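(* Let $Q$ be a real, symmetric, positive definite $n\times n$ matrix and let $B$ be a real $n\times n$ matrix all of whose eigenvalues have negative real parts. There exists a constant $C<\infty$, depending only on $n$, $Q$ and $B$, such that for all functions $f\in L^1(\gamma_\infty)$ with $\|f\|_{L^1(\gamma_\infty)}=1$ and all $\alpha>2$ $$\gamma_\infty\Big\{x\in\mathbb R^n:\sup_{t>1}|\mathcal H_tf(x)|>\alpha\Big\}\le\frac{C}{\alpha\sqrt{\log\alpha}}.$$ In particular, the maximal operator $f\mapsto\sup_{t>1}|\mathcal H_tf(x)|$ is of weak type $(1,1)$ with respect to $\gamma_\infty$; that is, for some constant $C=C(n,Q,B)$, $\gamma_\infty\{x:\sup_{t>1}|\mathcal H_tf(x)|>\alpha\}\le \frac C\alpha\|f\|_{L^1(\gamma_\infty)}$ for all $\alpha>0$ and all $f\in L^1(\gamma_\infty)$.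
   Context: For $0<t\le+\infty$ let $Q_t=\int_0^t e^{sB}Qe^{sB^*}\,ds$, a symmetric positive definite matrix, and let $\gamma_t$ be the Gaussian probability measure on $\mathbb R^n$ with density $y\mapsto(2\pi)^{-n/2}(\det Q_t)^{-1/2}\exp\left(-\frac12\langle Q_t^{-1}y,y\rangle\right)$ with respect to Lebesgue measure. The Ornstein--Uhlenbeck semigroup $(\mathcal H_t)_{t>0}$ with covariance $Q$ and drift $B$ is given by Kolmogorov's formula $\mathcal H_tf(x)=\int f(e^{tB}x-y)\,d\gamma_t(y)$, $x\in\mathbb R^n$, for bounded continuous $f$. Equivalently, $\mathcal H_tf(x)=\int K_t(x,u)f(u)\,d\gamma_\infty(u)$, an absolutely convergent integral for every $f\in L^1(\gamma_\infty)$, $t>0$, $x\in\mathbb R^n$, which defines $\mathcal H_tf$ for $f\in L^1(\gamma_\infty)$. Here the Mehler kernel is $$K_t(x,u)=\Big(\frac{\det Q_\infty}{\det Q_t}\Big)^{1/2}\exp(R(x))\exp\Big[-\tfrac12\big\langle(Q_t^{-1}-Q_\infty^{-1})(u-D_tx),\,u-D_tx\big\rangle\Big],$$ with $R(x)=\frac12\langle Q_\infty^{-1}x,x\rangle$ and $D_t=Q_\infty e^{-tB^*}Q_\infty^{-1}$. The measure $\gamma_\infty$ is invariant under $\mathcal H_t$. *)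

theory Defs
  imports "HOL-Analysis.Analysis"
begin

definition positive_definite :: "real^'n^'n \<Rightarrow> bool" where
  "positive_definite A \<longleftrightarrow> (\<forall>x. x \<noteq> 0 \<longrightarrow> (A *v x) \<bullet> x > 0)"

text \<open>Eigenvalues of a real matrix are taken over the complex numbers.\<close>

definition complex_eigenvalue :: "real^'n^'n \<Rightarrow> complex \<Rightarrow> bool" where
  "complex_eigenvalue A z \<longleftrightarrow>
     (\<exists>v::complex^'n. v \<noteq> 0 \<and> (\<chi> i j. complex_of_real (A $ i $ j)) *v v = z *s v)"

text \<open>Both \<open>(^)\<close> and \<open>exp\<close> would be wrong here: the product \<open>(*)\<close> on \<open>real^'n^'n\<close> is
  componentwise, not the matrix product.\<close>

primrec matrix_power :: "real^'n^'n \<Rightarrow> nat \<Rightarrow> real^'n^'n" where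
  "matrix_power A 0 = mat 1"
| "matrix_power A (Suc k) = A ** matrix_power A k"

definition matrix_exp :: "real^'n^'n \<Rightarrow> real^'n^'n" where
  "matrix_exp A = (\<Sum>k. (1 / fact k) *\<^sub>R matrix_power A k)"

text \<open>The time parameter is extended real, so that \<open>t = \<infinity>\<close> gives the covariance of the
  invariant measure.\<close>

definition ou_cov :: "real^'n^'n \<Rightarrow> real^'n^'n \<Rightarrow> ereal \<Rightarrow> real^'n^'n" where
  "ou_cov Q B t = (LINT s:{s. 0 \<le> s \<and> ereal s \<le> t}|lborel.
     matrix_exp (s *\<^sub>R B) ** Q ** matrix_exp (s *\<^sub>R transpose B))"

definition ou_gauss :: "real^'n^'n \<Rightarrow> real^'n^'n \<Rightarrow> ereal \<Rightarrow> (real^'n) measure" where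
  "ou_gauss Q B t = density lborel (\<lambda>y. ennreal
     ((2 * pi) powr (- real CARD('n) / 2) * det (ou_cov Q B t) powr (- 1 / 2) *
      exp (- (1 / 2) * ((matrix_inv (ou_cov Q B t) *v y) \<bullet> y))))"

definition ou_D :: "real^'n^'n \<Rightarrow> real^'n^'n \<Rightarrow> real \<Rightarrow> real^'n^'n" where
  "ou_D Q B t =
     ou_cov Q B \<infinity> ** matrix_exp (- t *\<^sub>R transpose B) ** matrix_inv (ou_cov Q B \<infinity>)"

definition ou_R :: "real^'n^'n \<Rightarrow> real^'n^'n \<Rightarrow> real^'n \<Rightarrow> real" where
  "ou_R Q B x = 1 / 2 * ((matrix_inv (ou_cov Q B \<infinity>) *v x) \<bullet> x)"

definition mehler_kernel ::
    "real^'n^'n \<Rightarrow> real^'n^'n \<Rightarrow> real \<Rightarrow> real^'n \<Rightarrow> real^'n \<Rightarrow> real" where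
  "mehler_kernel Q B t x u =
     sqrt (det (ou_cov Q B \<infinity>) / det (ou_cov Q B (ereal t))) * exp (ou_R Q B x) *
     exp (- (1 / 2) *
       (((matrix_inv (ou_cov Q B (ereal t)) - matrix_inv (ou_cov Q B \<infinity>)) *v (u - ou_D Q B t *v x))
         \<bullet> (u - ou_D Q B t *v x)))"

text \<open>The semigroup on integrable functions, as an integral against the Mehler kernel; for bounded
  continuous \<open>f\<close> it agrees with Kolmogorov's formula.\<close>

definition ou_semigroup ::
    "real^'n^'n \<Rightarrow> real^'n^'n \<Rightarrow> real \<Rightarrow> (real^'n \<Rightarrow> real) \<Rightarrow> real^'n \<Rightarrow> real" where
  "ou_semigroup Q B t f x = (LINT u|ou_gauss Q B \<infinity>. mehler_kernel Q B t x u * f u)"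

text \<open>The supremum is taken in the extended reals, since it need not be finite.\<close>

definition ou_maximal ::
    "real^'n^'n \<Rightarrow> real^'n^'n \<Rightarrow> (real^'n \<Rightarrow> real) \<Rightarrow> real^'n \<Rightarrow> ereal" where
  "ou_maximal Q B f x = (SUP t\<in>{1<..}. ereal \<bar>ou_semigroup Q B t f x\<bar>)"

text \<open>Measurability of the level sets is required explicitly, because \<open>emeasure\<close> is \<open>0\<close> on
  non-measurable sets.\<close>

definition weak_type_1_1 :: "'a measure \<Rightarrow> (('a \<Rightarrow> real) \<Rightarrow> 'a \<Rightarrow> ereal) \<Rightarrow> bool" where
  "weak_type_1_1 M T \<longleftrightarrow>
     (\<exists>C\<ge>0. \<forall>f \<alpha>. integrable M f \<longrightarrow> \<alpha> > 0 \<longrightarrow>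
        {x \<in> space M. T f x > ereal \<alpha>} \<in> sets M \<and>
        emeasure M {x \<in> space M. T f x > ereal \<alpha>} \<le> ennreal (C / \<alpha> * (LINT x|M. \<bar>f x\<bar>)))"

end

theory Submission
  imports Defs "HOL-Computational_Algebra.Fundamental_Theorem_Algebra"
begin

text \<open>
  Write \<open>E t\<close> for the matrix exponential of \<open>t B\<close>, \<open>S\<close> for the covariance at time \<open>\<infinity>\<close>, and
  \<open>N x\<close> for the norm \<open>sqrt \<langle>S\<^sup>-\<^sup>1 x, x\<rangle>\<close>, so that the invariant density is a multiple of
  \<open>exp (- N x\<^sup>2 / 2)\<close>. The flow \<open>P t = S E(t)\<^sup>T S\<^sup>-\<^sup>1\<close> (the matrix \<open>D\<^bsub>-t\<^esub>\<close> of the paper) contracts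
  \<open>N\<close>, and for \<open>t \<ge> 1\<close> the Mehler kernel is at most
  \<open>C exp (N x\<^sup>2 / 2) exp (- N (x - P t u)\<^sup>2 / 2)\<close>. Hence the maximal function is bounded by
  \<open>C exp (N x\<^sup>2 / 2) F x\<close>, where \<open>F \<le> 1\<close> integrates against \<open>|f|\<close> a kernel concentrated around
  the trajectories, and contraction makes \<open>F\<close> nondecreasing along the flow.

  If \<open>C exp (N x\<^sup>2 / 2) F x > \<alpha>\<close>, then \<open>N x \<ge> \<rho>\<close> with \<open>\<rho>\<close> of order \<open>sqrt (ln \<alpha>)\<close>. Flowing such a
  point into the shell \<open>\<rho> - 1 \<le> N \<le> \<rho>\<close>, where \<open>F\<close> is at least as large, reduces the measure of the
  level set to \<open>1 / (\<alpha> \<rho>)\<close> times the integral of \<open>F\<close> over the shell. That integral is bounded,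
  because \<open>N\<close> changes along a trajectory at a rate comparable with its speed: a trajectory meets
  the shell in a piece of bounded length, and the kernel is Gaussian around it.
\<close>

section \<open>The matrix exponential\<close>

text \<open>The Lyapunov identity \<open>B ** S + S ** transpose B = - Q\<close> carries the
  algebra: it yields the closed form \<open>S - E t ** S ** transpose (E t)\<close> of the
  covariance at time \<open>t\<close>, its positivity, and two-sided exponential rates for the flow.
  The restriction to \<open>t \<ge> 1\<close> keeps the determinant in the kernel away from 0 and
  leaves Gaussians of one fixed width around \<open>P t *v u\<close>. The supremum over
  \<open>t\<close> is then moved inside the integral over \<open>u\<close>: the maximal function is
  dominated by a positive operator, linear in \<open>|f|\<close> and free of \<open>t\<close>, and
  Fubini reduces the shell estimate to one trajectory at a time. The obstacle is the factor
  \<open>exp (\<psi> x / 2)\<close>, which cancels the Gaussian weight: a direct Chebyshev estimate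
  sees the whole length of a trajectory, which is unbounded. Comparing points along the flow
  localises the estimate to a shell whose unit width matches the width of the Gaussians. Points with
  \<open>\<psi> x > 2 * \<rho>\<^sup>2\<close> could take arbitrarily long to reach the shell; there
  the Gaussian mass alone is small enough.\<close>

lemma bounded_bilinear_matrix_mult:
  "bounded_bilinear ((**) :: real^'n^'m \<Rightarrow> real^'p^'n \<Rightarrow> real^'p^'m)"
  unfolding bilinear_conv_bounded_bilinear[symmetric] bilinear_def
  by (auto intro!: linearI simp: matrix_matrix_mult_def vec_eq_iff algebra_simps sum.distrib
      sum_distrib_left)

lemma bounded_bilinear_matrix_vector_mult:
  "bounded_bilinear ((*v) :: real^'n^'m \<Rightarrow> real^'n \<Rightarrow> real^'m)"
  unfolding bilinear_conv_bounded_bilinear[symmetric] bilinear_def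
  by (auto intro!: linearI simp: matrix_vector_mult_def vec_eq_iff algebra_simps sum.distrib
      sum_distrib_left)

lemma bounded_linear_transpose: "bounded_linear (transpose :: real^'n^'m \<Rightarrow> real^'m^'n)"
  unfolding linear_conv_bounded_linear[symmetric]
  by (auto intro!: linearI simp: transpose_def vec_eq_iff)

lemma bounded_linear_entry: "bounded_linear (\<lambda>A :: real^'n^'m. A $ i $ j)"
  unfolding linear_conv_bounded_linear[symmetric]
  by (auto intro!: linearI)

text \<open>Bilinearity gives submultiplicativity of the norm up to a constant \<open>K\<close>; the
  resulting geometric bound is what the exponential series is compared with.\<close>

lemma matrix_power_norm_bound:
  "\<exists>K\<ge>0. \<forall>(A::real^'n^'n) k. norm (matrix_power A k) \<le> norm (mat 1 :: real^'n^'n) * (K * norm A) ^ k"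
proof -
  obtain K where K: "K \<ge> 0" "\<And>(A::real^'n^'n) (B::real^'n^'n). norm (A ** B) \<le> norm A * norm B * K"
    using bounded_bilinear.nonneg_bounded[OF bounded_bilinear_matrix_mult] by blast
  have "norm (matrix_power A k) \<le> norm (mat 1 :: real^'n^'n) * (K * norm A) ^ k" for A :: "real^'n^'n" and k
  proof (induction k)
    case (Suc k)
    have "norm (matrix_power A (Suc k)) \<le> norm A * norm (matrix_power A k) * K"
      using K(2) by simp
    also have "\<dots> \<le> norm A * (norm (mat 1 :: real^'n^'n) * (K * norm A) ^ k) * K"
      by (intro mult_right_mono mult_left_mono Suc K) auto
    finally show ?case by (simp add: mult_ac)
  qed auto
  with K show ?thesis by blast
qed

lemma matrix_exp_summable: "summable (\<lambda>k. (1 / fact k) *\<^sub>R matrix_power (A::real^'n^'n) k)"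
proof -
  obtain K where K: "\<And>(A::real^'n^'n) k. norm (matrix_power A k) \<le> norm (mat 1 :: real^'n^'n) * (K * norm A) ^ k"
    using matrix_power_norm_bound by blast
  have "summable (\<lambda>k. norm (mat 1 :: real^'n^'n) * (inverse (fact k) * (K * norm A) ^ k))"
    by (intro summable_mult summable_exp)
  then show ?thesis
    by (rule summable_comparison_test')
      (use K[of A] in \<open>auto simp: divide_simps mult_ac\<close>)
qed

lemma matrix_power_scaleR: "matrix_power (t *\<^sub>R A) k = t ^ k *\<^sub>R matrix_power (A::real^'n^'n) k"
  by (induction k)
    (simp_all add: bounded_bilinear.scaleR_left[OF bounded_bilinear_matrix_mult]
      bounded_bilinear.scaleR_right[OF bounded_bilinear_matrix_mult] mult_ac)

lemma matrix_power_commute: "matrix_power A k ** A = A ** matrix_power (A::real^'n^'n) k"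
  by (induction k) (simp_all add: matrix_mul_assoc[symmetric])

lemma transpose_matrix_power: "transpose (matrix_power A k) = matrix_power (transpose (A::real^'n^'n)) k"
  by (induction k) (simp_all add: matrix_transpose_mul matrix_power_commute transpose_mat)

lemma matrix_exp_0 [simp]: "matrix_exp (0::real^'n^'n) = mat 1"
proof -
  have z: "matrix_power (0::real^'n^'n) k = (if k = 0 then mat 1 else 0)" for k
    by (cases k) (auto simp: bounded_bilinear.zero_left[OF bounded_bilinear_matrix_mult])
  have "(\<lambda>k. (1 / fact k) *\<^sub>R matrix_power (0::real^'n^'n) k) = (\<lambda>k. if k = 0 then mat 1 else 0)"
    by (auto simp: z fun_eq_iff)
  then show ?thesis unfolding matrix_exp_def
    using sums_unique[OF sums_single[of 0 "\<lambda>_. mat 1 :: real^'n^'n"]] by simp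
qed

lemma transpose_matrix_exp: "transpose (matrix_exp A) = matrix_exp (transpose (A::real^'n^'n))"
  unfolding matrix_exp_def
  by (subst bounded_linear.suminf[OF bounded_linear_transpose matrix_exp_summable])
    (simp add: transpose_matrix_power linear_cmul[OF bounded_linear.linear[OF bounded_linear_transpose]])

text \<open>Entrywise the exponential is a real power series in \<open>t\<close> that converges
  everywhere, so the scalar theorem on termwise differentiation applies.\<close>

lemma matrix_exp_entry:
  "(matrix_exp (t *\<^sub>R A)) $ i $ j = (\<Sum>k. (matrix_power A k $ i $ j / fact k) * t ^ k)"
  unfolding matrix_exp_def
  by (subst bounded_linear.suminf[OF bounded_linear_entry matrix_exp_summable])
    (simp add: matrix_power_scaleR mult_ac divide_inverse)

lemma matrix_exp_entry_summable:
  "summable (\<lambda>k. (matrix_power A k $ i $ j / fact k) * t ^ k)"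
  using bounded_linear.summable[OF bounded_linear_entry matrix_exp_summable[of "t *\<^sub>R A"], of i j]
  by (simp add: matrix_power_scaleR mult_ac divide_inverse)

lemma matrix_exp_mult_entry:
  "(A ** matrix_exp (t *\<^sub>R A)) $ i $ j = (\<Sum>k. (matrix_power A (Suc k) $ i $ j / fact k) * t ^ k)"
proof -
  have 1: "bounded_linear (\<lambda>X. A ** X)" 
    using bounded_bilinear.bounded_linear_right[OF bounded_bilinear_matrix_mult] .
  have "(A ** matrix_exp (t *\<^sub>R A)) $ i $ j = (\<Sum>k. (A ** ((1 / fact k) *\<^sub>R matrix_power (t *\<^sub>R A) k)) $ i $ j)"
    unfolding matrix_exp_def
    by (subst bounded_linear.suminf[OF bounded_linear_compose[OF bounded_linear_entry 1] matrix_exp_summable]) simp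
  then show ?thesis
    by (simp add: matrix_power_scaleR mult_ac divide_inverse
      bounded_bilinear.scaleR_right[OF bounded_bilinear_matrix_mult])
qed

lemma matrix_exp_commute: "A ** matrix_exp (t *\<^sub>R A) = matrix_exp (t *\<^sub>R A) ** (A::real^'n^'n)"
proof -
  have 1: "bounded_linear (\<lambda>X. A ** X)" "bounded_linear (\<lambda>X. X ** A)" 
    using bounded_bilinear.bounded_linear_right[OF bounded_bilinear_matrix_mult]
      bounded_bilinear.bounded_linear_left[OF bounded_bilinear_matrix_mult] by auto
  show ?thesis
    unfolding matrix_exp_def
    unfolding bounded_linear.suminf[OF 1(1) matrix_exp_summable] bounded_linear.suminf[OF 1(2) matrix_exp_summable]
    by (simp add: matrix_power_scaleR matrix_power_commute bounded_bilinear.scaleR_right[OF bounded_bilinear_matrix_mult]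
       bounded_bilinear.scaleR_left[OF bounded_bilinear_matrix_mult])
qed

lemma has_vector_derivative_matrixI:
  fixes f :: "real \<Rightarrow> real^'n^'m"
  assumes "\<And>i j. ((\<lambda>t. f t $ i $ j) has_real_derivative f' $ i $ j) (at t)"
  shows "(f has_vector_derivative f') (at t)"
  unfolding has_vector_derivative_def
proof (subst has_derivative_componentwise_within, rule ballI)
  fix b :: "real^'n^'m" assume "b \<in> Basis"
  then obtain i j where b: "b = axis i (axis j 1)"
    by (auto simp: Basis_vec_def)
  show "((\<lambda>x. f x \<bullet> b) has_derivative (\<lambda>x. (x *\<^sub>R f') \<bullet> b)) (at t)"
    using assms[of i j] unfolding has_field_derivative_def
    by (simp add: b inner_axis mult.commute[of _ "f' $ i $ j"])
qed

lemma matrix_exp_has_vector_derivative: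
  "((\<lambda>t. matrix_exp (t *\<^sub>R A)) has_vector_derivative (A ** matrix_exp (t *\<^sub>R (A::real^'n^'n)))) (at t)"
proof (rule has_vector_derivative_matrixI)
  fix i j
  have "((\<lambda>t. \<Sum>k. (matrix_power A k $ i $ j / fact k) * t ^ k) has_real_derivative
     (\<Sum>k. diffs (\<lambda>k. matrix_power A k $ i $ j / fact k) k * t ^ k)) (at t)"
    by (rule termdiffs_strong_converges_everywhere) (rule matrix_exp_entry_summable)
  moreover have "diffs (\<lambda>k. matrix_power A k $ i $ j / fact k) k = matrix_power A (Suc k) $ i $ j / fact k" for k
  proof -
    have "(1 + real k) \<noteq> 0" by linarith
    then show ?thesis by (simp add: diffs_def del: matrix_power.simps)
  qed
  ultimately show "((\<lambda>t. matrix_exp (t *\<^sub>R A) $ i $ j) has_real_derivative (A ** matrix_exp (t *\<^sub>R A)) $ i $ j) (at t)"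
    by (simp add: matrix_exp_entry matrix_exp_mult_entry del: matrix_power.simps)
qed

text \<open>The product with the times \<open>c - t\<close> and \<open>t\<close> has derivative 0,
  because \<open>A\<close> commutes with its exponential; its value at \<open>t\<close> is compared
  with that at 0, where one factor is the identity.\<close>

lemma matrix_exp_add:
  "matrix_exp (s *\<^sub>R A) ** matrix_exp (t *\<^sub>R A) = matrix_exp ((s + t) *\<^sub>R (A::real^'n^'n))"
proof -
  define c where "c = s + t"
  let ?f = "\<lambda>t. matrix_exp ((c - t) *\<^sub>R A) ** matrix_exp (t *\<^sub>R A)"
  have d1: "((\<lambda>t. matrix_exp ((c - t) *\<^sub>R A)) has_vector_derivative (-1) *\<^sub>R (A ** matrix_exp ((c - t) *\<^sub>R A))) (at t)" for t
  proof -
    have "((\<lambda>t. c - t) has_vector_derivative (-1::real)) (at t)"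
      by (auto intro!: derivative_eq_intros)
    from vector_diff_chain_at[OF this matrix_exp_has_vector_derivative]
    show ?thesis by (simp add: o_def)
  qed
  have "(?f has_vector_derivative 0) (at t within UNIV)" for t
    using bounded_bilinear.has_vector_derivative[OF bounded_bilinear_matrix_mult d1[of t] matrix_exp_has_vector_derivative[of A t]]
    by (simp add: matrix_exp_commute matrix_mul_assoc[symmetric] 
       bounded_bilinear.minus_left[OF bounded_bilinear_matrix_mult])
  then obtain C where "\<And>t. t \<in> UNIV \<Longrightarrow> ?f t = C"
    using has_vector_derivative_zero_constant[OF convex_UNIV, of ?f] by blast
  from this[of t] this[of 0] show ?thesis by (simp add: c_def)
qed

section \<open>Exponential decay from the spectrum\<close>

definition poly_apply :: "complex^'n^'n \<Rightarrow> complex poly \<Rightarrow> complex^'n \<Rightarrow> complex^'n" where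
  "poly_apply A p v = (\<Sum>i\<le>degree p. coeff p i *s (((*v) A) ^^ i) v)"

lemma poly_apply_bound:
  assumes "\<And>i. i > m \<Longrightarrow> coeff p i = 0"
  shows "poly_apply A p v = (\<Sum>i\<le>m. coeff p i *s (((*v) A) ^^ i) v)"
  unfolding poly_apply_def
proof (rule sum.mono_neutral_left)
  show "{..degree p} \<subseteq> {..m}"
    using assms by (auto intro: degree_le order_trans)
qed (auto simp: coeff_eq_0)

lemma matrix_vector_funpow_linear:
  "(((*v) (A::complex^'n^'n)) ^^ i) (a *s v + b *s w) = a *s (((*v) A) ^^ i) v + b *s (((*v) A) ^^ i) (w::complex^'n)"
  by (induction i) (simp_all add: matrix_vector_right_distrib vector_scalar_commute)

lemma poly_apply_linear:
  "poly_apply A p (a *s v + b *s w) = a *s poly_apply A p v + b *s poly_apply A p w"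
  by (simp add: poly_apply_def matrix_vector_funpow_linear vec.scale_sum_right sum.distrib vector_add_ldistrib
      vector_smult_assoc mult.commute)

lemma matrix_vector_mult_sum: "A *v (\<Sum>i\<in>S. f i) = (\<Sum>i\<in>S. A *v f i)"
  by (induction S rule: infinite_finite_induct) (simp_all add: matrix_vector_right_distrib)

lemma poly_apply_mult_vec: "poly_apply A p (A *v v) = A *v poly_apply A p v"
  by (simp add: poly_apply_def matrix_vector_mult_sum vector_scalar_commute funpow_swap1)

text \<open>Splitting off a linear factor trades one degree of the polynomial for one application of
  \<open>A - l\<close> to the vector; this drives the induction on the degree and exhibits
  eigenvectors.\<close>

lemma poly_apply_root:
  "poly_apply A ([:- l, 1:] * q) v = poly_apply A q (A *v v - l *s v)"
proof -
  define m where "m = Suc (degree q)"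
  have "[:- l, 1:] * q = pCons 0 q + smult (- l) q" by simp
  then have c: "coeff ([:- l, 1:] * q) i = (case i of 0 \<Rightarrow> 0 | Suc j \<Rightarrow> coeff q j) - l * coeff q i" for i
    by (auto simp: coeff_pCons split: nat.splits)
  have "poly_apply A ([:- l, 1:] * q) v = (\<Sum>i\<le>m. coeff ([:- l, 1:] * q) i *s (((*v) A) ^^ i) v)"
    by (rule poly_apply_bound) (auto simp: c m_def coeff_eq_0 split: nat.splits)
  also have "\<dots> = (\<Sum>i\<le>m. (case i of 0 \<Rightarrow> 0 | Suc j \<Rightarrow> coeff q j) *s (((*v) A) ^^ i) v)
       - l *s (\<Sum>i\<le>m. coeff q i *s (((*v) A) ^^ i) v)"
    unfolding c by (simp add: vec.scale_left_diff_distrib sum_subtractf vec.scale_sum_right vector_smult_assoc)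
  also have "(\<Sum>i\<le>m. coeff q i *s (((*v) A) ^^ i) v) = poly_apply A q v"
    by (rule poly_apply_bound[symmetric]) (auto simp: m_def coeff_eq_0)
  also have "(\<Sum>i\<le>m. (case i of 0 \<Rightarrow> 0 | Suc j \<Rightarrow> coeff q j) *s (((*v) A) ^^ i) v) = poly_apply A q (A *v v)"
    unfolding m_def poly_apply_def by (subst sum.atMost_Suc_shift) (simp add: funpow_swap1)
  also have "poly_apply A q (A *v v) - l *s poly_apply A q v = poly_apply A q (1 *s (A *v v) + (- l) *s v)"
    by (subst poly_apply_linear) simp
  finally show ?thesis by simp
qed

text \<open>The iterates of \<open>v\<close> up to the real dimension \<open>m\<close> are
  \<open>m + 1\<close> vectors, hence linearly dependent over the reals, and the coefficients of a
  dependence form the polynomial. If two iterates coincide, their set may be too small for this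
  count, and the difference of two monomials serves instead.\<close>

lemma exists_annihilating_poly:
  fixes A :: "complex^'n^'n"
  shows "\<exists>p. p \<noteq> 0 \<and> poly_apply A p v = 0"
proof -
  define f where "f k = (((*v) A) ^^ k) v" for k
  define m where "m = DIM(complex^'n)"
  have main: "\<exists>p. p \<noteq> 0 \<and> poly_apply A p v = 0"
    if c: "(\<Sum>k\<le>m. complex_of_real (c k) *s f k) = 0" "c j \<noteq> 0" "j \<le> m" for c j
  proof -
    define p where "p = (\<Sum>k\<le>m. monom (complex_of_real (c k)) k)"
    have cf: "coeff p i = (if i \<le> m then complex_of_real (c i) else 0)" for i
      by (simp add: p_def coeff_sum)
    then have "coeff p j \<noteq> 0" using c by simp
    then have "p \<noteq> 0" by auto
    moreover have "poly_apply A p v = 0"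
      using c(1) by (subst poly_apply_bound[of m]) (auto simp: cf f_def)
    ultimately show ?thesis by blast
  qed
  show ?thesis
  proof (cases "inj_on f {..m}")
    case False
    then obtain i j where ij: "i \<le> m" "j \<le> m" "i \<noteq> j" "f i = f j"
      by (auto simp: inj_on_def)
    define c where "c k = (if k = i then 1 else if k = j then -1 else 0 :: real)" for k
    have "(\<Sum>k\<le>m. complex_of_real (c k) *s f k) = (\<Sum>k\<le>m. (if k = i then f i else 0) - (if k = j then f j else 0))"
      using ij by (intro sum.cong) (auto simp: c_def)
    also have "\<dots> = 0" using ij by (simp add: sum_subtractf)
    finally show ?thesis using main[of c i] ij by (simp add: c_def)
  next
    case True
    have "card (f ` {..m}) = Suc m" using True by (simp add: card_image)
    then have "dependent (f ` {..m})"
      using independent_bound[of "f ` {..m}"] by (auto simp: m_def)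
    then obtain u j where u: "j \<le> m" "u (f j) \<noteq> 0" "(\<Sum>w\<in>f ` {..m}. u w *\<^sub>R w) = 0"
      by (subst (asm) dependent_finite) auto
    have sc: "complex_of_real r *s w = r *\<^sub>R w" for r and w :: "complex^'n"
      by (simp add: vec_eq_iff scaleR_conv_of_real[where 'a=complex])
    have "(\<Sum>k\<le>m. complex_of_real (u (f k)) *s f k) = 0"
      using u(3) by (simp add: sc sum.reindex[OF True])
    then show ?thesis using main[of "\<lambda>k. u (f k)"] u by blast
  qed
qed

definition complex_matrix :: "real^'n^'n \<Rightarrow> complex^'n^'n" where
  "complex_matrix A = (\<chi> i j. complex_of_real (A $ i $ j))"

lemma complex_matrix_mult_vec_mult:
  "complex_matrix (A ** B) *v v = complex_matrix A *v (complex_matrix B *v v)"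
proof -
  have "complex_matrix (A ** B) = complex_matrix A ** complex_matrix B"
    by (simp add: complex_matrix_def matrix_matrix_mult_def vec_eq_iff)
  then show ?thesis by (simp add: matrix_vector_mul_assoc)
qed

lemma bounded_linear_complex_matrix_vec:
  "bounded_linear (\<lambda>A :: real^'n^'n. complex_matrix A *v v)"
  unfolding linear_conv_bounded_linear[symmetric]
  by (auto intro!: linearI simp: complex_matrix_def matrix_vector_mult_def vec_eq_iff algebra_simps sum.distrib
      scaleR_sum_right sum_distrib_left scaleR_conv_of_real[where 'a=complex])

lemma norm_vector_smult: "norm (c *s v) = cmod c * norm (v :: complex^'n)"
  by (simp add: norm_vec_def L2_set_right_distrib norm_mult)

lemma bounded_bilinear_vector_smult: "bounded_bilinear ((*s) :: complex \<Rightarrow> complex^'n \<Rightarrow> _)"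
  unfolding bilinear_conv_bounded_bilinear[symmetric] bilinear_def
  by (auto intro!: linearI simp: vec_eq_iff algebra_simps)

text \<open>Induction on the degree. After removal of a root \<open>l\<close>, the vector
  \<open>w = (A - l) v\<close> is annihilated by the quotient and its orbit decays; multiplied by
  \<open>exp (- l t)\<close>, the orbit of \<open>v\<close> has derivative
  \<open>exp (- l t) E(t) w\<close>, which is integrated. Repeated roots, which would bring in
  powers of \<open>t\<close>, are absorbed by lowering the rate.\<close>

lemma annihilated_orbit_decay:
  fixes B :: "real^'n^'n"
  assumes "p \<noteq> 0" "poly_apply (complex_matrix B) p v = 0"
    and "\<And>z. poly p z = 0 \<Longrightarrow> Re z < 0"
  shows "\<exists>C\<ge>0. \<exists>c>0. \<forall>t\<ge>0. norm (complex_matrix (matrix_exp (t *\<^sub>R B)) *v v) \<le> C * exp (- c * t)"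
  using assms
proof (induction "degree p" arbitrary: p v)
  case 0
  then obtain a where a: "p = [:a:]" "a \<noteq> 0"
    by (metis degree_eq_zeroE pCons_0_0)
  have "v = 0" using 0(3) a by (simp add: poly_apply_def)
  then show ?case by (intro exI[of _ 0] conjI exI[of _ 1]) auto
next
  case (Suc d)
  have "\<not> constant (poly p)" using Suc(2) by (simp add: constant_degree)
  then obtain l where l: "poly p l = 0"
    using fundamental_theorem_of_algebra by blast
  then obtain q where q: "p = [:- l, 1:] * q"
    by (auto simp: poly_eq_0_iff_dvd)
  have q0: "q \<noteq> 0" using Suc(3) q by auto
  have dq: "d = degree q" using Suc(2) q0 unfolding q by (subst (asm) degree_mult_eq) auto
  let ?A = "complex_matrix B"
  let ?E = "\<lambda>t. complex_matrix (matrix_exp (t *\<^sub>R B))"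
  define w where "w = ?A *v v - l *s v"
  have "poly_apply ?A q w = 0"
    using Suc(4) unfolding q poly_apply_root w_def .
  from Suc(1)[OF dq q0 this] Suc(5) obtain C c where
    Cc: "C \<ge> 0" "c > 0" "\<And>t. t \<ge> 0 \<Longrightarrow> norm (?E t *v w) \<le> C * exp (- c * t)"
    by (auto simp: q)
  define a where "a = - Re l"
  have a: "a > 0" using Suc(5)[OF l] by (simp add: a_def)
  \<comment> \<open>The rate is strictly below \<open>a\<close>, so that
    \<open>exp ((a - e) * t)\<close> has the growing primitive with factor
    \<open>1 / (a - e)\<close>, even if \<open>c\<close> and \<open>a\<close> agree.\<close>
  define e where "e = min c (a / 2)"
  have e: "e > 0" "e < a" "e \<le> c" using a Cc by (auto simp: e_def)
  define z where "z t = exp (- l * of_real t) *s (?E t *v v)" for t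
  have dE: "((\<lambda>t. ?E t *v v) has_vector_derivative (?E t *v (?A *v v))) (at t)" for t
    using bounded_linear.has_vector_derivative[OF bounded_linear_complex_matrix_vec matrix_exp_has_vector_derivative[of B t]]
    by (simp add: matrix_exp_commute complex_matrix_mult_vec_mult)
  have dx: "((\<lambda>t. exp (- l * of_real t)) has_vector_derivative (- l * exp (- l * of_real t))) (at t)" for t
    by (auto intro!: derivative_eq_intros has_vector_derivative_real_field simp: mult_ac)
  have dz: "(z has_vector_derivative (exp (- l * of_real t) *s (?E t *v w))) (at t)" for t
  proof -
    have "exp (- l * of_real t) *s (?E t *v (?A *v v)) + (- l * exp (- l * of_real t)) *s (?E t *v v)
       = exp (- l * of_real t) *s (?E t *v w)"
      unfolding w_def by (simp add: vec_eq_iff matrix_vector_mult_def right_diff_distrib sum_subtractf sum_distrib_left mult_ac)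
    with bounded_bilinear.has_vector_derivative[OF bounded_bilinear_vector_smult dx[of t] dE[of t]]
    show ?thesis unfolding z_def by simp
  qed
  have zb: "norm (z t - z 0) \<le> C / (a - e) * exp ((a - e) * t) - C / (a - e) * exp ((a - e) * 0)" if t: "t \<ge> 0" for t
  proof (cases "t = 0")
    case False
    show ?thesis
    proof (rule differentiable_bound_general[where f' = "\<lambda>t. exp (- l * of_real t) *s (?E t *v w)"
         and \<phi>' = "\<lambda>t. C * exp ((a - e) * t)"])
      show "0 < t" using t False by simp
      show "continuous_on {0..t} z"
        by (rule continuous_on_vector_derivative) (rule has_vector_derivative_at_within[OF dz])
      show "continuous_on {0..t} (\<lambda>t. C / (a - e) * exp ((a - e) * t))"
        by (intro continuous_intros)
      show "(z has_vector_derivative exp (- l * complex_of_real x) *s (?E x *v w)) (at x)" for x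
        by (rule dz)
      show "((\<lambda>t. C / (a - e) * exp ((a - e) * t)) has_vector_derivative C * exp ((a - e) * x)) (at x)" for x
        using e by (auto intro!: derivative_eq_intros simp: has_real_derivative_iff_has_vector_derivative[symmetric])
      fix x assume x: "0 < x" "x < t"
      have "norm (exp (- l * complex_of_real x) *s (?E x *v w)) = exp (a * x) * norm (?E x *v w)"
        by (simp add: norm_vector_smult a_def)
      also have "\<dots> \<le> exp (a * x) * (C * exp (- e * x))"
      proof (rule mult_left_mono)
        have "norm (?E x *v w) \<le> C * exp (- c * x)" using Cc(3) x by auto
        also have "\<dots> \<le> C * exp (- e * x)"
          using Cc(1) e(3) x by (intro mult_left_mono) auto
        finally show "norm (?E x *v w) \<le> C * exp (- e * x)" .
      qed auto
      also have "\<dots> = C * exp ((a - e) * x)" by (simp add: exp_add[symmetric] algebra_simps)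
      finally show "norm (exp (- l * complex_of_real x) *s (?E x *v w)) \<le> C * exp ((a - e) * x)" .
    qed
  qed auto
  have "norm (?E t *v v) \<le> (norm (z 0) + C / (a - e)) * exp (- e * t)" if t: "t \<ge> 0" for t
  proof -
    have "norm (z t) \<le> norm (z 0) + norm (z t - z 0)"
      using norm_triangle_ineq[of "z 0" "z t - z 0"] by simp
    also have "\<dots> \<le> norm (z 0) * exp ((a - e) * t) + C / (a - e) * exp ((a - e) * t)"
    proof (rule add_mono)
      show "norm (z 0) \<le> norm (z 0) * exp ((a - e) * t)"
        using e t by (intro mult_le_cancel_left1[THEN iffD2]) auto
      have "C / (a - e) \<ge> 0" using Cc e by simp
      with zb[OF t] show "norm (z t - z 0) \<le> C / (a - e) * exp ((a - e) * t)" by simp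
    qed
    also have "\<dots> = (norm (z 0) + C / (a - e)) * exp ((a - e) * t)" by (simp add: algebra_simps)
    finally have nz: "norm (z t) \<le> (norm (z 0) + C / (a - e)) * exp ((a - e) * t)" .
    have "norm (z t) = exp (a * t) * norm (?E t *v v)"
      by (simp add: z_def norm_vector_smult a_def)
    then have "norm (?E t *v v) = exp (- a * t) * norm (z t)"
      by (simp add: exp_minus)
    also have "\<dots> \<le> exp (- a * t) * ((norm (z 0) + C / (a - e)) * exp ((a - e) * t))"
      by (intro mult_left_mono nz) auto
    also have "\<dots> = (norm (z 0) + C / (a - e)) * (exp (- a * t) * exp ((a - e) * t))" by simp
    also have "exp (- a * t) * exp ((a - e) * t) = exp (- e * t)" by (simp add: exp_add[symmetric] algebra_simps)
    finally show ?thesis .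
  qed
  moreover have "norm (z 0) + C / (a - e) \<ge> 0" using Cc e by (simp add: add_nonneg_nonneg)
  ultimately show ?case using e(1) by blast
qed

text \<open>Take an annihilating polynomial of least degree. If \<open>l\<close> is a root, the
  quotient \<open>q\<close> does not annihilate \<open>v\<close>, and
  \<open>poly_apply ?A q v\<close> is an eigenvector for \<open>l\<close>; hence all roots lie in
  the left half-plane.\<close>

lemma stable_orbit_decay:
  fixes B :: "real^'n^'n"
  assumes "\<And>z. complex_eigenvalue B z \<Longrightarrow> Re z < 0"
  shows "\<exists>C\<ge>0. \<exists>c>0. \<forall>t\<ge>0. norm (complex_matrix (matrix_exp (t *\<^sub>R B)) *v v) \<le> C * exp (- c * t)"
proof -
  let ?A = "complex_matrix B"
  let ?P = "\<lambda>p. p \<noteq> 0 \<and> poly_apply ?A p v = 0"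
  obtain p0 where "?P p0" using exists_annihilating_poly by blast
  then obtain p where p: "?P p" and min: "\<And>q. ?P q \<Longrightarrow> degree p \<le> degree q"
    using ex_has_least_nat[of ?P p0 degree] by blast
  have "Re l < 0" if l: "poly p l = 0" for l
  proof -
    obtain q where q: "p = [:- l, 1:] * q" using l by (auto simp: poly_eq_0_iff_dvd)
    have q0: "q \<noteq> 0" using p q by auto
    have "degree p = Suc (degree q)" using q0 unfolding q by (subst degree_mult_eq) auto
    then have ne: "poly_apply ?A q v \<noteq> 0" using min[of q] q0 by auto
    have "0 = poly_apply ?A q (1 *s (?A *v v) + (- l) *s v)"
      using p unfolding q by (simp add: poly_apply_root[of _ l, simplified])
    also have "\<dots> = ?A *v poly_apply ?A q v - l *s poly_apply ?A q v"
      by (subst poly_apply_linear) (simp add: poly_apply_mult_vec)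
    finally have "complex_eigenvalue B l"
      unfolding complex_eigenvalue_def using ne by (auto simp: complex_matrix_def intro!: exI[of _ "poly_apply ?A q v"])
    with assms show ?thesis by blast
  qed
  then show ?thesis using annihilated_orbit_decay p by blast
qed

text \<open>The orbits of the coordinate vectors are the columns; there are finitely many, so the
  least of their rates serves for all entries.\<close>

lemma stable_matrix_exp_decay:
  fixes B :: "real^'n^'n"
  assumes "\<And>z. complex_eigenvalue B z \<Longrightarrow> Re z < 0"
  shows "\<exists>C\<ge>0. \<exists>c>0. \<forall>t\<ge>0. norm (matrix_exp (t *\<^sub>R B)) \<le> C * exp (- c * t)"
proof -
  have "\<forall>j. \<exists>C c. C \<ge> 0 \<and> c > 0 \<and> (\<forall>t\<ge>0. norm (complex_matrix (matrix_exp (t *\<^sub>R B)) *v axis j 1) \<le> C * exp (- c * t))"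
    using stable_orbit_decay[OF assms] by blast
  then obtain C c where
    C: "\<And>j. C j \<ge> 0" "\<And>j. c j > 0"
       "\<And>j t. t \<ge> 0 \<Longrightarrow> norm (complex_matrix (matrix_exp (t *\<^sub>R B)) *v axis j 1) \<le> C j * exp (- c j * t)"
    by metis
  define e where "e = Min (range c)"
  have e: "e > 0" "\<And>j. e \<le> c j" by (auto simp: e_def C)
  have "norm (matrix_exp (t *\<^sub>R B)) \<le> (\<Sum>i\<in>(UNIV::'n set). \<Sum>j\<in>UNIV. C j) * exp (- e * t)" if t: "t \<ge> 0" for t
  proof -
    let ?E = "matrix_exp (t *\<^sub>R B)"
    have "\<bar>?E $ i $ j\<bar> \<le> C j * exp (- e * t)" for i j
    proof -
      have "\<bar>?E $ i $ j\<bar> = norm ((complex_matrix ?E *v axis j 1) $ i)"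
        by (simp add: complex_matrix_def matrix_vector_mult_def axis_def if_distrib cong: if_cong)
      also have "\<dots> \<le> norm (complex_matrix ?E *v axis j 1)" by (rule Finite_Cartesian_Product.norm_nth_le)
      also have "\<dots> \<le> C j * exp (- c j * t)" using C t by blast
      also have "\<dots> \<le> C j * exp (- e * t)" using C(1) e(2)[of j] t
        by (intro mult_left_mono) (auto intro: mult_right_mono)
      finally show ?thesis .
    qed
    note ent = this
    have "norm ?E \<le> (\<Sum>i\<in>UNIV. norm (?E $ i))"
      unfolding norm_vec_def[of ?E] by (rule L2_set_le_sum) auto
    also have "\<dots> \<le> (\<Sum>i\<in>UNIV. \<Sum>j\<in>UNIV. \<bar>?E $ i $ j\<bar>)"
      by (intro sum_mono norm_le_l1_cart)
    also have "\<dots> \<le> (\<Sum>i\<in>(UNIV::'n set). \<Sum>j\<in>UNIV. C j * exp (- e * t))"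
      by (intro sum_mono ent)
    finally show ?thesis by (simp add: sum_distrib_right[symmetric] sum_distrib_left mult_ac)
  qed
  moreover have "(\<Sum>i\<in>(UNIV::'n set). \<Sum>j\<in>UNIV. C j) \<ge> 0" by (intro sum_nonneg C)
  ultimately show ?thesis using e(1) by blast
qed

section \<open>Covariance matrices\<close>

declare transpose_matrix_vector [simp del] vector_transpose_matrix [simp del]

lemma inner_matrix_vector_left: "(A *v x) \<bullet> y = x \<bullet> (transpose A *v (y::real^'n))"
  by (metis dot_lmul_matrix transpose_matrix_vector transpose_transpose)

lemma bounded_linear_quadratic_form: "bounded_linear (\<lambda>A::real^'n^'n. (A *v x) \<bullet> y)"
  by (rule bounded_linear_compose[OF bounded_linear_inner_left
        bounded_bilinear.bounded_linear_left[OF bounded_bilinear_matrix_vector_mult]])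

lemma matrix_inv_inverse:
  assumes "invertible (A::real^'n^'n)"
  shows "A ** matrix_inv A = mat 1" "matrix_inv A ** A = mat 1"
  using someI_ex[OF assms[unfolded invertible_def]] by (auto simp: matrix_inv_def)

lemma positive_definite_invertible:
  assumes "positive_definite A" shows "invertible A"
  unfolding invertible_left_inverse matrix_left_invertible_ker
  using assms by (metis positive_definite_def inner_zero_left less_irrefl)

lemma positive_definite_nonneg:
  assumes "positive_definite A" shows "(A *v x) \<bullet> x \<ge> 0"
  using assms by (cases "x = 0") (auto simp: positive_definite_def less_imp_le)

lemma positive_definite_bounds:
  fixes A :: "real^'n^'n"
  assumes "positive_definite A"
  shows "\<exists>m>0. \<exists>M>0. \<forall>x. m * (norm x)\<^sup>2 \<le> (A *v x) \<bullet> x \<and> (A *v x) \<bullet> x \<le> M * (norm x)\<^sup>2"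
proof -
  let ?q = "\<lambda>x. (A *v x) \<bullet> x"
  have cont: "continuous_on (sphere 0 1) ?q"
    by (intro continuous_intros matrix_vector_mult_linear_continuous_on)
  have ne: "sphere (0::real^'n) 1 \<noteq> {}" by simp
  obtain a where a: "a \<in> sphere 0 1" "\<And>x. x \<in> sphere 0 1 \<Longrightarrow> ?q a \<le> ?q x"
    using continuous_attains_inf[OF compact_sphere ne cont] by blast
  obtain b where b: "b \<in> sphere 0 1" "\<And>x. x \<in> sphere 0 1 \<Longrightarrow> ?q x \<le> ?q b"
    using continuous_attains_sup[OF compact_sphere ne cont] by blast
  have "a \<noteq> 0" "b \<noteq> 0" using a(1) b(1) by auto
  then have "?q a > 0" "?q b > 0" using assms by (auto simp: positive_definite_def)
  moreover have "?q a * (norm x)\<^sup>2 \<le> ?q x \<and> ?q x \<le> ?q b * (norm x)\<^sup>2" for x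
  proof (cases "x = 0")
    case False
    define y where "y = x /\<^sub>R norm x"
    have y: "y \<in> sphere 0 1" using False by (simp add: y_def)
    have "?q x = ?q (norm x *\<^sub>R y)" using False by (simp add: y_def)
    also have "\<dots> = (norm x)\<^sup>2 * ?q y"
      by (simp add: matrix_vector_mult_scaleR power2_eq_square)
    finally show ?thesis using a(2)[OF y] b(2)[OF y]
      by (simp add: mult.commute mult_right_mono)
  qed auto
  ultimately show ?thesis by blast
qed

lemma matrix_vector_has_vector_derivative:
  "(X has_vector_derivative X') F \<Longrightarrow> ((\<lambda>t. X t *v v) has_vector_derivative (X' *v (v::real^'n))) F"
  by (rule bounded_linear.has_vector_derivative[OF
        bounded_bilinear.bounded_linear_left[OF bounded_bilinear_matrix_vector_mult]])

lemma continuous_det: "continuous_on A (det :: real^'n^'n \<Rightarrow> real)"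
  unfolding det_def by (intro continuous_intros)

locale ornstein_uhlenbeck =
  fixes Q B :: "real^'n^'n"
  assumes sym_Q: "transpose Q = Q"
    and posdef_Q: "positive_definite Q"
    and stable: "\<And>z. complex_eigenvalue B z \<Longrightarrow> Re z < 0"
begin

definition E :: "real \<Rightarrow> real^'n^'n" where "E t = matrix_exp (t *\<^sub>R B)"

definition S :: "real^'n^'n" where "S = ou_cov Q B \<infinity>"

definition V :: "real \<Rightarrow> real^'n^'n" where "V t = E t ** Q ** transpose (E t)"

lemma E_0 [simp]: "E 0 = mat 1" by (simp add: E_def)

lemma E_add: "E (s + t) = E s ** E t" by (simp add: E_def matrix_exp_add)

lemma E_inverse: "E t ** E (- t) = mat 1" "E (- t) ** E t = mat 1"
  by (simp_all add: E_add[symmetric])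

lemma E_commute: "E t ** B = B ** E t" by (simp add: E_def matrix_exp_commute)

lemma E_deriv: "(E has_vector_derivative (B ** E t)) (at t)"
  unfolding E_def by (rule matrix_exp_has_vector_derivative)

lemma transpose_E_deriv:
  "((\<lambda>t. transpose (E t)) has_vector_derivative (transpose (E t) ** transpose B)) (at t)"
  using bounded_linear.has_vector_derivative[OF bounded_linear_transpose E_deriv]
  by (simp add: matrix_transpose_mul)

lemma transpose_E_commute: "transpose (E t) ** transpose B = transpose B ** transpose (E t)"
  by (metis E_commute matrix_transpose_mul)

lemma ou_cov_eq: "ou_cov Q B t = (LINT s:{s. 0 \<le> s \<and> ereal s \<le> t}|lborel. V s)"
proof -
  have "transpose (s *\<^sub>R B) = s *\<^sub>R transpose B" for s
    by (simp add: transpose_def vec_eq_iff)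
  then show ?thesis
    by (simp add: ou_cov_def V_def E_def transpose_matrix_exp)
qed

text \<open>Used with \<open>M = Q\<close>, which gives the integrand \<open>V\<close>, and with
  \<open>M = S\<close>, which gives the part of the covariance beyond time \<open>t\<close>.\<close>

lemma conj_E_deriv:
  "((\<lambda>t. E t ** M ** transpose (E t)) has_vector_derivative
     (E t ** (B ** M + M ** transpose B) ** transpose (E t))) (at t)"
proof -
  have "((\<lambda>t. E t ** M) has_vector_derivative (E t ** B ** M)) (at t)"
    using bounded_linear.has_vector_derivative[OF
        bounded_bilinear.bounded_linear_left[OF bounded_bilinear_matrix_mult] E_deriv, of M t]
    by (simp add: E_commute)
  from bounded_bilinear.has_vector_derivative[OF bounded_bilinear_matrix_mult this transpose_E_deriv]
  show ?thesis
    by (simp add: matrix_add_ldistrib bounded_bilinear.add_left[OF bounded_bilinear_matrix_mult]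
        matrix_mul_assoc[symmetric] transpose_E_commute add.commute)
qed

lemma V_deriv: "(V has_vector_derivative (B ** V t + V t ** transpose B)) (at t)"
  using conj_E_deriv[of Q t]
  unfolding V_def
  by (simp add: matrix_add_ldistrib bounded_bilinear.add_left[OF bounded_bilinear_matrix_mult]
      matrix_mul_assoc E_commute)
    (simp add: matrix_mul_assoc[symmetric] transpose_E_commute)

lemma continuous_V: "continuous_on A V"
  by (rule continuous_on_vector_derivative) (rule has_vector_derivative_at_within[OF V_deriv])

lemma E_decay: "\<exists>C\<ge>0. \<exists>c>0. \<forall>t\<ge>0. norm (E t) \<le> C * exp (- c * t)"
  unfolding E_def using stable_matrix_exp_decay[OF stable] .

lemma conj_E_decay:
  "\<exists>C\<ge>0. \<exists>c>0. \<forall>t\<ge>0. norm (E t ** M ** transpose (E t)) \<le> C * exp (- c * t)"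
proof -
  obtain C c where C: "C \<ge> 0" "c > 0" "\<And>t. t \<ge> 0 \<Longrightarrow> norm (E t) \<le> C * exp (- c * t)"
    using E_decay by blast
  obtain K where K: "K \<ge> 0" "\<And>(X::real^'n^'n) (Y::real^'n^'n). norm (X ** Y) \<le> norm X * norm Y * K"
    using bounded_bilinear.nonneg_bounded[OF bounded_bilinear_matrix_mult] by blast
  obtain T where T: "T \<ge> 0" "\<And>X::real^'n^'n. norm (transpose X) \<le> norm X * T"
    using bounded_linear.nonneg_bounded[OF bounded_linear_transpose] by blast
  have "norm (E t ** M ** transpose (E t)) \<le> (C * norm M * K * (C * T) * K) * exp (- c * t)" if t: "t \<ge> 0" for t
  proof -
    have e1: "norm (E t) \<le> C" using C(3)[OF t] C(1,2) t
      by (intro order_trans[OF C(3)[OF t]] mult_left_le) auto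
    have "norm (E t ** M ** transpose (E t)) \<le> norm (E t ** M) * norm (transpose (E t)) * K"
      by (rule K)
    also have "\<dots> \<le> ((C * exp (- c * t)) * norm M * K) * (C * T) * K"
    proof (intro mult_right_mono mult_mono)
      show "norm (E t ** M) \<le> C * exp (- c * t) * norm M * K"
        by (rule order_trans[OF K(2)]) (intro mult_right_mono C(3) t K; simp)
      show "norm (transpose (E t)) \<le> C * T"
        by (rule order_trans[OF T(2)]) (intro mult_right_mono e1 T)
    qed (use K C T in auto)
    finally show ?thesis by (simp add: mult_ac)
  qed
  moreover have "C * norm M * K * (C * T) * K \<ge> 0" using C K T by auto
  ultimately show ?thesis using C(2) by blast
qed

lemma conj_E_tendsto: "((\<lambda>t. E t ** M ** transpose (E t)) \<longlongrightarrow> 0) at_top"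
proof -
  obtain C c where C: "C \<ge> 0" "c > 0" "\<And>t. t \<ge> 0 \<Longrightarrow> norm (E t ** M ** transpose (E t)) \<le> C * exp (- c * t)"
    using conj_E_decay by blast
  have "((\<lambda>t. C * exp (- c * t)) \<longlongrightarrow> C * 0) at_top"
    by (intro tendsto_intros filterlim_compose[OF exp_at_bot]
        filterlim_tendsto_neg_mult_at_bot[OF tendsto_const] filterlim_ident) (use C in auto)
  then have "((\<lambda>t. C * exp (- c * t)) \<longlongrightarrow> 0) at_top" by simp
  moreover have "eventually (\<lambda>t. norm (E t ** M ** transpose (E t)) \<le> C * exp (- c * t)) at_top"
    using C by (auto intro: eventually_mono[OF eventually_ge_at_top[of 0]])
  ultimately show ?thesis by (rule Lim_null_comparison[rotated])
qed

lemma V_integrable: "set_integrable lborel {0..} V"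
proof -
  obtain C c where C: "C \<ge> 0" "c > 0" "\<And>t. t \<ge> 0 \<Longrightarrow> norm (V t) \<le> C * exp (- c * t)"
    using conj_E_decay unfolding V_def by blast
  have lim: "((\<lambda>t. - (C / c) * exp (- c * t)) \<longlongrightarrow> - (C / c) * 0) at_top"
    by (intro tendsto_intros filterlim_compose[OF exp_at_bot]
        filterlim_tendsto_neg_mult_at_bot[OF tendsto_const] filterlim_ident) (use C in auto)
  have "(\<integral>\<^sup>+x. ennreal (C * exp (- c * x)) * indicator {0..} x \<partial>lborel) = ennreal (- (C / c) * 0 - (- (C / c) * exp (- c * 0)))"
    by (rule nn_integral_FTC_atLeast[OF _ _ _ lim])
      (use C in \<open>auto intro!: derivative_eq_intros\<close>)
  moreover have "(\<integral>\<^sup>+x. ennreal (norm (indicator {0..} x *\<^sub>R V x)) \<partial>lborel) \<le> (\<integral>\<^sup>+x. ennreal (C * exp (- c * x)) * indicator {0..} x \<partial>lborel)"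
    by (intro nn_integral_mono) (use C(3) in \<open>auto simp: indicator_def intro!: ennreal_leI\<close>)
  moreover have "V \<in> borel_measurable borel"
    by (rule borel_measurable_continuous_onI[OF continuous_V])
  ultimately show ?thesis
    unfolding set_integrable_def
    by (intro integrableI_bounded) (auto simp: le_less_trans)
qed

section \<open>The Lyapunov equation and the closed form of the covariance\<close>

lemma S_eq: "S = (LINT s:{0..}|lborel. V s)"
  by (simp add: S_def ou_cov_eq atLeast_def)

lemma ou_cov_real: "ou_cov Q B (ereal t) = (LINT s:{0..t}|lborel. V s)"
  by (simp add: ou_cov_eq atLeastAtMost_def atLeast_def atMost_def Collect_conj_eq[symmetric])

lemma ou_cov_tendsto: "((\<lambda>t. ou_cov Q B (ereal t)) \<longlongrightarrow> S) at_top"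
  unfolding ou_cov_real S_eq
  by (rule tendsto_set_lebesgue_integral_at_top) (auto intro: V_integrable)

text \<open>The operator \<open>?T\<close> maps \<open>V\<close> to its derivative. Applied to the
  covariance up to time \<open>t\<close> it therefore integrates to \<open>V t - Q\<close>, and
  \<open>V t\<close> vanishes as \<open>t\<close> grows.\<close>

lemma lyapunov: "B ** S + S ** transpose B = - Q"
proof -
  let ?T = "\<lambda>X. B ** X + X ** transpose B"
  have T: "bounded_linear ?T"
    by (intro bounded_linear_add
      bounded_bilinear.bounded_linear_right[OF bounded_bilinear_matrix_mult]
      bounded_bilinear.bounded_linear_left[OF bounded_bilinear_matrix_mult])
  have eq: "?T (ou_cov Q B (ereal t)) = V t - Q" if t: "t \<ge> 0" for t
  proof -
    have int: "integrable lborel (\<lambda>x. indicator {0..t} x *\<^sub>R V x)"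
      using borel_integrable_atLeastAtMost'[OF continuous_V] unfolding set_integrable_def .
    have "?T (ou_cov Q B (ereal t)) = (\<integral>x. ?T (indicator {0..t} x *\<^sub>R V x) \<partial>lborel)"
      unfolding ou_cov_real set_lebesgue_integral_def
      by (rule integral_bounded_linear[OF T int, symmetric])
    also have "\<dots> = (\<integral>x. indicator {0..t} x *\<^sub>R ?T (V x) \<partial>lborel)"
      by (intro Bochner_Integration.integral_cong refl) (simp add: linear_cmul[OF bounded_linear.linear[OF T]])
    also have "\<dots> = V t - V 0"
      by (rule integral_FTC_atLeastAtMost[OF t has_vector_derivative_at_within[OF V_deriv]])
        (intro bounded_linear.continuous_on[OF T] continuous_V)
    finally show ?thesis by (simp add: V_def)
  qed
  have "((\<lambda>t. V t - Q) \<longlongrightarrow> 0 - Q) at_top"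
    unfolding V_def by (intro tendsto_intros conj_E_tendsto)
  moreover have "((\<lambda>t. V t - Q) \<longlongrightarrow> ?T S) at_top"
    by (rule Lim_transform_eventually[OF bounded_linear.tendsto[OF T ou_cov_tendsto]])
      (auto intro: eventually_mono[OF eventually_ge_at_top[of 0]] simp: eq)
  ultimately show ?thesis
    using tendsto_unique[OF trivial_limit_at_top_linorder] by fastforce
qed

lemma conj_S_deriv: "((\<lambda>t. E t ** S ** transpose (E t)) has_vector_derivative - V t) (at t)"
  using conj_E_deriv[of S t] unfolding lyapunov V_def
  by (simp add: bounded_bilinear.minus_right[OF bounded_bilinear_matrix_mult]
     bounded_bilinear.minus_left[OF bounded_bilinear_matrix_mult])

text \<open>By the Lyapunov equation \<open>- (E t ** S ** transpose (E t))\<close> is a primitive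
  of \<open>V\<close>; the covariance at finite times becomes an algebraic expression.\<close>

lemma ou_cov_finite: 
  assumes t: "t \<ge> 0" shows "ou_cov Q B (ereal t) = S - E t ** S ** transpose (E t)"
proof -
  have "(\<integral>x. indicator {0..t} x *\<^sub>R V x \<partial>lborel) = - (E t ** S ** transpose (E t)) - - (E 0 ** S ** transpose (E 0))"
    by (rule integral_FTC_atLeastAtMost[OF t has_vector_derivative_at_within])
      (auto intro: continuous_V has_vector_derivative_minus[OF conj_S_deriv, simplified])
  then show ?thesis
    by (simp add: ou_cov_real set_lebesgue_integral_def)
qed

lemma sym_S: "transpose S = S"
proof -
  have "transpose (V s) = V s" for s
    by (simp add: V_def matrix_transpose_mul sym_Q matrix_mul_assoc)
  moreover have "transpose S = (\<integral>x. transpose (indicator {0..} x *\<^sub>R V x) \<partial>lborel)"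
    unfolding S_eq set_lebesgue_integral_def
    by (rule integral_bounded_linear[symmetric, OF bounded_linear_transpose V_integrable[unfolded set_integrable_def]])
  ultimately show ?thesis
    by (simp add: S_eq set_lebesgue_integral_def linear_cmul[OF bounded_linear.linear[OF bounded_linear_transpose]])
qed

lemma transpose_E_eq_0: "transpose (E t) *v x = 0 \<longleftrightarrow> x = 0"
proof
  assume "transpose (E t) *v x = 0"
  moreover have "transpose (E (- t)) ** transpose (E t) = mat 1"
    by (simp add: matrix_transpose_mul[symmetric] E_inverse transpose_mat)
  ultimately show "x = 0"
    by (metis matrix_vector_mul_assoc matrix_vector_mul_lid matrix_vector_mult_0_right)
qed simp

lemma V_form: "(V t *v x) \<bullet> x = (Q *v (transpose (E t) *v x)) \<bullet> (transpose (E t) *v x)"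
  unfolding V_def by (simp add: matrix_vector_mul_assoc[symmetric] inner_matrix_vector_left)

lemma conj_S_form_deriv:
  "((\<lambda>t. ((E t ** S ** transpose (E t)) *v x) \<bullet> x) has_real_derivative
     - ((Q *v (transpose (E t) *v x)) \<bullet> (transpose (E t) *v x))) (at t)"
  using bounded_linear.has_vector_derivative[OF bounded_linear_quadratic_form conj_S_deriv, of x x t]
  by (simp add: has_real_derivative_iff_has_vector_derivative V_form
    bounded_bilinear.minus_left[OF bounded_bilinear_matrix_vector_mult])

lemma conj_S_form_strict_decreasing:
  assumes "x \<noteq> 0" "s < t"
  shows "((E t ** S ** transpose (E t)) *v x) \<bullet> x < ((E s ** S ** transpose (E s)) *v x) \<bullet> x"
  using assms(2)
proof (rule DERIV_neg_imp_decreasing)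
  show "\<exists>y. ((\<lambda>t. ((E t ** S ** transpose (E t)) *v x) \<bullet> x) has_real_derivative y) (at r) \<and> y < 0" for r
    using conj_S_form_deriv[of x r] posdef_Q transpose_E_eq_0[of r x] assms(1)
    by (intro exI conjI) (assumption, auto simp: positive_definite_def)
qed

text \<open>A strictly decreasing function with limit 0 at infinity is positive. At time 0 this is
  the positivity of \<open>S\<close>, while the strict decrease from 0 to \<open>t\<close> is that
  of the covariance at time \<open>t\<close>.\<close>

lemma conj_S_form_pos:
  assumes "x \<noteq> 0" shows "((E t ** S ** transpose (E t)) *v x) \<bullet> x > 0"
proof -
  let ?r = "\<lambda>t. ((E t ** S ** transpose (E t)) *v x) \<bullet> x"
  have "(?r \<longlongrightarrow> (0 *v x) \<bullet> x) at_top"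
    by (rule bounded_linear.tendsto[OF bounded_linear_quadratic_form conj_E_tendsto])
  then have lim: "(?r \<longlongrightarrow> 0) at_top" by simp
  \<comment> \<open>The limit yields only a weak inequality; one further unit of time makes it
    strict.\<close>
  have "0 \<le> ?r (t + 1)"
    by (rule tendsto_upperbound[OF lim])
      (auto intro!: eventually_mono[OF eventually_gt_at_top[of "t + 1"]] less_imp_le conj_S_form_strict_decreasing assms)
  also have "\<dots> < ?r t" by (rule conj_S_form_strict_decreasing[OF assms]) simp
  finally show ?thesis .
qed

lemma posdef_S: "positive_definite S"
  unfolding positive_definite_def using conj_S_form_pos[of _ 0] by simp

lemma posdef_ou_cov: "t > 0 \<Longrightarrow> positive_definite (ou_cov Q B (ereal t))"
  unfolding positive_definite_def using conj_S_form_strict_decreasing[of _ 0 t]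
  by (simp add: ou_cov_finite matrix_vector_mult_diff_rdistrib inner_diff_left)

text \<open>For large \<open>t\<close> the determinants are close to \<open>det S\<close>, which is
  not 0; on the remaining compact interval continuity gives a positive minimum. Near
  \<open>t = 0\<close> there is no such bound, as the covariance tends to 0. With absolute values,
  invertibility is all that is used.\<close>

lemma det_ou_cov_bounded_below: "\<exists>d>0. \<forall>t\<ge>1. d \<le> \<bar>det (ou_cov Q B (ereal t))\<bar>"
proof -
  let ?M = "\<lambda>t. S - E t ** S ** transpose (E t)"
  let ?d = "\<lambda>t. \<bar>det (?M t)\<bar>"
  have nz: "?d t > 0" if "t \<ge> 1" for t
    using positive_definite_invertible[OF posdef_ou_cov[of t]] that
    by (simp add: ou_cov_finite invertible_det_nz)
  have S0: "\<bar>det S\<bar> > 0" using positive_definite_invertible[OF posdef_S] by (simp add: invertible_det_nz)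
  have "(?M \<longlongrightarrow> S - 0) at_top" by (intro tendsto_intros conj_E_tendsto)
  then have "(?d \<longlongrightarrow> \<bar>det (S - 0)\<bar>) at_top"
    by (intro tendsto_rabs continuous_on_tendsto_compose[OF continuous_det[of UNIV]]) auto
  then have "eventually (\<lambda>t. ?d t > \<bar>det S\<bar> / 2) at_top"
    using S0 by (intro order_tendstoD(1)[where y = "\<bar>det S\<bar>"]) auto
  then obtain T where T: "\<And>t. t \<ge> T \<Longrightarrow> ?d t > \<bar>det S\<bar> / 2"
    by (auto simp: eventually_at_top_linorder)
  have "continuous_on {1..max 1 T} (\<lambda>t. E t ** S ** transpose (E t))"
    by (rule continuous_on_vector_derivative) (rule has_vector_derivative_at_within[OF conj_S_deriv])
  then have c: "continuous_on {1..max 1 T} ?d"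
    by (intro continuous_intros continuous_on_compose2[OF continuous_det[of UNIV]]) auto
  obtain s where s: "s \<in> {1..max 1 T}" "\<And>t. t \<in> {1..max 1 T} \<Longrightarrow> ?d s \<le> ?d t"
    using continuous_attains_inf[OF compact_Icc _ c] by (metis atLeastAtMost_iff empty_iff max.cobounded1 order_refl)
  have "min (?d s) (\<bar>det S\<bar> / 2) \<le> \<bar>det (ou_cov Q B (ereal t))\<bar>" if t: "t \<ge> 1" for t
    using t T[of t] s(2)[of t] by (cases "t \<ge> T") (auto simp: ou_cov_finite min_le_iff_disj less_imp_le)
  moreover have "min (?d s) (\<bar>det S\<bar> / 2) > 0" using nz[of s] s(1) S0 by auto
  ultimately show ?thesis by blast
qed

end

section \<open>The contracting flow and the Mehler kernel\<close>

text \<open>Gronwall's argument: \<open>exp (a * t) * g t\<close> does not increase. The sign of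
  \<open>g\<close> is free, so applying the lemma to the negative of a function gives lower
  bounds.\<close>

lemma exp_mult_antimono:
  fixes g :: "real \<Rightarrow> real"
  assumes "\<And>t. \<exists>D. (g has_real_derivative D) (at t) \<and> D \<le> - a * g t" and "s \<le> t"
  shows "g t \<le> exp (- a * (t - s)) * g s"
proof -
  have "exp (a * t) * g t \<le> exp (a * s) * g s"
    using assms(2)
  proof (rule DERIV_nonpos_imp_nonincreasing)
    fix r
    obtain D where D: "(g has_real_derivative D) (at r)" "D \<le> - a * g r" using assms(1) by blast
    have "((\<lambda>t. exp (a * t) * g t) has_real_derivative (exp (a * r) * (a * g r + D))) (at r)"
      by (auto intro!: derivative_eq_intros D simp: algebra_simps)
    moreover have "exp (a * r) * (a * g r + D) \<le> 0" using D by (simp add: mult_le_0_iff)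
    ultimately show "\<exists>y. ((\<lambda>t. exp (a * t) * g t) has_real_derivative y) (at r) \<and> y \<le> 0" by blast
  qed
  then have "exp (- a * t) * (exp (a * t) * g t) \<le> exp (- a * t) * (exp (a * s) * g s)"
    by (intro mult_left_mono) auto
  moreover have "exp (- a * t) * (exp (a * t) * g t) = g t"
    by (simp add: exp_minus)
  moreover have "exp (- a * t) * (exp (a * s) * g s) = exp (- a * (t - s)) * g s"
    unfolding mult.assoc[symmetric] exp_add[symmetric] by (simp add: algebra_simps)
  ultimately show ?thesis by linarith
qed

lemma continuous_matrix_vector_mult [continuous_intros]:
  "continuous_on A f \<Longrightarrow> continuous_on A g \<Longrightarrow> continuous_on A (\<lambda>x. (f x :: real^'n^'n) *v g x)"
  by (rule bounded_bilinear.continuous_on[OF bounded_bilinear_matrix_vector_mult])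

lemma continuous_matrix_mult [continuous_intros]:
  "continuous_on A f \<Longrightarrow> continuous_on A g \<Longrightarrow> continuous_on A (\<lambda>x. (f x :: real^'n^'n) ** (g x :: real^'n^'n))"
  by (rule bounded_bilinear.continuous_on[OF bounded_bilinear_matrix_mult])

context ornstein_uhlenbeck
begin

definition J :: "real^'n^'n" where "J = matrix_inv S"

definition \<psi> :: "real^'n \<Rightarrow> real" where "\<psi> x = (J *v x) \<bullet> x"

text \<open>\<open>P t\<close> is the adjoint of \<open>E t\<close> for the inner product
  \<open>(J *v x) \<bullet> y\<close>.\<close>

definition P :: "real \<Rightarrow> real^'n^'n" where "P t = S ** transpose (E t) ** J"

lemma S_J: "S ** J = mat 1" and J_S: "J ** S = mat 1"
  using matrix_inv_inverse[OF positive_definite_invertible[OF posdef_S]] by (simp_all add: J_def)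

lemma J_S_vec: "J *v (S *v x) = x" and S_J_vec: "S *v (J *v x) = x"
  by (simp_all add: matrix_vector_mul_assoc S_J J_S)

lemma sym_J: "transpose J = J"
proof -
  have "transpose J ** S = mat 1"
    using S_J by (metis matrix_transpose_mul sym_S transpose_mat)
  then have "transpose J ** S ** J = J" by simp
  then show ?thesis by (simp add: matrix_mul_assoc[symmetric] S_J)
qed

lemma J_sym_inner: "(J *v x) \<bullet> y = (J *v y) \<bullet> x"
  by (metis inner_matrix_vector_left sym_J inner_commute)

lemma S_sym_inner: "(S *v x) \<bullet> y = (S *v y) \<bullet> x"
  by (metis inner_matrix_vector_left sym_S inner_commute)

lemma ou_R_eq: "ou_R Q B x = \<psi> x / 2"
  by (simp add: ou_R_def \<psi>_def J_def S_def)

lemma posdef_J: "positive_definite J"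
  unfolding positive_definite_def
proof (intro allI impI)
  fix x :: "real^'n" assume "x \<noteq> 0"
  then have "J *v x \<noteq> 0" using S_J_vec[of x] by auto
  then have "(S *v (J *v x)) \<bullet> (J *v x) > 0"
    using posdef_S by (simp add: positive_definite_def)
  then show "(J *v x) \<bullet> x > 0" by (simp add: S_J_vec inner_commute)
qed

lemma \<psi>_nonneg: "\<psi> x \<ge> 0" unfolding \<psi>_def by (rule positive_definite_nonneg[OF posdef_J])

lemma \<psi>_pos: "x \<noteq> 0 \<Longrightarrow> \<psi> x > 0" using posdef_J by (simp add: \<psi>_def positive_definite_def)

lemma \<psi>_0 [simp]: "\<psi> 0 = 0" by (simp add: \<psi>_def)

lemma \<psi>_minus [simp]: "\<psi> (- x) = \<psi> x"
  using matrix_vector_mult_scaleR[of J "-1" x] by (simp add: \<psi>_def)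

lemma continuous_\<psi> [continuous_intros]: "continuous_on A f \<Longrightarrow> continuous_on A (\<lambda>x. \<psi> (f x))"
  unfolding \<psi>_def by (intro continuous_intros)

lemma P_0 [simp]: "P 0 = mat 1" by (simp add: P_def S_J transpose_mat)

lemma P_add: "P (s + t) = P s ** P t"
proof -
  have "P s ** P t = S ** transpose (E s) ** (J ** S) ** transpose (E t) ** J"
    by (simp add: P_def matrix_mul_assoc)
  also have "\<dots> = S ** (transpose (E s) ** transpose (E t)) ** J"
    by (simp add: J_S matrix_mul_assoc)
  also have "transpose (E s) ** transpose (E t) = transpose (E (s + t))"
    by (metis E_add add.commute matrix_transpose_mul)
  finally show ?thesis by (simp add: P_def)
qed

lemma P_add_vec: "P s *v (P t *v x) = P (s + t) *v x"
  by (simp add: P_add matrix_vector_mul_assoc)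

lemma ou_D_eq: "ou_D Q B t = P (- t)"
proof -
  have "transpose (- t *\<^sub>R B) = - t *\<^sub>R transpose B"
    by (simp add: transpose_def vec_eq_iff)
  then show ?thesis
    by (simp add: ou_D_def P_def E_def transpose_matrix_exp J_def S_def)
qed

lemma P_deriv:
  "((\<lambda>t. P t *v x) has_vector_derivative ((S ** transpose B ** J) *v (P t *v x))) (at t)"
proof -
  have b: "bounded_linear (\<lambda>X. S ** X ** J)"
    by (intro bounded_linear_compose[OF bounded_bilinear.bounded_linear_left[OF bounded_bilinear_matrix_mult]
       bounded_bilinear.bounded_linear_right[OF bounded_bilinear_matrix_mult]])
  have "(P has_vector_derivative (S ** (transpose (E t) ** transpose B) ** J)) (at t)"
    using bounded_linear.has_vector_derivative[OF b transpose_E_deriv] by (simp add: P_def[abs_def])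
  moreover have "S ** (transpose (E t) ** transpose B) ** J = S ** transpose B ** (J ** S) ** transpose (E t) ** J"
    by (simp add: J_S matrix_mul_assoc[symmetric] transpose_E_commute)
  then have "S ** (transpose (E t) ** transpose B) ** J = (S ** transpose B ** J) ** P t"
    by (simp add: P_def matrix_mul_assoc)
  ultimately show ?thesis
    by (metis matrix_vector_has_vector_derivative matrix_vector_mul_assoc)
qed

lemma continuous_P [continuous_intros]:
  assumes "continuous_on A f" shows "continuous_on A (\<lambda>x. P (f x))"
proof -
  have "continuous_on UNIV (\<lambda>t. transpose (E t))"
    by (rule continuous_on_vector_derivative) (rule has_vector_derivative_at_within[OF transpose_E_deriv])
  then have "continuous_on A (\<lambda>x. transpose (E (f x)))"
    using continuous_on_compose2[OF _ assms] by blast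
  then show ?thesis unfolding P_def by (intro continuous_intros)
qed

section \<open>Exponential rates of the quadratic form along the flow\<close>

lemma \<psi>_P: "\<psi> (P t *v x) = ((E t ** S ** transpose (E t)) *v (J *v x)) \<bullet> (J *v x)"
  by (simp add: \<psi>_def P_def matrix_vector_mul_assoc[symmetric] J_S_vec inner_matrix_vector_left inner_commute)

text \<open>With \<open>y = transpose (E t) *v (J *v x)\<close>, the form along the flow is
  \<open>(S *v y) \<bullet> y\<close> and its derivative is \<open>- ((Q *v y) \<bullet> y)\<close>.
  Both are comparable with the squared norm of \<open>y\<close>, and the ratios of the bounds are
  \<open>a\<close> and \<open>b\<close>.\<close>

lemma \<psi>_P_deriv_bounds:
  "\<exists>a>0. \<exists>b>0. \<forall>x t. \<exists>D. ((\<lambda>t. \<psi> (P t *v x)) has_real_derivative D) (at t) \<and>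
     a * \<psi> (P t *v x) \<le> - D \<and> - D \<le> b * \<psi> (P t *v x)"
proof -
  obtain m M where m: "m > 0" "M > 0" "\<And>x. m * (norm x)\<^sup>2 \<le> (Q *v x) \<bullet> x" "\<And>x. (Q *v x) \<bullet> x \<le> M * (norm x)\<^sup>2"
    using positive_definite_bounds[OF posdef_Q] by blast
  obtain k K where k: "k > 0" "K > 0" "\<And>x. k * (norm x)\<^sup>2 \<le> (S *v x) \<bullet> x" "\<And>x. (S *v x) \<bullet> x \<le> K * (norm x)\<^sup>2"
    using positive_definite_bounds[OF posdef_S] by blast
  have "\<exists>D. ((\<lambda>t. \<psi> (P t *v x)) has_real_derivative D) (at t) \<and>
     (m / K) * \<psi> (P t *v x) \<le> - D \<and> - D \<le> (M / k) * \<psi> (P t *v x)" for x t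
  proof -
    define y where "y = transpose (E t) *v (J *v x)"
    have "((\<lambda>t. \<psi> (P t *v x)) has_real_derivative - ((Q *v y) \<bullet> y)) (at t)"
      unfolding \<psi>_P y_def by (rule conj_S_form_deriv)
    moreover have "\<psi> (P t *v x) = (S *v y) \<bullet> y"
      unfolding \<psi>_P y_def by (simp add: matrix_vector_mul_assoc[symmetric] inner_matrix_vector_left)
    moreover have "(m / K) * ((S *v y) \<bullet> y) \<le> (m / K) * (K * (norm y)\<^sup>2)"
      using m k by (intro mult_left_mono) auto
    then have "(m / K) * ((S *v y) \<bullet> y) \<le> (Q *v y) \<bullet> y" using m(3)[of y] k by simp
    moreover have "(M / k) * ((S *v y) \<bullet> y) \<ge> (M / k) * (k * (norm y)\<^sup>2)"
      using m k by (intro mult_left_mono) auto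
    then have "(Q *v y) \<bullet> y \<le> (M / k) * ((S *v y) \<bullet> y)" using m(4)[of y] k by simp
    ultimately show ?thesis by auto
  qed
  moreover have "m / K > 0" "M / k > 0" using m k by auto
  ultimately show ?thesis by blast
qed

lemma \<psi>_P_bounds:
  "\<exists>a>0. \<exists>b>0. \<forall>x s. s \<ge> 0 \<longrightarrow> exp (- b * s) * \<psi> x \<le> \<psi> (P s *v x) \<and> \<psi> (P s *v x) \<le> exp (- a * s) * \<psi> x"
proof -
  obtain a b where ab: "a > 0" "b > 0" and
    D: "\<And>x t. \<exists>D. ((\<lambda>t. \<psi> (P t *v x)) has_real_derivative D) (at t) \<and>
     a * \<psi> (P t *v x) \<le> - D \<and> - D \<le> b * \<psi> (P t *v x)"
    using \<psi>_P_deriv_bounds by blast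
  have "\<psi> (P s *v x) \<le> exp (- a * s) * \<psi> x" if "s \<ge> 0" for s x
    using exp_mult_antimono[of "\<lambda>t. \<psi> (P t *v x)" a 0 s] D[of x] that by force
  moreover have "exp (- b * s) * \<psi> x \<le> \<psi> (P s *v x)" if s: "s \<ge> 0" for s x
  proof -
    have "- \<psi> (P s *v x) \<le> exp (- b * (s - 0)) * - \<psi> (P 0 *v x)"
    proof (rule exp_mult_antimono[OF _ s])
      fix t
      obtain d where "((\<lambda>t. \<psi> (P t *v x)) has_real_derivative d) (at t)" "- d \<le> b * \<psi> (P t *v x)"
        using D by blast
      then show "\<exists>D. ((\<lambda>t. - \<psi> (P t *v x)) has_real_derivative D) (at t) \<and> D \<le> - b * - \<psi> (P t *v x)"
        by (intro exI[of _ "- d"] conjI DERIV_minus) auto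
    qed
    then show ?thesis by simp
  qed
  ultimately show ?thesis using ab by blast
qed

lemma \<psi>_P_le: "s \<ge> 0 \<Longrightarrow> \<psi> (P s *v x) \<le> \<psi> x"
proof -
  assume s: "s \<ge> 0"
  obtain a where a: "a > 0" "\<And>x s. s \<ge> 0 \<Longrightarrow> \<psi> (P s *v x) \<le> exp (- a * s) * \<psi> x"
    using \<psi>_P_bounds by blast
  have "exp (- a * s) * \<psi> x \<le> 1 * \<psi> x"
    using a(1) s by (intro mult_right_mono \<psi>_nonneg) auto
  with a(2)[OF s, of x] show ?thesis by linarith
qed

text \<open>The vector \<open>p\<close> is chosen so that \<open>S *v p = P (- t) *v z\<close>,
  which is minus the argument of the form. Splitting \<open>S = A + D\<close>, with \<open>A\<close>
  the covariance at time \<open>t\<close>, turns the exponent into the exact sum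
  \<open>\<psi> z + (A *v q) \<bullet> q\<close>, whose second term is nonnegative.\<close>

lemma kernel_form_bound:
  assumes t: "t > 0"
  shows "\<psi> (x - P t *v u) \<le>
     ((matrix_inv (ou_cov Q B (ereal t)) - matrix_inv (ou_cov Q B \<infinity>)) *v (u - ou_D Q B t *v x))
         \<bullet> (u - ou_D Q B t *v x)"
proof -
  define A where "A = ou_cov Q B (ereal t)"
  define D where "D = E t ** S ** transpose (E t)"
  define z where "z = x - P t *v u"
  define p where "p = transpose (E (- t)) *v (J *v z)"
  define q where "q = matrix_inv A *v (D *v p)"
  have pA: "positive_definite A" unfolding A_def using t by (rule posdef_ou_cov)
  have A: "A ** matrix_inv A = mat 1" "matrix_inv A ** A = mat 1"
    by (rule matrix_inv_inverse[OF positive_definite_invertible[OF pA]])+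
  have AD: "S = A + D" using t by (simp add: A_def D_def ou_cov_finite)
  have "transpose D = D" by (simp add: D_def matrix_transpose_mul sym_S matrix_mul_assoc)
  have symA: "(A *v v) \<bullet> w = (A *v w) \<bullet> v" for v w
  proof -
    have "A = S - D" using AD by simp
    moreover have "(D *v v) \<bullet> w = (D *v w) \<bullet> v"
      by (metis inner_matrix_vector_left \<open>transpose D = D\<close> inner_commute)
    ultimately show ?thesis using S_sym_inner[of v w]
      by (simp add: matrix_vector_mult_diff_rdistrib inner_diff_left)
  qed
  have w: "u - ou_D Q B t *v x = - (S *v p)"
  proof -
    have "S *v p = P (- t) *v z" by (simp add: p_def P_def matrix_vector_mul_assoc matrix_mul_assoc)
    also have "\<dots> = P (- t) *v x - u"
      by (simp add: z_def matrix_vector_mult_diff_distrib P_add_vec)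
    finally show ?thesis by (simp add: ou_D_eq)
  qed
  have et: "transpose (E t) *v p = J *v z"
  proof -
    have "transpose (E t) ** transpose (E (- t)) = mat 1"
      by (simp add: matrix_transpose_mul[symmetric] E_inverse transpose_mat)
    then show ?thesis by (simp add: p_def matrix_vector_mul_assoc matrix_mul_assoc)
  qed
  have "(D *v p) \<bullet> p = (S *v (transpose (E t) *v p)) \<bullet> (transpose (E t) *v p)"
    by (simp add: D_def matrix_vector_mul_assoc[symmetric] inner_matrix_vector_left[of "E t"])
  then have Dz: "(D *v p) \<bullet> p = \<psi> z"
    by (simp add: et S_J_vec \<psi>_def inner_commute)
  have Aq: "A *v q = D *v p" by (simp add: q_def matrix_vector_mul_assoc matrix_mul_assoc A)
  \<comment> \<open>Since \<open>matrix_inv A *v (S *v p) = p + q\<close> and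
    \<open>J *v (S *v p) = p\<close>, only \<open>q\<close> survives.\<close>
  have "(matrix_inv A - J) *v (S *v p) = q"
  proof -
    have "matrix_inv A *v (S *v p) = p + q"
      by (simp add: AD matrix_vector_mult_add_rdistrib matrix_vector_right_distrib q_def)
        (simp add: matrix_vector_mul_assoc A)
    then show ?thesis by (simp add: matrix_vector_mult_diff_rdistrib J_S_vec)
  qed
  then have "((matrix_inv A - J) *v (S *v p)) \<bullet> (S *v p) = q \<bullet> (A *v p) + q \<bullet> (D *v p)"
    by (simp add: AD matrix_vector_mult_add_rdistrib inner_add_right)
  also have "q \<bullet> (A *v p) = \<psi> z" using symA[of q p] Aq Dz by (simp add: inner_commute)
  also have "q \<bullet> (D *v p) = (A *v q) \<bullet> q" by (simp add: Aq inner_commute)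
  finally have "\<psi> z \<le> ((matrix_inv A - J) *v (S *v p)) \<bullet> (S *v p)"
    using positive_definite_nonneg[OF pA, of q] by simp
  moreover have "((matrix_inv A - J) *v (- (S *v p))) \<bullet> (- (S *v p)) = ((matrix_inv A - J) *v (S *v p)) \<bullet> (S *v p)"
    using matrix_vector_mult_scaleR[of "matrix_inv A - J" "-1" "S *v p"] by simp
  ultimately show ?thesis
    unfolding w A_def[symmetric] z_def[symmetric] S_def[symmetric] J_def[symmetric] by simp
qed

lemma mehler_kernel_bound:
  "\<exists>C>0. \<forall>t\<ge>1. \<forall>x u. \<bar>mehler_kernel Q B t x u\<bar> \<le> C * exp (\<psi> x / 2) * exp (- \<psi> (x - P t *v u) / 2)"
proof -
  obtain d where d: "d > 0" "\<And>t. t \<ge> 1 \<Longrightarrow> d \<le> \<bar>det (ou_cov Q B (ereal t))\<bar>"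
    using det_ou_cov_bounded_below by blast
  define C where "C = sqrt (\<bar>det S\<bar> / d)"
  have "\<bar>det S\<bar> > 0" using positive_definite_invertible[OF posdef_S] by (simp add: invertible_det_nz)
  then have "C > 0" using d by (simp add: C_def)
  moreover have "\<bar>mehler_kernel Q B t x u\<bar> \<le> C * exp (\<psi> x / 2) * exp (- \<psi> (x - P t *v u) / 2)" if t: "t \<ge> 1" for t x u
  proof -
    \<comment> \<open>The real square root is odd, so the prefactor is bounded by means of absolute
      values of determinants alone.\<close>
    have abs_sqrt: "\<bar>sqrt y\<bar> = sqrt \<bar>y\<bar>" for y
      by (cases "y \<ge> 0") (auto simp: abs_if real_sqrt_minus)
    have "\<bar>sqrt (det (ou_cov Q B \<infinity>) / det (ou_cov Q B (ereal t)))\<bar> = sqrt (\<bar>det S\<bar> / \<bar>det (ou_cov Q B (ereal t))\<bar>)"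
      by (simp only: abs_sqrt S_def abs_divide)
    also have "\<dots> \<le> C" unfolding C_def
      using d(1) d(2)[OF t] by (intro real_sqrt_le_mono divide_left_mono) auto
    finally have 1: "\<bar>sqrt (det (ou_cov Q B \<infinity>) / det (ou_cov Q B (ereal t)))\<bar> \<le> C" .
    show ?thesis unfolding mehler_kernel_def abs_mult ou_R_eq
      using kernel_form_bound[of t x u] t \<open>C > 0\<close>
      by (intro mult_mono 1) auto
  qed
  ultimately show ?thesis by blast
qed

end

section \<open>Integral estimates\<close>

lemma nn_integral_lborel_translate:
  fixes k :: "'a::euclidean_space \<Rightarrow> ennreal"
  assumes [measurable]: "k \<in> borel_measurable borel"
  shows "(\<integral>\<^sup>+x. k (c + x) \<partial>lborel) = (\<integral>\<^sup>+x. k x \<partial>lborel)"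
proof -
  have "(\<integral>\<^sup>+x. k x \<partial>lborel) = (\<integral>\<^sup>+x. k x \<partial>distr lborel borel ((+) c))"
    by (simp add: lborel_distr_plus)
  also have "\<dots> = (\<integral>\<^sup>+x. k (c + x) \<partial>lborel)"
    by (subst nn_integral_distr) auto
  finally show ?thesis ..
qed

text \<open>A substitute for the linear change of variables, which the library only has for well-ordered
  index types. Both sides come from the integral of \<open>indicator (ball 0 1) y * k (f x + y)\<close> over
  \<open>x\<close> and \<open>y\<close>, so that only translation invariance is needed.\<close>

lemma nn_integral_linear_le:
  fixes f f' :: "'a::euclidean_space \<Rightarrow> 'a"
  assumes f: "linear f" "\<And>x. f (f' x) = x" "\<And>x. norm x \<le> K * norm (f x)" and K: "K > 0"
    and [measurable]: "k \<in> borel_measurable borel"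
  shows "emeasure lborel (ball (0::'a) 1) * (\<integral>\<^sup>+x. k (f x) \<partial>lborel) \<le>
    emeasure lborel (ball (0::'a) K) * (\<integral>\<^sup>+x. k x \<partial>lborel)"
proof -
  have [measurable]: "f \<in> borel_measurable borel"
    using f(1) by (simp add: borel_measurable_continuous_onI linear_continuous_on linear_conv_bounded_linear)
  let ?U = "ball (0::'a) 1"
  have U1: "?U \<in> sets lborel" by simp
  have [measurable]: "?U \<in> sets borel" "ball (0::'a) K \<in> sets borel" by simp_all
  have fst_snd: "(\<lambda>x. f (fst x) + snd x) \<in> borel_measurable (lborel \<Otimes>\<^sub>M lborel)"
    "(\<lambda>x. snd x - f (fst x)) \<in> borel_measurable (lborel \<Otimes>\<^sub>M lborel)"
    by measurable
  have "emeasure lborel ?U * (\<integral>\<^sup>+x. k (f x) \<partial>lborel) = (\<integral>\<^sup>+y. indicator ?U y * (\<integral>\<^sup>+x. k (f x) \<partial>lborel) \<partial>lborel)"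
    by (subst nn_integral_multc[OF borel_measurable_indicator[OF U1]]) (simp only: nn_integral_indicator[OF U1])
  also have "\<dots> = (\<integral>\<^sup>+y. (\<integral>\<^sup>+x. indicator ?U y * k (f x + y) \<partial>lborel) \<partial>lborel)"
  proof (rule nn_integral_cong)
    \<comment> \<open>Translating \<open>x\<close> by \<open>f' y\<close> becomes, after
      \<open>f\<close>, a translation by \<open>y\<close>.\<close>
    fix y :: 'a
    have "(\<integral>\<^sup>+x. k (f x) \<partial>lborel) = (\<integral>\<^sup>+x. k (f (f' y + x)) \<partial>lborel)"
      by (rule nn_integral_lborel_translate[symmetric]) simp
    also have "\<dots> = (\<integral>\<^sup>+x. k (f x + y) \<partial>lborel)"
      by (simp add: linear_add[OF f(1)] f(2) add.commute)
    finally show "indicator ?U y * (\<integral>\<^sup>+x. k (f x) \<partial>lborel) = (\<integral>\<^sup>+x. indicator ?U y * k (f x + y) \<partial>lborel)"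
      by (simp add: nn_integral_cmult)
  qed
  also have "\<dots> = (\<integral>\<^sup>+x. (\<integral>\<^sup>+y. indicator ?U y * k (f x + y) \<partial>lborel) \<partial>lborel)"
    by (rule lborel_pair.Fubini') (use measurable_compose[OF fst_snd(1) assms(5)] in measurable)
  also have "\<dots> = (\<integral>\<^sup>+x. (\<integral>\<^sup>+z. indicator ?U (z - f x) * k z \<partial>lborel) \<partial>lborel)"
  proof (rule nn_integral_cong)
    fix x :: 'a
    show "(\<integral>\<^sup>+y. indicator ?U y * k (f x + y) \<partial>lborel) = (\<integral>\<^sup>+z. indicator ?U (z - f x) * k z \<partial>lborel)"
      using nn_integral_lborel_translate[of "\<lambda>z. indicator ?U (z - f x) * k z" "f x"] by simp
  qed
  also have "\<dots> = (\<integral>\<^sup>+z. (\<integral>\<^sup>+x. indicator ?U (z - f x) * k z \<partial>lborel) \<partial>lborel)"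
    by (rule lborel_pair.Fubini') (use fst_snd(2) in measurable)
  also have "\<dots> \<le> (\<integral>\<^sup>+z. emeasure lborel (ball (0::'a) K) * k z \<partial>lborel)"
  proof (intro nn_integral_mono)
    fix z :: 'a
    have "(\<integral>\<^sup>+x. indicator ?U (z - f x) * k z \<partial>lborel) = (\<integral>\<^sup>+x. indicator ?U (z - f x) \<partial>lborel) * k z"
      by (rule nn_integral_multc) measurable
    also have "(\<integral>\<^sup>+x. indicator ?U (z - f x) \<partial>lborel) \<le> (\<integral>\<^sup>+x. indicator (ball (0::'a) K) (- f' z + x) \<partial>lborel)"
    proof (intro nn_integral_mono)
      fix x
      \<comment> \<open>The preimage of the unit ball around \<open>z\<close> lies in the ball of
        radius \<open>K\<close> around \<open>f' z\<close>.\<close>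
      have "norm (f' z - x) < K" if "norm (z - f x) < 1"
      proof -
        have "z - f x = f (f' z - x)" using f(1,2) by (simp add: linear_diff)
        then have "norm (f' z - x) \<le> K * norm (z - f x)" using f(3) by simp
        also have "\<dots> < K" using that K by simp
        finally show ?thesis .
      qed
      moreover have "norm (x - f' z) = norm (f' z - x)" by (rule norm_minus_commute)
      ultimately show "(indicator ?U (z - f x) :: ennreal) \<le> indicator (ball 0 K) (- f' z + x)"
        by (auto simp: indicator_def)
    qed
    also have "(\<integral>\<^sup>+x. indicator (ball (0::'a) K) (- f' z + x) \<partial>lborel) = emeasure lborel (ball (0::'a) K)"
      using nn_integral_lborel_translate[OF borel_measurable_indicator, of "ball (0::'a) K" "- f' z"]
        nn_integral_indicator[of "ball (0::'a) K" lborel] by simp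
    finally show "(\<integral>\<^sup>+x. indicator ?U (z - f x) * k z \<partial>lborel) \<le> emeasure lborel (ball (0::'a) K) * k z"
      by (simp add: mult_right_mono)
  qed
  also have "\<dots> = emeasure lborel (ball (0::'a) K) * (\<integral>\<^sup>+x. k x \<partial>lborel)"
    by (rule nn_integral_cmult) measurable
  finally show ?thesis .
qed

lemma nn_integral_exp_decay:
  fixes c M :: real
  assumes "c > 0"
  shows "(\<integral>\<^sup>+x. ennreal (M * exp (- c * (x - a))) * indicator {a..} x \<partial>lborel) = ennreal (M / c)"
proof (cases "M \<ge> 0")
  case True
  have lim: "((\<lambda>x. - (M / c) * exp (- c * (x - a))) \<longlongrightarrow> - (M / c) * 0) at_top"
    using assms by (intro tendsto_intros filterlim_compose[OF exp_at_bot]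
        filterlim_tendsto_neg_mult_at_bot[OF tendsto_const]
        filterlim_tendsto_add_at_top[of "\<lambda>_. - a" "- a", simplified add.commute[of "- a"] diff_conv_add_uminus[symmetric]] filterlim_ident) auto
  have "(\<integral>\<^sup>+x. ennreal (M * exp (- c * (x - a))) * indicator {a..} x \<partial>lborel)
     = ennreal (- (M / c) * 0 - (- (M / c) * exp (- c * (a - a))))"
    using assms True by (intro nn_integral_FTC_atLeast[OF _ _ _ lim]) (auto intro!: derivative_eq_intros)
  then show ?thesis by simp
next
  \<comment> \<open>For negative \<open>M\<close> both sides are 0, because \<open>ennreal\<close>
    truncates negative numbers.\<close>
  case False
  then have "M * exp (- c * (x - a)) \<le> 0" for x by (simp add: mult_le_0_iff)
  moreover have "M / c \<le> 0" using False assms by (simp add: divide_le_0_iff)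
  ultimately show ?thesis by (simp add: ennreal_neg)
qed

lemma nn_integral_gaussian_real_finite:
  fixes c :: real assumes "c > 0"
  shows "(\<integral>\<^sup>+x. ennreal (exp (- c * x\<^sup>2)) \<partial>lborel) < \<infinity>"
proof -
  \<comment> \<open>Completing the square gives
    \<open>\<bar>x\<bar> - 1 / (4 * c) \<le> c * x^2\<close>, hence the constant; the other half
    line is covered by the reflection of \<open>?h\<close>.\<close>
  let ?h = "\<lambda>x. ennreal (exp (1 / (4 * c)) * exp (- 1 * (x - 0))) * indicator {0::real..} x"
  have h: "ennreal (exp (- c * x\<^sup>2)) \<le> ?h x + ?h (0 + (-1) * x)" for x
  proof -
    have "0 \<le> c * (\<bar>x\<bar> - 1 / (2 * c))\<^sup>2" using assms by simp
    also have "\<dots> = c * x\<^sup>2 - \<bar>x\<bar> + 1 / (4 * c)"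
      using assms by (simp add: power2_diff field_simps power2_eq_square)
    finally have "exp (- c * x\<^sup>2) \<le> exp (1 / (4 * c) - \<bar>x\<bar>)" by simp
    also have "\<dots> = exp (1 / (4 * c)) * exp (- \<bar>x\<bar>)" by (simp add: exp_add[symmetric])
    finally have b: "exp (- c * x\<^sup>2) \<le> exp (1 / (4 * c)) * exp (- \<bar>x\<bar>)" .
    show ?thesis
    proof (cases "x \<ge> 0")
      case True
      then have "ennreal (exp (- c * x\<^sup>2)) \<le> ?h x" using b by (simp add: ennreal_leI)
      then show ?thesis by (rule order_trans) simp
    next
      case False
      then have "ennreal (exp (- c * x\<^sup>2)) \<le> ?h (0 + (-1) * x)" using b by (simp add: ennreal_leI)
      then show ?thesis by (rule order_trans) simp
    qed
  qed
  have i: "(\<integral>\<^sup>+x. ?h x \<partial>lborel) = ennreal (exp (1 / (4 * c)) / 1)"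
    by (rule nn_integral_exp_decay) simp
  have "(\<integral>\<^sup>+x. ?h x \<partial>lborel) = \<bar>-1::real\<bar> * (\<integral>\<^sup>+x. ?h (0 + (-1) * x) \<partial>lborel)"
    by (rule nn_integral_real_affine) auto
  then have i2: "(\<integral>\<^sup>+x. ?h (0 + (-1) * x) \<partial>lborel) = ennreal (exp (1 / (4 * c)) / 1)" 
    unfolding i by simp
  have "(\<integral>\<^sup>+x. ennreal (exp (- c * x\<^sup>2)) \<partial>lborel) \<le> (\<integral>\<^sup>+x. ?h x + ?h (0 + (-1) * x) \<partial>lborel)"
    by (intro nn_integral_mono h)
  also have "\<dots> = (\<integral>\<^sup>+x. ?h x \<partial>lborel) + (\<integral>\<^sup>+x. ?h (0 + (-1) * x) \<partial>lborel)"
    by (rule nn_integral_add) measurable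
  also have "\<dots> < \<infinity>" unfolding i i2 by simp
  finally show ?thesis .
qed

lemma nn_integral_gaussian_finite:
  fixes c :: real assumes "c > 0"
  shows "(\<integral>\<^sup>+x. ennreal (exp (- c * (norm (x::'a::euclidean_space))\<^sup>2)) \<partial>lborel) < \<infinity>"
proof -
  have "ennreal (exp (- c * (norm x)\<^sup>2)) = (\<Prod>b\<in>Basis. ennreal (exp (- c * (x \<bullet> b)\<^sup>2)))" for x :: 'a
  proof -
    have "(norm x)\<^sup>2 = (\<Sum>b\<in>Basis. (x \<bullet> b)\<^sup>2)"
      unfolding power2_norm_eq_inner by (subst euclidean_inner) (simp add: power2_eq_square)
    then have "exp (- c * (norm x)\<^sup>2) = (\<Prod>b\<in>Basis. exp (- c * (x \<bullet> b)\<^sup>2))"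
      by (simp add: exp_sum[symmetric] sum_distrib_left sum_negf)
    then show ?thesis by (simp add: prod_ennreal)
  qed
  then have "(\<integral>\<^sup>+x. ennreal (exp (- c * (norm (x::'a))\<^sup>2)) \<partial>lborel)
     = (\<Prod>b\<in>(Basis::'a set). (\<integral>\<^sup>+x. ennreal (exp (- c * x\<^sup>2)) \<partial>lborel))"
    using nn_integral_lborel_prod[of "\<lambda>_::'a. \<lambda>x. ennreal (exp (- c * x\<^sup>2))"] by simp
  also have "\<dots> < \<infinity>"
    using nn_integral_gaussian_real_finite[OF assms] by (simp add: ennreal_prod_eq_top less_top power_less_top_ennreal)
  finally show ?thesis .
qed

text \<open>Since \<open>r\<close> grows at rate at least \<open>k\<close>, the function
  \<open>exp (- r)\<close> decays at that rate once it is below \<open>M\<close>. The integral is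
  therefore at most that of a decaying exponential which starts with the value \<open>M\<close>,
  wherever it starts.\<close>

lemma nn_integral_exp_superlinear_le:
  fixes r :: "real \<Rightarrow> real"
  assumes r: "\<And>s s'. 0 \<le> s' \<Longrightarrow> s' \<le> s \<Longrightarrow> r s - r s' \<ge> k * (s - s')"
    and k: "k > 0" and M: "M \<ge> 0"
  shows "(\<integral>\<^sup>+s. ennreal (exp (- r s)) * indicator {s. 0 \<le> s \<and> exp (- r s) < M} s \<partial>lborel) \<le> ennreal (M / k)"
proof -
  define T where "T = {s. 0 \<le> s \<and> exp (- r s) < M}"
  define \<sigma> where "\<sigma> = Inf T"
  have bdd: "bdd_below T" by (rule bdd_belowI[of _ 0]) (simp add: T_def)
  have bound: "\<sigma> \<le> s \<and> exp (- r s) \<le> M * exp (- k * (s - \<sigma>))" if s: "s \<in> T" for s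
  proof
    show "\<sigma> \<le> s" unfolding \<sigma>_def by (rule cInf_lower[OF s bdd])
    have Mp: "M > 0" using s exp_gt_zero[of "- r s"] by (auto simp: T_def simp del: exp_gt_zero)
    have lnM: "- r q < ln M" if "q \<in> T" for q
      using that Mp by (simp add: T_def) (metis exp_gt_zero ln_exp ln_less_cancel_iff)
    \<comment> \<open>The line of slope \<open>k\<close> through \<open>(s, r s)\<close> takes the
      value \<open>- ln M\<close> at \<open>\<tau>\<close>, so a point of \<open>T\<close> before
      \<open>\<tau>\<close> would contradict the growth of \<open>r\<close>. Points near the infimum
      are used because \<open>\<sigma>\<close> may lie outside \<open>T\<close> and \<open>r\<close>
      may be discontinuous.\<close>
    define \<tau> where "\<tau> = s - (ln M + r s) / k"
    have t: "\<tau> < s" using lnM[OF s] k by (simp add: \<tau>_def)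
    have "\<tau> \<le> \<sigma>"
    proof (rule ccontr)
      assume "\<not> \<tau> \<le> \<sigma>"
      then obtain q where q: "q \<in> T" "q < \<tau>"
        using cInf_lessD[of T \<tau>] s unfolding \<sigma>_def by auto
      have "k * (s - q) \<le> r s - r q" using q t by (intro r) (auto simp: T_def)
      moreover have "k * (s - q) > k * (s - \<tau>)" using q k by simp
      moreover have "k * (s - \<tau>) = ln M + r s" using k by (simp add: \<tau>_def)
      ultimately show False using lnM[OF q(1)] by linarith
    qed
    then have "k * (s - \<sigma>) \<le> k * (s - \<tau>)" using k by simp
    also have "\<dots> = ln M + r s" using k by (simp add: \<tau>_def)
    finally have "exp (- r s) \<le> exp (ln M - k * (s - \<sigma>))" by simp
    also have "\<dots> = M * exp (- k * (s - \<sigma>))" using Mp by (simp add: exp_diff exp_minus divide_inverse)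
    finally show "exp (- r s) \<le> M * exp (- k * (s - \<sigma>))" .
  qed
  have "(\<integral>\<^sup>+s. ennreal (exp (- r s)) * indicator T s \<partial>lborel) \<le>
     (\<integral>\<^sup>+s. ennreal (M * exp (- k * (s - \<sigma>))) * indicator {\<sigma>..} s \<partial>lborel)"
    using bound by (intro nn_integral_mono) (auto simp: indicator_def intro!: ennreal_leI)
  also have "\<dots> = ennreal (M / k)" by (rule nn_integral_exp_decay[OF k])
  finally show ?thesis unfolding T_def .
qed

context ornstein_uhlenbeck
begin

section \<open>The norm of the invariant Gaussian and the shape of trajectories\<close>

definition N :: "real^'n \<Rightarrow> real" where "N x = sqrt (\<psi> x)"

lemma N_nonneg [simp]: "N x \<ge> 0" by (simp add: N_def \<psi>_nonneg)

lemma N_power2: "(N x)\<^sup>2 = \<psi> x" by (simp add: N_def \<psi>_nonneg)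

lemma N_minus_commute: "N (x - y) = N (y - x)"
  unfolding N_def by (metis \<psi>_minus minus_diff_eq)

lemma continuous_N [continuous_intros]: "continuous_on A f \<Longrightarrow> continuous_on A (\<lambda>x. N (f x))"
  unfolding N_def by (intro continuous_intros)

lemma \<psi>_add: "\<psi> (x + y) = \<psi> x + 2 * ((J *v x) \<bullet> y) + \<psi> y"
  by (simp add: \<psi>_def matrix_vector_right_distrib inner_add_left inner_add_right J_sym_inner[of y x])

lemma \<psi>_scaleR: "\<psi> (c *\<^sub>R x) = c\<^sup>2 * \<psi> x"
  by (simp add: \<psi>_def matrix_vector_mult_scaleR power2_eq_square)

text \<open>Cauchy-Schwarz for the inner product of \<open>J\<close>, obtained from
  \<open>\<psi> \<ge> 0\<close> at the point of the line through \<open>x\<close> in direction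
  \<open>y\<close> that is closest to 0.\<close>

lemma N_triangle: "N (x + y) \<le> N x + N y"
proof (cases "y = 0")
  case False
  then have py: "\<psi> y > 0" by (rule \<psi>_pos)
  let ?i = "(J *v x) \<bullet> y"
  have "0 \<le> \<psi> (x + (- ?i / \<psi> y) *\<^sub>R y)" by (rule \<psi>_nonneg)
  also have "\<dots> = \<psi> x - ?i\<^sup>2 / \<psi> y"
    using py unfolding \<psi>_add \<psi>_scaleR by (simp add: field_simps power2_eq_square)
  finally have "?i\<^sup>2 \<le> \<psi> x * \<psi> y" using py by (simp add: field_simps)
  also have "\<dots> = (N x * N y)\<^sup>2" by (simp add: power_mult_distrib N_power2)
  finally have "?i \<le> N x * N y" by (rule power2_le_imp_le) simp
  then have "(N (x + y))\<^sup>2 \<le> (N x + N y)\<^sup>2"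
    by (simp add: power2_sum N_power2 \<psi>_add)
  then show ?thesis by (rule power2_le_imp_le) simp
qed (simp add: N_def)

lemma N_diff_triangle: "\<bar>N x - N y\<bar> \<le> N (x - y)"
  using N_triangle[of "x - y" y] N_triangle[of "y - x" x] by (simp add: N_minus_commute)

lemma N_norm_bounds: "\<exists>m>0. \<exists>M>0. \<forall>x. m * norm x \<le> N x \<and> N x \<le> M * norm x"
proof -
  obtain m M where m: "m > 0" "M > 0" "\<And>x. m * (norm x)\<^sup>2 \<le> \<psi> x" "\<And>x. \<psi> x \<le> M * (norm x)\<^sup>2"
    unfolding \<psi>_def using positive_definite_bounds[OF posdef_J] by blast
  have "sqrt m * norm x \<le> N x \<and> N x \<le> sqrt M * norm x" for x
    using real_sqrt_le_mono[OF m(3)[of x]] real_sqrt_le_mono[OF m(4)[of x]]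
    by (simp add: N_def real_sqrt_mult)
  moreover have "sqrt m > 0" "sqrt M > 0" using m by auto
  ultimately show ?thesis by blast
qed

text \<open>The velocity is linear in the position, and \<open>N\<close> decreases at least at the
  rate \<open>a / 2\<close> times itself, so the drop of \<open>N\<close> controls the length
  travelled. With \<open>N\<close> in place of its square both sides scale alike, and one
  \<open>L\<close> serves all trajectories.\<close>

lemma orbit_chord_bound:
  "\<exists>L\<ge>0. \<forall>u r s. N (P r *v u - P s *v u) \<le> L * \<bar>N (P r *v u) - N (P s *v u)\<bar>"
proof -
  obtain a where a: "a > 0" and
    D: "\<And>x t. \<exists>D. ((\<lambda>t. \<psi> (P t *v x)) has_real_derivative D) (at t) \<and> a * \<psi> (P t *v x) \<le> - D"
    using \<psi>_P_deriv_bounds by blast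
  obtain m M where m: "m > 0" "M > 0" "\<And>x. m * norm x \<le> N x" "\<And>x. N x \<le> M * norm x"
    using N_norm_bounds by blast
  let ?G = "S ** transpose B ** J"
  obtain K where K: "K \<ge> 0" "\<And>x. norm (?G *v x) \<le> norm x * K"
    using bounded_linear.nonneg_bounded[OF matrix_vector_mul_bounded_linear] by blast
  \<comment> \<open>\<open>K / m\<close> bounds the speed in terms of \<open>N\<close>, and
    \<open>a / 2\<close> is the decay rate of \<open>N\<close>; \<open>L\<close> is their quotient.
    The later factor \<open>M\<close> converts the norm back to \<open>N\<close>.\<close>
  define L where "L = 2 * K / (a * m)"
  have L: "L \<ge> 0" using K a m by (simp add: L_def)
  have main: "N (P t *v w - w) \<le> (M * L) * (N w - N (P t *v w))" if t: "t \<ge> 0" for t w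
  proof (cases "w = 0 \<or> t = 0")
    case True
    then show ?thesis by (auto simp: N_def)
  next
    case False
    \<comment> \<open>A trajectory starting off the origin never reaches it, so the square root in
      \<open>N\<close> can be differentiated along it.\<close>
    have "P r *v w \<noteq> 0" for r
    proof
      assume "P r *v w = 0"
      then have "P (- r) *v (P r *v w) = 0" by simp
      then show False using False by (simp add: P_add_vec)
    qed
    then have pos: "\<psi> (P r *v w) > 0" for r by (rule \<psi>_pos)
    have "\<exists>d. ((\<lambda>t. N (P t *v w)) has_real_derivative d) (at r) \<and> a / 2 * N (P r *v w) \<le> - d" for r
    proof -
      obtain d where d: "((\<lambda>t. \<psi> (P t *v w)) has_real_derivative d) (at r)" "a * \<psi> (P r *v w) \<le> - d"
        using D by blast
      have "((\<lambda>t. N (P t *v w)) has_real_derivative (d * (inverse (N (P r *v w)) / 2))) (at r)"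
        unfolding N_def using pos[of r] by (auto intro!: derivative_eq_intros d(1) simp: mult_ac)
      moreover have "a / 2 * N (P r *v w) \<le> - (d * (inverse (N (P r *v w)) / 2))"
      proof -
        have n: "N (P r *v w) > 0" using pos[of r] by (simp add: N_def)
        have "a * (N (P r *v w))\<^sup>2 \<le> - d" using d(2) by (simp add: N_power2)
        then show ?thesis using n by (simp add: field_simps power2_eq_square)
      qed
      ultimately show ?thesis by blast
    qed
    then obtain d where d: "\<And>r. ((\<lambda>t. N (P t *v w)) has_real_derivative d r) (at r)"
        "\<And>r. a / 2 * N (P r *v w) \<le> - d r" by metis
    have "norm (P t *v w - P 0 *v w) \<le> - L * N (P t *v w) - (- L * N (P 0 *v w))"
    proof (rule differentiable_bound_general[where f' = "\<lambda>r. ?G *v (P r *v w)" and \<phi>' = "\<lambda>r. - L * d r"])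
      show "0 < t" using t False by auto
      show "continuous_on {0..t} (\<lambda>t. P t *v w)" by (intro continuous_intros)
      show "continuous_on {0..t} (\<lambda>t. - L * N (P t *v w))" by (intro continuous_intros)
      show "((\<lambda>t. P t *v w) has_vector_derivative ?G *v (P x *v w)) (at x)" for x
        by (rule P_deriv)
      show "((\<lambda>t. - L * N (P t *v w)) has_vector_derivative - L * d x) (at x)" for x
        using DERIV_cmult[OF d(1), of "- L"] by (simp add: has_real_derivative_iff_has_vector_derivative)
      fix x
      have "norm (?G *v (P x *v w)) \<le> K * norm (P x *v w)" using K(2) by (simp add: mult.commute)
      also have "\<dots> \<le> K * (N (P x *v w) / m)"
        using m(1) m(3)[of "P x *v w"] K by (intro mult_left_mono) (auto simp: field_simps)
      also have "\<dots> = L * (a / 2 * N (P x *v w))" using a m by (simp add: L_def)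
      also have "\<dots> \<le> L * - d x" by (intro mult_left_mono d L)
      finally show "norm (?G *v (P x *v w)) \<le> - L * d x" by simp
    qed
    then have "norm (P t *v w - w) \<le> L * (N w - N (P t *v w))" by (simp add: algebra_simps)
    then have "M * norm (P t *v w - w) \<le> M * (L * (N w - N (P t *v w)))" using m by simp
    with m(4)[of "P t *v w - w"] show ?thesis by (simp add: mult.assoc)
  qed
  have "N (P r *v u - P s *v u) \<le> (M * L) * \<bar>N (P r *v u) - N (P s *v u)\<bar>" for u r s
  proof -
    have *: "N (P r *v u - P s *v u) \<le> (M * L) * \<bar>N (P r *v u) - N (P s *v u)\<bar>" if "s \<le> r" for r s
    proof -
      have "N (P r *v u - P s *v u) \<le> (M * L) * (N (P s *v u) - N (P r *v u))"
        using main[of "r - s" "P s *v u"] that by (simp add: P_add_vec)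
      also have "\<dots> \<le> (M * L) * \<bar>N (P r *v u) - N (P s *v u)\<bar>"
        using L m by (intro mult_left_mono) auto
      finally show ?thesis .
    qed
    show ?thesis
      using *[of s r] *[of r s] by (cases "s \<le> r") (auto simp: N_minus_commute abs_minus_commute)
  qed
  moreover have "M * L \<ge> 0" using L m by simp
  ultimately show ?thesis by blast
qed

text \<open>Forward in time \<open>\<psi>\<close> tends to 0 and backward to infinity, at an
  explicit rate. The time \<open>s\<close> is long enough for the values at \<open>s\<close> and
  \<open>- s\<close> to enclose the level.\<close>

lemma orbit_meets_level:
  assumes u: "u \<noteq> 0" and \<rho>: "\<rho> > 0"
  shows "\<exists>r. N (P r *v u) = \<rho>"
proof -
  obtain a where a: "a > 0" "\<And>x s. s \<ge> 0 \<Longrightarrow> \<psi> (P s *v x) \<le> exp (- a * s) * \<psi> x"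
    using \<psi>_P_bounds by blast
  have pu: "\<psi> u > 0" using u by (rule \<psi>_pos)
  define q where "q = \<rho>\<^sup>2"
  have q: "q > 0" using \<rho> by (simp add: q_def)
  define s where "s = (\<bar>ln (\<psi> u)\<bar> + \<bar>ln q\<bar>) / a"
  have s: "s \<ge> 0" using a by (simp add: s_def)
  have as: "a * s = \<bar>ln (\<psi> u)\<bar> + \<bar>ln q\<bar>" using a by (simp add: s_def)
  have "\<psi> (P s *v u) \<le> exp (- a * s) * \<psi> u" by (rule a(2)[OF s])
  also have "\<dots> = exp (ln (\<psi> u) - a * s)" using pu by (simp add: exp_diff exp_minus divide_inverse mult.commute)
  also have "\<dots> \<le> exp (ln q)" unfolding as by simp
  also have "\<dots> = q" using q by simp
  finally have 1: "\<psi> (P s *v u) \<le> q" .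
  have "q = exp (ln q)" using q by simp
  also have "\<dots> \<le> exp (a * s + ln (\<psi> u))" unfolding as by simp
  also have "\<dots> = exp (a * s) * \<psi> u" using pu by (simp add: exp_add)
  also have "\<dots> \<le> exp (a * s) * (exp (- a * s) * \<psi> (P (- s) *v u))"
    using a(2)[OF s, of "P (- s) *v u"] by (simp add: P_add_vec)
  also have "\<dots> = \<psi> (P (- s) *v u)" by (simp add: exp_minus)
  finally have 2: "q \<le> \<psi> (P (- s) *v u)" .
  have "\<exists>r\<ge>- s. r \<le> s \<and> \<psi> (P r *v u) = q"
  proof (rule IVT2'[where f = "\<lambda>t. \<psi> (P t *v u)", OF 1 2])
    show "continuous_on {- s..s} (\<lambda>t. \<psi> (P t *v u))" by (intro continuous_intros)
  qed (use s in auto)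
  then obtain r where "\<psi> (P r *v u) = q" by blast
  then show ?thesis using \<rho> by (intro exI[of _ r]) (simp add: N_def q_def)
qed

section \<open>Gaussian tubes around trajectories\<close>

lemma \<psi>_gaussian_finite: "c > 0 \<Longrightarrow> (\<integral>\<^sup>+x. ennreal (exp (- c * \<psi> x)) \<partial>lborel) < \<infinity>"
proof -
  assume c: "c > 0"
  obtain m where m: "m > 0" "\<And>x. m * (norm x)\<^sup>2 \<le> \<psi> x"
    unfolding \<psi>_def using positive_definite_bounds[OF posdef_J] by blast
  have "(\<integral>\<^sup>+x. ennreal (exp (- c * \<psi> x)) \<partial>lborel) \<le> (\<integral>\<^sup>+x. ennreal (exp (- (c * m) * (norm (x::real^'n))\<^sup>2)) \<partial>lborel)"
    using c m(2) by (intro nn_integral_mono ennreal_leI) (simp add: mult.assoc)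
  also have "\<dots> < \<infinity>" using c m by (intro nn_integral_gaussian_finite) simp
  finally show ?thesis .
qed

text \<open>Taking the supremum before the integration in \<open>u\<close> gives one kernel that
  serves all times at once.\<close>

definition tube_kernel :: "real^'n \<Rightarrow> real^'n \<Rightarrow> ennreal" where
  "tube_kernel x u = (SUP t\<in>{1..}. ennreal (exp (- \<psi> (x - P t *v u) / 2)))"

text \<open>Let \<open>P r *v u\<close> lie on the level \<open>N = \<rho>\<close>. For
  \<open>y\<close> in the shell, \<open>N (P t *v u)\<close> differs from \<open>\<rho>\<close> by
  at most \<open>N (y - P t *v u) + 1\<close>, and the chord bound turns this into a bound for the
  distance from \<open>P t *v u\<close> to \<open>P r *v u\<close>. Inside the shell the whole tube
  thus lies below one wider Gaussian centred at that point, whose mass depends on neither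
  \<open>u\<close> nor \<open>\<rho>\<close>.\<close>

lemma tube_kernel_shell_integral:
  "\<exists>C\<ge>0. \<forall>u \<rho>. \<rho> > 0 \<longrightarrow> (\<integral>\<^sup>+y. tube_kernel y u * indicator {y. \<bar>N y - \<rho>\<bar> \<le> 1} y \<partial>lborel) \<le> ennreal C"
proof -
  obtain L where L: "L \<ge> 0" "\<And>u r s. N (P r *v u - P s *v u) \<le> L * \<bar>N (P r *v u) - N (P s *v u)\<bar>"
    using orbit_chord_bound by blast
  \<comment> \<open>Squaring a sum of two terms costs the factor \<open>2 * (1 + L)\<^sup>2\<close>;
    another factor 2 matches the exponent \<open>1 / 2\<close> of the kernel. The additive remainder
    becomes 1, whence \<open>exp 1\<close> in the bound.\<close>
  define \<kappa> where "\<kappa> = 1 / (4 * (1 + L)\<^sup>2)"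
  have \<kappa>: "\<kappa> > 0" using L by (simp add: \<kappa>_def)
  define I where "I = (\<integral>\<^sup>+x. ennreal (exp (- \<kappa> * \<psi> x)) \<partial>lborel)"
  have I: "I < \<infinity>" unfolding I_def by (rule \<psi>_gaussian_finite[OF \<kappa>])
  have meas: "(\<lambda>x. ennreal (exp (- \<kappa> * \<psi> x))) \<in> borel_measurable borel"
    by (intro measurable_compose[OF _ measurable_ennreal] borel_measurable_continuous_onI continuous_intros)
  have \<kappa>2: "\<kappa> \<le> 1 / 2"
  proof -
    have "1 \<le> (1 + L)\<^sup>2" using L(1) by (simp add: one_le_power)
    then have "1 / (4 * (1 + L)\<^sup>2) \<le> 1 / (4 * 1)" by (intro divide_left_mono) auto
    then show ?thesis by (simp add: \<kappa>_def)
  qed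
  have "(\<integral>\<^sup>+y. tube_kernel y u * indicator {y. \<bar>N y - \<rho>\<bar> \<le> 1} y \<partial>lborel) \<le> ennreal (exp 1) * I"
    if \<rho>: "\<rho> > 0" for u \<rho>
  proof -
    obtain w where w: "\<And>y t. \<bar>N y - \<rho>\<bar> \<le> 1 \<Longrightarrow> - \<psi> (y - P t *v u) / 2 \<le> 1 - \<kappa> * \<psi> (w + y)"
    proof (cases "u = 0")
      \<comment> \<open>For \<open>u = 0\<close> the trajectory is the origin and meets no positive
        level; the Gaussian is already centred, and \<open>\<kappa> \<le> 1 / 2\<close> gives the
        bound.\<close>
      case True
      have "- \<psi> y / 2 \<le> 1 - \<kappa> * \<psi> y" for y
        using mult_right_mono[OF \<kappa>2 \<psi>_nonneg[of y]] by simp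
      then show ?thesis using True by (intro that[of 0]) auto
    next
      case False
      then obtain r where r: "N (P r *v u) = \<rho>" using orbit_meets_level \<rho> by blast
      show ?thesis
      proof (rule that[of "- (P r *v u)"])
        fix y t assume y: "\<bar>N y - \<rho>\<bar> \<le> 1"
        let ?v = "P t *v u" and ?w = "P r *v u"
        have "N (y - ?w) \<le> N (y - ?v) + N (?v - ?w)"
          using N_triangle[of "y - ?v" "?v - ?w"] by simp
        also have "N (?v - ?w) \<le> L * (N (y - ?v) + 1)"
          using L(2)[of t u r] N_diff_triangle[of y ?v] y r
            mult_left_mono[of "\<bar>N ?v - N ?w\<bar>" "N (y - ?v) + 1" L] L(1) by (auto simp: abs_if split: if_splits)
        finally have "N (y - ?w) \<le> (1 + L) * N (y - ?v) + L" by (simp add: algebra_simps)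
        then have "(N (y - ?w))\<^sup>2 \<le> ((1 + L) * N (y - ?v) + L)\<^sup>2"
          by (intro power_mono) auto
        also have "\<dots> \<le> 2 * ((1 + L) * N (y - ?v))\<^sup>2 + 2 * L\<^sup>2"
          using sum_squares_bound[of "(1 + L) * N (y - ?v)" L] by (simp add: power2_sum)
        also have "\<dots> \<le> 2 * (1 + L)\<^sup>2 * (N (y - ?v))\<^sup>2 + 4 * (1 + L)\<^sup>2"
        proof -
          have "L\<^sup>2 \<le> (1 + L)\<^sup>2" using L(1) by (intro power_mono) auto
          then have "2 * L\<^sup>2 \<le> 4 * (1 + L)\<^sup>2" using zero_le_power2[of "1 + L"] by linarith
          then show ?thesis by (simp add: power_mult_distrib)
        qed
        finally have "\<kappa> * \<psi> (y - ?w) \<le> \<kappa> * (2 * (1 + L)\<^sup>2 * \<psi> (y - ?v) + 4 * (1 + L)\<^sup>2)"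
          using \<kappa> by (simp add: N_power2)
        also have "\<dots> = \<psi> (y - ?v) / 2 + 1"
          using L(1) by (simp add: \<kappa>_def field_simps add_nonneg_eq_0_iff)
        finally show "- \<psi> (y - ?v) / 2 \<le> 1 - \<kappa> * \<psi> (- ?w + y)" by simp
      qed
    qed
    have "(\<integral>\<^sup>+y. tube_kernel y u * indicator {y. \<bar>N y - \<rho>\<bar> \<le> 1} y \<partial>lborel) \<le>
       (\<integral>\<^sup>+y. ennreal (exp 1) * ennreal (exp (- \<kappa> * \<psi> (w + y))) \<partial>lborel)"
    proof (intro nn_integral_mono)
      fix y
      show "tube_kernel y u * indicator {y. \<bar>N y - \<rho>\<bar> \<le> 1} y \<le> ennreal (exp 1) * ennreal (exp (- \<kappa> * \<psi> (w + y)))"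
      proof (cases "\<bar>N y - \<rho>\<bar> \<le> 1")
        case True
        have "tube_kernel y u \<le> ennreal (exp (1 - \<kappa> * \<psi> (w + y)))"
          unfolding tube_kernel_def by (intro SUP_least ennreal_leI) (use w[OF True] in simp)
        also have "\<dots> = ennreal (exp 1) * ennreal (exp (- \<kappa> * \<psi> (w + y)))"
          by (simp add: ennreal_mult[symmetric] exp_add[symmetric])
        finally show ?thesis using True by simp
      qed simp
    qed
    also have "\<dots> = ennreal (exp 1) * (\<integral>\<^sup>+y. ennreal (exp (- \<kappa> * \<psi> (w + y))) \<partial>lborel)"
    proof (rule nn_integral_cmult)
      show "(\<lambda>y. ennreal (exp (- \<kappa> * \<psi> (w + y)))) \<in> borel_measurable lborel"
        using measurable_compose[OF _ meas, of "\<lambda>y. w + y" lborel] by simp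
    qed
    also have "(\<integral>\<^sup>+y. ennreal (exp (- \<kappa> * \<psi> (w + y))) \<partial>lborel) = I"
      unfolding I_def by (rule nn_integral_lborel_translate[OF meas])
    finally show ?thesis .
  qed
  moreover obtain C where "C \<ge> 0" "ennreal (exp 1) * I = ennreal C"
    using I that[of "exp 1 * enn2real I"] by (cases I) (auto simp: ennreal_mult[symmetric])
  ultimately show ?thesis by metis
qed


section \<open>Level sets of functions monotone along the flow\<close>

lemma measurable_P_vec [measurable (raw)]:
  assumes "f \<in> borel_measurable M" "g \<in> borel_measurable M"
  shows "(\<lambda>z. P (f z) *v g z) \<in> borel_measurable M"
  by (rule borel_measurable_continuous_Pair[OF assms]) (intro continuous_intros)

lemma measurable_\<psi> [measurable]: "\<psi> \<in> borel_measurable borel"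
  by (rule borel_measurable_continuous_onI) (intro continuous_intros)

lemma measurable_N [measurable]: "N \<in> borel_measurable borel"
  by (rule borel_measurable_continuous_onI) (intro continuous_intros)

text \<open>Being a supremum of continuous functions, the tube kernel is lower semicontinuous; this avoids
  reducing the uncountable supremum to rational times.\<close>

lemma measurable_tube_kernel [measurable (raw)]:
  assumes [measurable]: "f \<in> borel_measurable M" "g \<in> borel_measurable M"
  shows "(\<lambda>z. tube_kernel (f z) (g z)) \<in> borel_measurable M"
proof -
  have "(\<lambda>z. tube_kernel (fst z) (snd z)) \<in> borel_measurable borel"
  proof (rule borel_measurableI_greater)
    fix y :: ennreal
    have "{z \<in> space borel. y < tube_kernel (fst z) (snd z)} =
      (\<Union>t\<in>{1..}. {z. y < ennreal (exp (- \<psi> (fst z - P t *v snd z) / 2))})"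
      by (auto simp: tube_kernel_def less_SUP_iff)
    also have "open \<dots>"
      by (intro open_UN ballI open_Collect_less continuous_intros continuous_on_ennreal) auto
    finally show "{z \<in> space borel. y < tube_kernel (fst z) (snd z)} \<in> sets borel"
      by (rule borel_open)
  qed
  moreover have "(\<lambda>z. (f z, g z)) \<in> borel_measurable M" by measurable
  ultimately have "(\<lambda>z. tube_kernel (fst (f z, g z)) (snd (f z, g z))) \<in> borel_measurable M"
    by (rule measurable_compose[rotated])
  then show ?thesis by simp
qed

lemma tube_kernel_le_1: "tube_kernel x u \<le> 1"
  unfolding tube_kernel_def
proof (intro SUP_least)
  show "ennreal (exp (- \<psi> (x - P t *v u) / 2)) \<le> 1" for t
    using ennreal_leI[of "exp (- \<psi> (x - P t *v u) / 2)" 1] \<psi>_nonneg by simp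
qed

text \<open>The flow carries the displacement at time \<open>t\<close> to a displacement at time
  \<open>s + t\<close>, which is still admissible, without enlarging it.\<close>

lemma tube_kernel_P_mono:
  assumes "s \<ge> 0" shows "tube_kernel x u \<le> tube_kernel (P s *v x) u"
  unfolding tube_kernel_def
proof (rule SUP_mono)
  fix t :: real assume t: "t \<in> {1..}"
  have "P s *v (x - P t *v u) = P s *v x - P (s + t) *v u"
    by (simp add: matrix_vector_mult_diff_distrib P_add_vec)
  then have "\<psi> (P s *v x - P (s + t) *v u) \<le> \<psi> (x - P t *v u)"
    using \<psi>_P_le[OF assms] by metis
  then show "\<exists>t'\<in>{1..}. ennreal (exp (- \<psi> (x - P t *v u) / 2)) \<le> ennreal (exp (- \<psi> (P s *v x - P t' *v u) / 2))"
    using assms t by (intro bexI[of _ "s + t"] ennreal_leI) auto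
qed

text \<open>Within time \<open>ln 2 / a\<close> the form halves, so the point reaches
  \<open>\<psi> = \<rho>\<^sup>2\<close>; from there \<open>N\<close> falls at relative rate at most
  \<open>b / 2\<close>, hence by at most 1 during a time \<open>2 / (b * \<rho>)\<close>. The upper
  bound on \<open>\<psi> x\<close> keeps the waiting time bounded, which makes \<open>T\<close>
  independent of \<open>\<rho>\<close>.\<close>

lemma shell_passage_time:
  "\<exists>T>0. \<exists>h>0. \<forall>x \<rho>. \<rho> \<ge> 1 \<longrightarrow> \<rho>\<^sup>2 \<le> \<psi> x \<longrightarrow> \<psi> x \<le> 2 * \<rho>\<^sup>2 \<longrightarrow>
     ennreal (h / \<rho>) \<le> (\<integral>\<^sup>+s. indicator {0..T} s * indicator {y. \<rho> - 1 \<le> N y \<and> N y \<le> \<rho>} (P s *v x) \<partial>lborel)"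
proof -
  obtain a b where a: "a > 0" and b: "b > 0" and
    up: "\<And>x s. s \<ge> 0 \<Longrightarrow> \<psi> (P s *v x) \<le> exp (- a * s) * \<psi> x" and
    lo: "\<And>x s. s \<ge> 0 \<Longrightarrow> exp (- b * s) * \<psi> x \<le> \<psi> (P s *v x)"
    using \<psi>_P_bounds by blast
  define T where "T = ln 2 / a + 2 / b"
  have T: "T > 0" using a b by (simp add: T_def add_pos_pos)
  have "ennreal ((2 / b) / \<rho>) \<le> (\<integral>\<^sup>+s. indicator {0..T} s * indicator {y. \<rho> - 1 \<le> N y \<and> N y \<le> \<rho>} (P s *v x) \<partial>lborel)"
    if \<rho>: "\<rho> \<ge> 1" and x: "\<rho>\<^sup>2 \<le> \<psi> x" "\<psi> x \<le> 2 * \<rho>\<^sup>2" for x \<rho>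
  proof -
    have "\<psi> (P (ln 2 / a) *v x) \<le> exp (- a * (ln 2 / a)) * \<psi> x"
      using a by (intro up) auto
    also have "\<dots> = \<psi> x / 2" using a by (simp add: exp_minus)
    also have "\<dots> \<le> \<rho>\<^sup>2" using x by simp
    finally have 1: "\<psi> (P (ln 2 / a) *v x) \<le> \<rho>\<^sup>2" .
    have "\<exists>r\<ge>0. r \<le> ln 2 / a \<and> \<psi> (P r *v x) = \<rho>\<^sup>2"
      by (rule IVT2'[where f = "\<lambda>t. \<psi> (P t *v x)", OF 1])
        (use x a in \<open>auto intro!: continuous_intros\<close>)
    then obtain r where r: "0 \<le> r" "r \<le> ln 2 / a" "\<psi> (P r *v x) = \<rho>\<^sup>2" by blast
    have "ennreal ((2 / b) / \<rho>) = emeasure lborel {r..r + (2 / b) / \<rho>}"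
      using b \<rho> by simp
    also have "\<dots> = (\<integral>\<^sup>+s. indicator {r..r + (2 / b) / \<rho>} s \<partial>lborel)"
      by (rule nn_integral_indicator[symmetric]) simp
    also have "\<dots> \<le> (\<integral>\<^sup>+s. indicator {0..T} s * indicator {y. \<rho> - 1 \<le> N y \<and> N y \<le> \<rho>} (P s *v x) \<partial>lborel)"
    proof (rule nn_integral_mono)
      fix s
      have "s \<in> {0..T} \<and> \<rho> - 1 \<le> N (P s *v x) \<and> N (P s *v x) \<le> \<rho>" if s: "s \<in> {r..r + (2 / b) / \<rho>}"
      proof (intro conjI)
        have "(2 / b) / \<rho> \<le> 2 / b" using \<rho> b by (simp add: divide_le_eq mult_le_cancel_left1)
        then show "s \<in> {0..T}" using s r by (auto simp: T_def)
        define h where "h = s - r"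
        have h: "h \<ge> 0" "h \<le> (2 / b) / \<rho>" using s by (auto simp: h_def)
        have sr: "P s *v x = P h *v (P r *v x)" by (simp add: P_add_vec h_def)
        have "\<psi> (P s *v x) \<le> \<rho>\<^sup>2" unfolding sr using \<psi>_P_le[OF h(1), of "P r *v x"] r(3) by simp
        then show "N (P s *v x) \<le> \<rho>" using \<rho> unfolding N_def by (simp add: real_le_lsqrt)
        have "\<rho> - 1 \<le> (1 - b * h / 2) * \<rho>"
          using h(2) b \<rho> by (simp add: field_simps)
        also have "\<dots> \<le> exp (- b * h / 2) * \<rho>"
          using exp_ge_add_one_self[of "- b * h / 2"] \<rho> by (intro mult_right_mono) auto
        also have "\<dots> = sqrt (exp (- b * h) * \<rho>\<^sup>2)"
        proof -
          have "(exp (- b * h / 2))\<^sup>2 = exp (- b * h)" by (simp add: exp_double[symmetric])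
          then have "exp (- b * h) * \<rho>\<^sup>2 = (exp (- b * h / 2) * \<rho>)\<^sup>2" by (simp add: power_mult_distrib)
          then show ?thesis using \<rho> by simp
        qed
        also have "\<dots> \<le> N (P s *v x)"
          unfolding N_def sr using lo[OF h(1), of "P r *v x"] r(3) by simp
        finally show "\<rho> - 1 \<le> N (P s *v x)" .
      qed
      then show "(indicator {r..r + (2 / b) / \<rho>} s :: ennreal) \<le>
          indicator {0..T} s * indicator {y. \<rho> - 1 \<le> N y \<and> N y \<le> \<rho>} (P s *v x)"
        by (auto simp: indicator_def)
    qed
    finally show ?thesis .
  qed
  moreover have "2 / b > 0" using b by simp
  ultimately show ?thesis using T by blast
qed

text \<open>Provides the expansion hypothesis of \<open>nn_integral_linear_le\<close> uniformly for
  \<open>s\<close> in a bounded interval, so that the change of variables by \<open>P s\<close>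
  costs a fixed factor.\<close>

lemma P_norm_bound:
  "\<exists>K>0. \<forall>s x. 0 \<le> s \<longrightarrow> s \<le> T \<longrightarrow> norm x \<le> K * norm (P s *v x)"
proof -
  obtain b where b: "b > 0" "\<And>x s. s \<ge> 0 \<Longrightarrow> exp (- b * s) * \<psi> x \<le> \<psi> (P s *v x)"
    using \<psi>_P_bounds by blast
  obtain m M where m: "m > 0" "M > 0" "\<And>x. m * norm x \<le> N x" "\<And>x. N x \<le> M * norm x"
    using N_norm_bounds by blast
  have "norm x \<le> (exp (b * T / 2) * M / m) * norm (P s *v x)" if s: "0 \<le> s" "s \<le> T" for s x
  proof -
    have "\<psi> x \<le> exp (b * s) * \<psi> (P s *v x)"
      using mult_left_mono[OF b(2)[OF s(1), of x], of "exp (b * s)"]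
      by (simp add: mult.assoc[symmetric] exp_add[symmetric])
    also have "\<dots> \<le> exp (b * T) * \<psi> (P s *v x)"
      using s b by (intro mult_right_mono \<psi>_nonneg) auto
    also have "\<dots> = (exp (b * T / 2) * N (P s *v x))\<^sup>2"
      by (simp add: power_mult_distrib N_power2 exp_double[symmetric])
    finally have "N x \<le> exp (b * T / 2) * N (P s *v x)"
      unfolding N_power2[symmetric] by (rule power2_le_imp_le) simp
    also have "\<dots> \<le> exp (b * T / 2) * (M * norm (P s *v x))" by (intro mult_left_mono m) auto
    finally have "m * norm x \<le> exp (b * T / 2) * (M * norm (P s *v x))"
      using m(3)[of x] by linarith
    then show ?thesis using m(1) by (simp add: field_simps)
  qed
  moreover have "exp (b * T / 2) * M / m > 0" using m by simp
  ultimately show ?thesis by blast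
qed

text \<open>Averaging over the times at which the flow \<open>P s\<close> carries a point into the shell of unit
  thickness replaces polar coordinates adapted to the flow. Along each backward trajectory the
  form \<open>\<psi>\<close> increases at a rate of order \<open>\<rho>\<^sup>2\<close>, whereas a shell passage takes a time
  of order \<open>1 / \<rho>\<close>; the quotient is the gain \<open>1 / \<rho>\<close>.\<close>

lemma flow_level_set_bound:
  "\<exists>C\<ge>0. \<forall>F \<rho> \<alpha>. \<rho> \<ge> 2 \<longrightarrow> \<alpha> > 0 \<longrightarrow> F \<in> borel_measurable borel \<longrightarrow> (\<forall>x. 0 \<le> F x) \<longrightarrow>
     (\<forall>x s. s \<ge> 0 \<longrightarrow> F x \<le> F (P s *v x)) \<longrightarrow>
     (\<integral>\<^sup>+x. ennreal (exp (- \<psi> x / 2)) * indicator {x. \<rho>\<^sup>2 \<le> \<psi> x \<and> \<psi> x \<le> 2 * \<rho>\<^sup>2 \<and> exp (- \<psi> x / 2) < F x / \<alpha>} x \<partial>lborel)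
      \<le> ennreal (C / (\<rho> * \<alpha>)) * (\<integral>\<^sup>+y. ennreal (F y) * indicator {y. \<bar>N y - \<rho>\<bar> \<le> 1} y \<partial>lborel)"
proof -
  obtain a where a: "a > 0" and
    up: "\<And>x s. s \<ge> 0 \<Longrightarrow> \<psi> (P s *v x) \<le> exp (- a * s) * \<psi> x"
    using \<psi>_P_bounds by blast
  obtain T h where T: "T > 0" and h: "h > 0" and
    pass: "\<And>x \<rho>. \<rho> \<ge> 1 \<Longrightarrow> \<rho>\<^sup>2 \<le> \<psi> x \<Longrightarrow> \<psi> x \<le> 2 * \<rho>\<^sup>2 \<Longrightarrow>
     ennreal (h / \<rho>) \<le> (\<integral>\<^sup>+s. indicator {0..T} s * indicator {y. \<rho> - 1 \<le> N y \<and> N y \<le> \<rho>} (P s *v x) \<partial>lborel)"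
    using shell_passage_time by blast
  obtain K where K: "K > 0" "\<And>s x. 0 \<le> s \<Longrightarrow> s \<le> T \<Longrightarrow> norm x \<le> K * norm (P s *v x)"
    using P_norm_bound by blast
  define v where "v = measure lborel (ball (0::real^'n) 1)"
  define V' where "V' = measure lborel (ball (0::real^'n) K)"
  have fin: "emeasure lborel (ball (0::real^'n) r) \<noteq> \<infinity>" for r
    using emeasure_lborel_ball_finite[of 0 r] by (simp add: less_top)
  have v: "v > 0" unfolding v_def by (rule content_ball_pos) simp
  have ev: "emeasure lborel (ball (0::real^'n) 1) = ennreal v" "emeasure lborel (ball (0::real^'n) K) = ennreal V'"
    using fin by (simp_all add: v_def V'_def emeasure_eq_ennreal_measure)
  have V': "V' \<ge> 0" by (simp add: V'_def)
  \<comment> \<open>\<open>V' / v\<close> is the cost of the change of variables,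
    \<open>h / \<rho>\<close> the least passage time, and \<open>8 / (a * \<rho>\<^sup>2)\<close>
    the inverse growth rate of \<open>\<psi> / 2\<close> along backward trajectories.\<close>
  define C where "C = 8 * V' / (v * h * a)"
  have C: "C \<ge> 0" using v h a V' by (simp add: C_def)
  have main: "(\<integral>\<^sup>+x. ennreal (exp (- \<psi> x / 2)) * indicator {x. \<rho>\<^sup>2 \<le> \<psi> x \<and> \<psi> x \<le> 2 * \<rho>\<^sup>2 \<and> exp (- \<psi> x / 2) < F x / \<alpha>} x \<partial>lborel)
      \<le> ennreal (C / (\<rho> * \<alpha>)) * (\<integral>\<^sup>+y. ennreal (F y) * indicator {y. \<bar>N y - \<rho>\<bar> \<le> 1} y \<partial>lborel)"
    if \<rho>: "\<rho> \<ge> 2" and \<alpha>: "\<alpha> > 0" and F[measurable]: "F \<in> borel_measurable borel" and F0: "\<And>x. 0 \<le> F x"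
      and mono: "\<And>x s. s \<ge> 0 \<Longrightarrow> F x \<le> F (P s *v x)" for F \<rho> \<alpha>
  proof -
    let ?e = "\<lambda>x. ennreal (exp (- \<psi> x / 2))"
    define A where "A = {x. \<rho>\<^sup>2 \<le> \<psi> x \<and> \<psi> x \<le> 2 * \<rho>\<^sup>2 \<and> exp (- \<psi> x / 2) < F x / \<alpha>}"
    define Sh where "Sh = {y. \<rho> - 1 \<le> N y \<and> N y \<le> \<rho>}"
    have A[measurable]: "A \<in> sets borel" unfolding A_def by measurable
    have Sh[measurable]: "Sh \<in> sets borel" unfolding Sh_def by measurable
    define g where "g x = ?e x * indicator A x" for x
    have g[measurable]: "g \<in> borel_measurable borel" unfolding g_def by measurable
    have inner: "(\<integral>\<^sup>+s. indicator {0..T} s * g (P (- s) *v y) \<partial>lborel) \<le> ennreal (8 / (a * \<rho>\<^sup>2 * \<alpha>)) * ennreal (F y)"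
      if y: "y \<in> Sh" for y
    proof -
      let ?r = "\<lambda>s. \<psi> (P (- s) *v y) / 2"
      \<comment> \<open>\<open>\<rho> \<ge> 2\<close> makes the inner radius
        \<open>\<rho> - 1\<close> at least \<open>\<rho> / 2\<close>.\<close>
      have N0: "N y \<ge> \<rho> / 2" using y \<rho> by (auto simp: Sh_def)
      have "(\<rho> / 2)\<^sup>2 \<le> (N y)\<^sup>2" by (rule power_mono[OF N0]) (use \<rho> in simp)
      then have py: "\<rho>\<^sup>2 / 4 \<le> \<psi> y" by (simp add: N_power2 power_divide)
      have r: "?r s - ?r s' \<ge> (a * \<rho>\<^sup>2 / 8) * (s - s')" if s: "0 \<le> s'" "s' \<le> s" for s s'
      proof -
        have 1: "\<psi> y \<le> \<psi> (P (- s') *v y)"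
          using \<psi>_P_le[OF s(1), of "P (- s') *v y"] by (simp add: P_add_vec)
        have "\<psi> (P (- s') *v y) \<le> exp (- a * (s - s')) * \<psi> (P (- s) *v y)"
          using up[of "s - s'" "P (- s) *v y"] s by (simp add: P_add_vec)
        then have "exp (a * (s - s')) * \<psi> (P (- s') *v y) \<le> exp (a * (s - s')) * (exp (- a * (s - s')) * \<psi> (P (- s) *v y))"
          by (intro mult_left_mono) auto
        also have "\<dots> = \<psi> (P (- s) *v y)" by (simp add: exp_minus)
        finally have 2: "exp (a * (s - s')) * \<psi> (P (- s') *v y) \<le> \<psi> (P (- s) *v y)" .
        have "(1 + a * (s - s')) * \<psi> (P (- s') *v y) \<le> exp (a * (s - s')) * \<psi> (P (- s') *v y)"
          by (intro mult_right_mono \<psi>_nonneg exp_ge_add_one_self)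
        with 2 have "a * (s - s') * \<psi> (P (- s') *v y) \<le> \<psi> (P (- s) *v y) - \<psi> (P (- s') *v y)"
          by (simp add: algebra_simps)
        moreover have "a * (s - s') * (\<rho>\<^sup>2 / 4) \<le> a * (s - s') * \<psi> (P (- s') *v y)"
          using 1 py a s by (intro mult_left_mono) auto
        moreover have "(a * \<rho>\<^sup>2 / 8) * (s - s') = (a * (s - s') * (\<rho>\<^sup>2 / 4)) / 2" by simp
        ultimately show ?thesis by linarith
      qed
      have "(\<integral>\<^sup>+s. indicator {0..T} s * g (P (- s) *v y) \<partial>lborel) \<le>
         (\<integral>\<^sup>+s. ennreal (exp (- ?r s)) * indicator {s. 0 \<le> s \<and> exp (- ?r s) < F y / \<alpha>} s \<partial>lborel)"
      proof (rule nn_integral_mono)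
        fix s
        have "exp (- ?r s) < F y / \<alpha>" if "0 \<le> s" "P (- s) *v y \<in> A"
        proof -
          have "exp (- ?r s) < F (P (- s) *v y) / \<alpha>" using that(2) by (simp add: A_def)
          \<comment> \<open>Monotonicity replaces the value of \<open>F\<close> at the backward
            point by the value at \<open>y\<close>. The threshold no longer depends on
            \<open>s\<close>, so the integral over times comes out proportional to
            \<open>F y\<close>.\<close>
          also have "\<dots> \<le> F y / \<alpha>"
            using mono[OF that(1), of "P (- s) *v y"] \<alpha> by (simp add: P_add_vec divide_right_mono)
          finally show ?thesis .
        qed
        then show "indicator {0..T} s * g (P (- s) *v y) \<le>
           ennreal (exp (- ?r s)) * indicator {s. 0 \<le> s \<and> exp (- ?r s) < F y / \<alpha>} s"
          by (auto simp: indicator_def g_def)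
      qed
      also have "\<dots> \<le> ennreal ((F y / \<alpha>) / (a * \<rho>\<^sup>2 / 8))"
        by (rule nn_integral_exp_superlinear_le[OF r]) (use a \<rho> \<alpha> F0 in auto)
      also have "(F y / \<alpha>) / (a * \<rho>\<^sup>2 / 8) = 8 / (a * \<rho>\<^sup>2 * \<alpha>) * F y"
        using a \<rho> \<alpha> by (simp add: field_simps)
      also have "ennreal \<dots> = ennreal (8 / (a * \<rho>\<^sup>2 * \<alpha>)) * ennreal (F y)"
        using a \<rho> \<alpha> F0 by (intro ennreal_mult) auto
      finally show ?thesis .
    qed
    have "ennreal (v * (h / \<rho>)) * (\<integral>\<^sup>+x. g x \<partial>lborel) = ennreal v * (\<integral>\<^sup>+x. g x * ennreal (h / \<rho>) \<partial>lborel)"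
    proof -
      have "ennreal (v * (h / \<rho>)) = ennreal v * ennreal (h / \<rho>)"
        using v h \<rho> by (intro ennreal_mult) auto
      then show ?thesis by (simp add: nn_integral_multc mult.assoc mult.commute[of "ennreal (h / \<rho>)"])
    qed
    \<comment> \<open>Each point of \<open>A\<close> is counted with the time its trajectory spends
      in the shell, which is at least \<open>h / \<rho>\<close>.\<close>
    also have "\<dots> \<le> ennreal v * (\<integral>\<^sup>+x. (\<integral>\<^sup>+s. indicator {0..T} s * (g x * indicator Sh (P s *v x)) \<partial>lborel) \<partial>lborel)"
    proof (intro mult_left_mono nn_integral_mono)
      fix x
      have "g x * ennreal (h / \<rho>) \<le> g x * (\<integral>\<^sup>+s. indicator {0..T} s * indicator Sh (P s *v x) \<partial>lborel)"
      proof (cases "x \<in> A")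
        case True
        then show ?thesis using pass[of \<rho> x] \<rho> unfolding Sh_def
          by (intro mult_left_mono) (auto simp: A_def)
      qed (simp add: g_def)
      also have "\<dots> = (\<integral>\<^sup>+s. g x * (indicator {0..T} s * indicator Sh (P s *v x)) \<partial>lborel)"
        by (rule nn_integral_cmult[symmetric]) measurable
      finally show "g x * ennreal (h / \<rho>) \<le> (\<integral>\<^sup>+s. indicator {0..T} s * (g x * indicator Sh (P s *v x)) \<partial>lborel)"
        by (simp add: mult_ac)
    qed simp
    also have "(\<integral>\<^sup>+x. (\<integral>\<^sup>+s. indicator {0..T} s * (g x * indicator Sh (P s *v x)) \<partial>lborel) \<partial>lborel)
       = (\<integral>\<^sup>+s. (\<integral>\<^sup>+x. indicator {0..T} s * (g x * indicator Sh (P s *v x)) \<partial>lborel) \<partial>lborel)"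
      by (rule lborel_pair.Fubini') measurable
    also have "ennreal v * \<dots> = (\<integral>\<^sup>+s. ennreal v * (\<integral>\<^sup>+x. indicator {0..T} s * (g x * indicator Sh (P s *v x)) \<partial>lborel) \<partial>lborel)"
      by (rule nn_integral_cmult[symmetric]) measurable
    \<comment> \<open>For fixed \<open>s\<close> the new variable is \<open>y = P s *v x\<close>, a
      point of the shell, and \<open>x\<close> becomes the backward point
      \<open>P (- s) *v y\<close>.\<close>
    also have "\<dots> \<le> (\<integral>\<^sup>+s. ennreal V' * (\<integral>\<^sup>+y. indicator {0..T} s * (g (P (- s) *v y) * indicator Sh y) \<partial>lborel) \<partial>lborel)"
    proof (rule nn_integral_mono)
      fix s
      show "ennreal v * (\<integral>\<^sup>+x. indicator {0..T} s * (g x * indicator Sh (P s *v x)) \<partial>lborel) \<le>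
         ennreal V' * (\<integral>\<^sup>+y. indicator {0..T} s * (g (P (- s) *v y) * indicator Sh y) \<partial>lborel)"
      proof (cases "s \<in> {0..T}")
        case True
        let ?k = "\<lambda>y. g (P (- s) *v y) * indicator Sh y"
        have "emeasure lborel (ball (0::real^'n) 1) * (\<integral>\<^sup>+x. ?k (P s *v x) \<partial>lborel) \<le>
          emeasure lborel (ball (0::real^'n) K) * (\<integral>\<^sup>+x. ?k x \<partial>lborel)"
          by (rule nn_integral_linear_le[where f' = "\<lambda>y. P (- s) *v y"])
            (use True K in \<open>auto simp: P_add_vec\<close>)
        then show ?thesis using True by (simp add: P_add_vec ev)
      qed simp
    qed
    also have "\<dots> = ennreal V' * (\<integral>\<^sup>+s. (\<integral>\<^sup>+y. indicator {0..T} s * (g (P (- s) *v y) * indicator Sh y) \<partial>lborel) \<partial>lborel)"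
      by (rule nn_integral_cmult) measurable
    also have "(\<integral>\<^sup>+s. (\<integral>\<^sup>+y. indicator {0..T} s * (g (P (- s) *v y) * indicator Sh y) \<partial>lborel) \<partial>lborel)
       = (\<integral>\<^sup>+y. (\<integral>\<^sup>+s. indicator {0..T} s * (g (P (- s) *v y) * indicator Sh y) \<partial>lborel) \<partial>lborel)"
      by (rule lborel_pair.Fubini') measurable
    also have "ennreal V' * \<dots> \<le> ennreal V' * (\<integral>\<^sup>+y. ennreal (8 / (a * \<rho>\<^sup>2 * \<alpha>)) * (ennreal (F y) * indicator {y. \<bar>N y - \<rho>\<bar> \<le> 1} y) \<partial>lborel)"
    proof (intro mult_left_mono nn_integral_mono)
      fix y
      show "(\<integral>\<^sup>+s. indicator {0..T} s * (g (P (- s) *v y) * indicator Sh y) \<partial>lborel) \<le>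
        ennreal (8 / (a * \<rho>\<^sup>2 * \<alpha>)) * (ennreal (F y) * indicator {y. \<bar>N y - \<rho>\<bar> \<le> 1} y)"
      proof (cases "y \<in> Sh")
        case True
        then have "\<bar>N y - \<rho>\<bar> \<le> 1" by (auto simp: Sh_def)
        then show ?thesis using inner[OF True] True by simp
      qed simp
    qed simp
    also have "\<dots> = ennreal (V' * (8 / (a * \<rho>\<^sup>2 * \<alpha>))) * (\<integral>\<^sup>+y. ennreal (F y) * indicator {y. \<bar>N y - \<rho>\<bar> \<le> 1} y \<partial>lborel)"
    proof -
      have "ennreal (V' * (8 / (a * \<rho>\<^sup>2 * \<alpha>))) = ennreal V' * ennreal (8 / (a * \<rho>\<^sup>2 * \<alpha>))"
        using V' a \<alpha> by (intro ennreal_mult) auto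
      then show ?thesis by (simp add: nn_integral_cmult mult.assoc)
    qed
    finally have fin: "ennreal (v * (h / \<rho>)) * (\<integral>\<^sup>+x. g x \<partial>lborel) \<le>
       ennreal (V' * (8 / (a * \<rho>\<^sup>2 * \<alpha>))) * (\<integral>\<^sup>+y. ennreal (F y) * indicator {y. \<bar>N y - \<rho>\<bar> \<le> 1} y \<partial>lborel)"
      (is "_ \<le> _ * ?I") .
    have "(\<integral>\<^sup>+x. g x \<partial>lborel) = ennreal (1 / (v * (h / \<rho>))) * (ennreal (v * (h / \<rho>)) * (\<integral>\<^sup>+x. g x \<partial>lborel))"
      using v h \<rho> by (simp add: mult.assoc[symmetric] ennreal_mult[symmetric])
    also have "\<dots> \<le> ennreal (1 / (v * (h / \<rho>))) * (ennreal (V' * (8 / (a * \<rho>\<^sup>2 * \<alpha>))) * ?I)"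
      by (intro mult_left_mono fin) simp
    also have "\<dots> = ennreal (1 / (v * (h / \<rho>)) * (V' * (8 / (a * \<rho>\<^sup>2 * \<alpha>)))) * ?I"
    proof -
      have "ennreal (1 / (v * (h / \<rho>)) * (V' * (8 / (a * \<rho>\<^sup>2 * \<alpha>)))) =
          ennreal (1 / (v * (h / \<rho>))) * ennreal (V' * (8 / (a * \<rho>\<^sup>2 * \<alpha>)))"
        using v h \<rho> V' a \<alpha> by (intro ennreal_mult) auto
      then show ?thesis by (simp only: mult.assoc)
    qed
    also have "1 / (v * (h / \<rho>)) * (V' * (8 / (a * \<rho>\<^sup>2 * \<alpha>))) = C / (\<rho> * \<alpha>)"
      using v h \<rho> a \<alpha> by (simp add: C_def field_simps power2_eq_square)
    finally show ?thesis unfolding g_def A_def .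
  qed
  show ?thesis using main C by blast
qed


section \<open>The maximal function\<close>

abbreviation \<gamma> :: "(real^'n) measure" where "\<gamma> \<equiv> ou_gauss Q B \<infinity>"

lemma space_\<gamma> [simp]: "space \<gamma> = UNIV" by (simp add: ou_gauss_def)

lemma sets_\<gamma> [simp, measurable_cong]: "sets \<gamma> = sets borel" by (simp add: ou_gauss_def)

lemma \<gamma>_eq:
  "\<exists>c\<ge>0. \<gamma> = density lborel (\<lambda>y. ennreal c * ennreal (exp (- \<psi> y / 2)))"
proof -
  define c where "c = (2 * pi) powr (- real CARD('n) / 2) * det S powr (- 1 / 2)"
  have "c \<ge> 0" by (simp add: c_def)
  then have "\<gamma> = density lborel (\<lambda>y. ennreal c * ennreal (exp (- \<psi> y / 2)))"
    unfolding ou_gauss_def S_def[symmetric] J_def[symmetric] c_def \<psi>_def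
    by (simp add: ennreal_mult[symmetric])
  then show ?thesis using \<open>c \<ge> 0\<close> by blast
qed

lemma sigma_finite_\<gamma>: "sigma_finite_measure \<gamma>" and emeasure_\<gamma>_finite: "emeasure \<gamma> UNIV < \<infinity>"
proof -
  obtain c where c: "c \<ge> 0" "\<gamma> = density lborel (\<lambda>y. ennreal c * ennreal (exp (- \<psi> y / 2)))"
    using \<gamma>_eq by blast
  have meas: "(\<lambda>y. ennreal c * ennreal (exp (- \<psi> y / 2))) \<in> borel_measurable lborel" by measurable
  have "emeasure \<gamma> UNIV = (\<integral>\<^sup>+y. ennreal c * ennreal (exp (- \<psi> y / 2)) \<partial>lborel)"
    unfolding c(2) using emeasure_density[OF meas, of UNIV] by simp
  also have "\<dots> = ennreal c * (\<integral>\<^sup>+y. ennreal (exp (- (1 / 2) * \<psi> y)) \<partial>lborel)"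
    by (subst nn_integral_cmult) simp_all
  also have "\<dots> < \<infinity>" using \<psi>_gaussian_finite[of "1 / 2"] by (simp add: ennreal_mult_less_top)
  finally show fin: "emeasure \<gamma> UNIV < \<infinity>" .
  then have "finite_measure \<gamma>" by (intro finite_measureI) (simp add: less_top)
  then show "sigma_finite_measure \<gamma>" by (simp add: finite_measure_def)
qed

section \<open>Integrability, continuity and open level sets\<close>

lemma continuous_mehler_kernel:
  "continuous_on A f \<Longrightarrow> continuous_on A g \<Longrightarrow> continuous_on A (\<lambda>z. mehler_kernel Q B t (f z) (g z))"
  unfolding mehler_kernel_def ou_R_def by (intro continuous_intros)

lemma measurable_mehler_kernel [measurable]: "mehler_kernel Q B t x \<in> borel_measurable borel"
  by (rule borel_measurable_continuous_onI) (intro continuous_mehler_kernel continuous_intros)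

lemma mehler_kernel_bounds:
  obtains C where "C \<ge> 1"
    "\<And>t x u. t \<ge> 1 \<Longrightarrow> \<bar>mehler_kernel Q B t x u\<bar> \<le> C * exp (\<psi> x / 2) * exp (- \<psi> (x - P t *v u) / 2)"
    "\<And>t x u. t \<ge> 1 \<Longrightarrow> \<bar>mehler_kernel Q B t x u\<bar> \<le> C * exp (\<psi> x / 2)"
proof -
  obtain C where C: "C > 0" "\<And>t x u. t \<ge> 1 \<Longrightarrow> \<bar>mehler_kernel Q B t x u\<bar> \<le> C * exp (\<psi> x / 2) * exp (- \<psi> (x - P t *v u) / 2)"
    using mehler_kernel_bound by blast
  have 1: "\<bar>mehler_kernel Q B t x u\<bar> \<le> max 1 C * exp (\<psi> x / 2) * exp (- \<psi> (x - P t *v u) / 2)" if "t \<ge> 1" for t x u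
    by (rule order_trans[OF C(2)[OF that]]) (intro mult_right_mono, auto)
  moreover have "\<bar>mehler_kernel Q B t x u\<bar> \<le> max 1 C * exp (\<psi> x / 2)" if "t \<ge> 1" for t x u
    by (rule order_trans[OF 1[OF that]]) (auto intro!: mult_left_le simp: \<psi>_nonneg)
  ultimately show ?thesis using that[of "max 1 C"] by simp
qed

lemma mehler_kernel_integrable:
  assumes t: "t \<ge> 1" and f: "integrable \<gamma> f"
  shows "integrable \<gamma> (\<lambda>u. mehler_kernel Q B t x u * f u)"
proof -
  obtain C where "C \<ge> 1" and C: "\<And>u. \<bar>mehler_kernel Q B t x u\<bar> \<le> C * exp (\<psi> x / 2)"
    using mehler_kernel_bounds t by metis
  have [measurable]: "f \<in> borel_measurable borel"
    using borel_measurable_integrable[OF f] by simp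
  show ?thesis
  proof (rule Bochner_Integration.integrable_bound)
    show "integrable \<gamma> (\<lambda>u. C * exp (\<psi> x / 2) * \<bar>f u\<bar>)" using f by simp
    have "\<bar>mehler_kernel Q B t x u * f u\<bar> \<le> \<bar>C * exp (\<psi> x / 2) * \<bar>f u\<bar>\<bar>" for u
      using mult_right_mono[OF C[of u], of "\<bar>f u\<bar>"] \<open>C \<ge> 1\<close> by (simp add: abs_mult)
    then show "AE u in \<gamma>. norm (mehler_kernel Q B t x u * f u) \<le> norm (C * exp (\<psi> x / 2) * \<bar>f u\<bar>)" by simp
  qed measurable
qed

text \<open>Along a convergent sequence \<open>\<psi>\<close> is bounded, so a constant multiple of
  \<open>\<bar>f u\<bar>\<close> dominates. Continuity serves measurability: a level set of the
  supremum is a union of open sets, however many times are involved.\<close>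

lemma ou_semigroup_continuous:
  assumes t: "t \<ge> 1" and f: "integrable \<gamma> f"
  shows "continuous_on UNIV (ou_semigroup Q B t f)"
proof (rule continuous_at_imp_continuous_on, intro ballI)
  fix a :: "real^'n"
  obtain C where C: "C \<ge> 1" "\<And>x u. \<bar>mehler_kernel Q B t x u\<bar> \<le> C * exp (\<psi> x / 2)"
    using mehler_kernel_bounds t by metis
  have [measurable]: "f \<in> borel_measurable borel"
    using borel_measurable_integrable[OF f] by simp
  show "isCont (ou_semigroup Q B t f) a"
    unfolding continuous_at_sequentially
  proof (intro allI impI)
    fix X :: "nat \<Rightarrow> real^'n" assume X: "X \<longlonglongrightarrow> a"
    have "continuous_on UNIV \<psi>" by (intro continuous_intros)
    then have "(\<lambda>n. \<psi> (X n)) \<longlonglongrightarrow> \<psi> a"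
      using X by (rule continuous_on_tendsto_compose) auto
    then have "Bseq (\<lambda>n. \<psi> (X n))" by (intro convergent_imp_Bseq convergentI)
    then obtain M where M: "\<And>n. norm (\<psi> (X n)) \<le> M" unfolding Bseq_def by blast
    show "(ou_semigroup Q B t f \<circ> X) \<longlonglongrightarrow> ou_semigroup Q B t f a"
      unfolding ou_semigroup_def comp_def
    proof (rule integral_dominated_convergence[where w = "\<lambda>u. C * exp (M / 2) * \<bar>f u\<bar>"])
      show "integrable \<gamma> (\<lambda>u. C * exp (M / 2) * \<bar>f u\<bar>)" using f by simp
      show "AE u in \<gamma>. (\<lambda>n. mehler_kernel Q B t (X n) u * f u) \<longlonglongrightarrow> mehler_kernel Q B t a u * f u"
      proof (intro AE_I2 tendsto_intros)
        fix u
        have "continuous_on UNIV (\<lambda>x. mehler_kernel Q B t x u)"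
          by (intro continuous_mehler_kernel continuous_intros)
        then show "(\<lambda>n. mehler_kernel Q B t (X n) u) \<longlonglongrightarrow> mehler_kernel Q B t a u"
          using X by (rule continuous_on_tendsto_compose) auto
      qed
      fix n
      have "\<bar>mehler_kernel Q B t (X n) u * f u\<bar> \<le> C * exp (M / 2) * \<bar>f u\<bar>" for u
      proof -
        have "\<bar>mehler_kernel Q B t (X n) u\<bar> \<le> C * exp (\<psi> (X n) / 2)" by (rule C)
        also have "\<dots> \<le> C * exp (M / 2)" using M[of n] C(1) by (intro mult_left_mono) auto
        finally show ?thesis by (simp add: abs_mult mult_right_mono)
      qed
      then show "AE u in \<gamma>. norm (mehler_kernel Q B t (X n) u * f u) \<le> C * exp (M / 2) * \<bar>f u\<bar>" by simp
    qed measurable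
  qed
qed

lemma ou_maximal_gt_iff:
  "ou_maximal Q B f x > ereal \<alpha> \<longleftrightarrow> (\<exists>t>1. \<bar>ou_semigroup Q B t f x\<bar> > \<alpha>)"
  by (auto simp: ou_maximal_def less_SUP_iff)

lemma ou_maximal_level_sets:
  assumes "integrable \<gamma> f"
  shows "{x. ou_maximal Q B f x > ereal \<alpha>} \<in> sets \<gamma>"
proof -
  have "{x. ou_maximal Q B f x > ereal \<alpha>} = (\<Union>t\<in>{1<..}. {x. \<alpha> < \<bar>ou_semigroup Q B t f x\<bar>})"
    by (auto simp: ou_maximal_gt_iff)
  also have "open \<dots>"
    by (intro open_UN ballI open_Collect_less continuous_intros ou_semigroup_continuous assms) auto
  finally show ?thesis by simp
qed

lemma ou_semigroup_tube_bound:
  obtains C where "C \<ge> 1"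
    "\<And>t x f. t \<ge> 1 \<Longrightarrow> integrable \<gamma> f \<Longrightarrow> ennreal \<bar>ou_semigroup Q B t f x\<bar> \<le>
       ennreal (C * exp (\<psi> x / 2)) * (\<integral>\<^sup>+u. tube_kernel x u * ennreal \<bar>f u\<bar> \<partial>\<gamma>)"
proof -
  obtain C where C: "C \<ge> 1" "\<And>t x u. t \<ge> 1 \<Longrightarrow> \<bar>mehler_kernel Q B t x u\<bar> \<le> C * exp (\<psi> x / 2) * exp (- \<psi> (x - P t *v u) / 2)"
    using mehler_kernel_bounds by metis
  have "ennreal \<bar>ou_semigroup Q B t f x\<bar> \<le> ennreal (C * exp (\<psi> x / 2)) * (\<integral>\<^sup>+u. tube_kernel x u * ennreal \<bar>f u\<bar> \<partial>\<gamma>)"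
    if t: "t \<ge> 1" and f: "integrable \<gamma> f" for t x f
  proof -
    have [measurable]: "f \<in> borel_measurable borel"
      using borel_measurable_integrable[OF f] by simp
    have "ennreal \<bar>ou_semigroup Q B t f x\<bar> \<le> (\<integral>\<^sup>+u. ennreal \<bar>mehler_kernel Q B t x u * f u\<bar> \<partial>\<gamma>)"
      using integral_norm_bound_ennreal[OF mehler_kernel_integrable[OF t f], of x]
      by (simp add: ou_semigroup_def)
    also have "\<dots> \<le> (\<integral>\<^sup>+u. ennreal (C * exp (\<psi> x / 2)) * (tube_kernel x u * ennreal \<bar>f u\<bar>) \<partial>\<gamma>)"
    proof (rule nn_integral_mono)
      fix u
      have "ennreal \<bar>mehler_kernel Q B t x u\<bar> \<le> ennreal (C * exp (\<psi> x / 2) * exp (- \<psi> (x - P t *v u) / 2))"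
        by (intro ennreal_leI C t)
      also have "\<dots> = ennreal (C * exp (\<psi> x / 2)) * ennreal (exp (- \<psi> (x - P t *v u) / 2))"
        using C(1) by (intro ennreal_mult) auto
      also have "\<dots> \<le> ennreal (C * exp (\<psi> x / 2)) * tube_kernel x u"
        using t unfolding tube_kernel_def by (intro mult_left_mono SUP_upper) auto
      finally show "ennreal \<bar>mehler_kernel Q B t x u * f u\<bar> \<le> ennreal (C * exp (\<psi> x / 2)) * (tube_kernel x u * ennreal \<bar>f u\<bar>)"
        by (simp add: abs_mult ennreal_mult mult.assoc[symmetric] mult_right_mono)
    qed
    also have "\<dots> = ennreal (C * exp (\<psi> x / 2)) * (\<integral>\<^sup>+u. tube_kernel x u * ennreal \<bar>f u\<bar> \<partial>\<gamma>)"
      by (rule nn_integral_cmult) measurable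
    finally show ?thesis .
  qed
  with C(1) show ?thesis using that by blast
qed

text \<open>The exponent \<open>1 / 2\<close> is split into \<open>3 / 8 + 1 / 8\<close>. Where
  \<open>\<psi> x > 2 * \<rho>\<^sup>2\<close>, the first part gives at most
  \<open>exp (- 3 / 4 * \<rho>\<^sup>2)\<close>, which beyond the required
  \<open>exp (- \<rho>\<^sup>2 / 2)\<close> leaves
  \<open>exp (- \<rho>\<^sup>2 / 4) \<le> 1 / \<rho>\<close>; the second part is integrable.\<close>

lemma \<gamma>_far_bound:
  "\<exists>C\<ge>0. \<forall>\<rho>\<ge>2. (\<integral>\<^sup>+x. ennreal (exp (- \<psi> x / 2)) * indicator {x. 2 * \<rho>\<^sup>2 < \<psi> x} x \<partial>lborel) \<le> ennreal (C / (\<rho> * exp (\<rho>\<^sup>2 / 2)))"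
proof -
  have "(\<integral>\<^sup>+x. ennreal (exp (- (1 / 8) * \<psi> x)) \<partial>lborel) < \<infinity>"
    by (rule \<psi>_gaussian_finite) simp
  then obtain C where C: "C \<ge> 0" "(\<integral>\<^sup>+x. ennreal (exp (- (1 / 8) * \<psi> x)) \<partial>lborel) = ennreal C"
    by (metis enn2real_nonneg ennreal_enn2real infinity_ennreal_def)
  have "(\<integral>\<^sup>+x. ennreal (exp (- \<psi> x / 2)) * indicator {x. 2 * \<rho>\<^sup>2 < \<psi> x} x \<partial>lborel) \<le> ennreal (C / (\<rho> * exp (\<rho>\<^sup>2 / 2)))"
    if \<rho>: "\<rho> \<ge> 2" for \<rho>
  proof -
    have "(\<integral>\<^sup>+x. ennreal (exp (- \<psi> x / 2)) * indicator {x. 2 * \<rho>\<^sup>2 < \<psi> x} x \<partial>lborel) \<le>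
      (\<integral>\<^sup>+x. ennreal (1 / (\<rho> * exp (\<rho>\<^sup>2 / 2))) * ennreal (exp (- (1 / 8) * \<psi> x)) \<partial>lborel)"
    proof (rule nn_integral_mono)
      fix x
      have "exp (- \<psi> x / 2) \<le> 1 / (\<rho> * exp (\<rho>\<^sup>2 / 2)) * exp (- (1 / 8) * \<psi> x)" if x: "2 * \<rho>\<^sup>2 < \<psi> x"
      proof -
        have "\<rho> \<le> 1 + \<rho>\<^sup>2 / 4" using zero_le_power2[of "1 - \<rho> / 2"] by (simp add: power2_diff power_divide)
        also have "\<dots> \<le> exp (\<rho>\<^sup>2 / 4)" by (rule exp_ge_add_one_self)
        finally have "1 / exp (\<rho>\<^sup>2 / 4) \<le> 1 / \<rho>" using \<rho> by (intro divide_left_mono) auto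
        then have "1 / exp (\<rho>\<^sup>2 / 4) * (1 / exp (\<rho>\<^sup>2 / 2)) \<le> 1 / \<rho> * (1 / exp (\<rho>\<^sup>2 / 2))"
          by (intro mult_right_mono) auto
        moreover have "exp (- (3 / 8) * \<psi> x) \<le> exp (- (\<rho>\<^sup>2 / 4) - \<rho>\<^sup>2 / 2)" using x by simp
        moreover have "exp (- (\<rho>\<^sup>2 / 4) - \<rho>\<^sup>2 / 2) = 1 / exp (\<rho>\<^sup>2 / 4) * (1 / exp (\<rho>\<^sup>2 / 2))"
          unfolding exp_diff exp_minus by (simp only: inverse_eq_divide divide_divide_eq_left times_divide_eq_right mult_1_right)
        moreover have "1 / \<rho> * (1 / exp (\<rho>\<^sup>2 / 2)) = 1 / (\<rho> * exp (\<rho>\<^sup>2 / 2))" by simp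
        ultimately have 1: "exp (- (3 / 8) * \<psi> x) \<le> 1 / (\<rho> * exp (\<rho>\<^sup>2 / 2))" by linarith
        have "exp (- \<psi> x / 2) = exp (- (3 / 8) * \<psi> x) * exp (- (1 / 8) * \<psi> x)"
          by (simp add: exp_add[symmetric])
        also have "\<dots> \<le> 1 / (\<rho> * exp (\<rho>\<^sup>2 / 2)) * exp (- (1 / 8) * \<psi> x)"
          by (intro mult_right_mono 1) simp
        finally show ?thesis .
      qed
      then show "ennreal (exp (- \<psi> x / 2)) * indicator {x. 2 * \<rho>\<^sup>2 < \<psi> x} x \<le>
         ennreal (1 / (\<rho> * exp (\<rho>\<^sup>2 / 2))) * ennreal (exp (- (1 / 8) * \<psi> x))"
        using \<rho> by (auto simp: indicator_def ennreal_mult[symmetric] intro!: ennreal_leI)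
    qed
    also have "\<dots> = ennreal (1 / (\<rho> * exp (\<rho>\<^sup>2 / 2))) * ennreal C"
      unfolding C(2)[symmetric] by (rule nn_integral_cmult) measurable
    also have "\<dots> = ennreal (C / (\<rho> * exp (\<rho>\<^sup>2 / 2)))"
      using C(1) \<rho> by (simp add: ennreal_mult[symmetric])
    finally show ?thesis .
  qed
  with C(1) show ?thesis by blast
qed

text \<open>The near part and the far part both come out of order
  \<open>1 / (\<rho> * \<beta>)\<close>, the far one because
  \<open>exp (\<rho>\<^sup>2 / 2) = \<beta>\<close>. Large levels ensure that
  \<open>\<rho> \<ge> 2\<close> and that \<open>ln \<beta>\<close> is comparable with
  \<open>ln \<alpha>\<close>.\<close>

lemma ou_maximal_large_level_bound:
  obtains C \<alpha>\<^sub>0 where "C \<ge> 0" "\<alpha>\<^sub>0 > 2"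
    "\<And>f \<alpha>. integrable \<gamma> f \<Longrightarrow> (LINT x|\<gamma>. \<bar>f x\<bar>) = 1 \<Longrightarrow> \<alpha> \<ge> \<alpha>\<^sub>0 \<Longrightarrow>
       emeasure \<gamma> {x. ou_maximal Q B f x > ereal \<alpha>} \<le> ennreal (C / (\<alpha> * sqrt (ln \<alpha>)))"
proof -
  obtain c where c: "c \<ge> 0" "\<gamma> = density lborel (\<lambda>y. ennreal c * ennreal (exp (- \<psi> y / 2)))"
    using \<gamma>_eq by blast
  obtain K where K: "K \<ge> 1"
    "\<And>t x f. t \<ge> 1 \<Longrightarrow> integrable \<gamma> f \<Longrightarrow> ennreal \<bar>ou_semigroup Q B t f x\<bar> \<le>
       ennreal (K * exp (\<psi> x / 2)) * (\<integral>\<^sup>+u. tube_kernel x u * ennreal \<bar>f u\<bar> \<partial>\<gamma>)"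
    by (rule ou_semigroup_tube_bound, rule that)
  obtain C1 where C1: "C1 \<ge> 0"
    "\<And>F \<rho> \<alpha>. \<rho> \<ge> 2 \<Longrightarrow> \<alpha> > 0 \<Longrightarrow> F \<in> borel_measurable borel \<Longrightarrow> (\<And>x. 0 \<le> F x) \<Longrightarrow> (\<And>x s. s \<ge> 0 \<Longrightarrow> F x \<le> F (P s *v x)) \<Longrightarrow>
     (\<integral>\<^sup>+x. ennreal (exp (- \<psi> x / 2)) * indicator {x. \<rho>\<^sup>2 \<le> \<psi> x \<and> \<psi> x \<le> 2 * \<rho>\<^sup>2 \<and> exp (- \<psi> x / 2) < F x / \<alpha>} x \<partial>lborel)
      \<le> ennreal (C1 / (\<rho> * \<alpha>)) * (\<integral>\<^sup>+y. ennreal (F y) * indicator {y. \<bar>N y - \<rho>\<bar> \<le> 1} y \<partial>lborel)"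
    using flow_level_set_bound by blast
  obtain C2 where C2: "C2 \<ge> 0"
    "\<And>u \<rho>. \<rho> > 0 \<Longrightarrow> (\<integral>\<^sup>+y. tube_kernel y u * indicator {y. \<bar>N y - \<rho>\<bar> \<le> 1} y \<partial>lborel) \<le> ennreal C2"
    using tube_kernel_shell_integral by blast
  obtain C3 where C3: "C3 \<ge> 0"
    "\<And>\<rho>. \<rho> \<ge> 2 \<Longrightarrow> (\<integral>\<^sup>+x. ennreal (exp (- \<psi> x / 2)) * indicator {x. 2 * \<rho>\<^sup>2 < \<psi> x} x \<partial>lborel) \<le> ennreal (C3 / (\<rho> * exp (\<rho>\<^sup>2 / 2)))"
    using \<gamma>_far_bound by blast
  define D where "D = c * (C1 * C2 + C3) * K"
  have D: "D \<ge> 0" using c C1 C2 C3 K by (simp add: D_def)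
  \<comment> \<open>\<open>K * exp 2 \<le> \<alpha>\<close> gives \<open>ln \<beta> \<ge> 2\<close>,
    that is \<open>\<rho> \<ge> 2\<close>; \<open>K\<^sup>2 \<le> \<alpha>\<close> gives
    \<open>ln \<alpha> \<le> 2 * ln \<beta>\<close>, that is
    \<open>sqrt (ln \<alpha>) \<le> \<rho>\<close>.\<close>
  define a0 where "a0 = K\<^sup>2 * exp 2"
  have K2: "K \<le> K\<^sup>2" "1 \<le> K\<^sup>2" using K(1) by (auto simp: power2_eq_square mult_le_cancel_left1 intro: mult_mono[of 1 K 1 K, simplified])
  have e2: "exp (2::real) \<ge> 3" using exp_ge_add_one_self[of "2::real"] by simp
  have a0: "a0 > 2" "K\<^sup>2 \<le> a0" "K * exp 2 \<le> a0"
    using K2 e2 mult_mono[of 1 "K\<^sup>2" 3 "exp (2::real)"] by (auto simp: a0_def mult_le_cancel_left1)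
  have main: "emeasure \<gamma> {x. ou_maximal Q B f x > ereal \<alpha>} \<le> ennreal (D / (\<alpha> * sqrt (ln \<alpha>)))"
    if f: "integrable \<gamma> f" and f1: "(LINT x|\<gamma>. \<bar>f x\<bar>) = 1" and \<alpha>: "\<alpha> \<ge> a0" for f \<alpha>
  proof -
    have [measurable]: "f \<in> borel_measurable borel"
      using borel_measurable_integrable[OF f] by simp
    have nf: "(\<integral>\<^sup>+u. ennreal \<bar>f u\<bar> \<partial>\<gamma>) = 1"
      using nn_integral_eq_integral[of \<gamma> "\<lambda>u. \<bar>f u\<bar>"] f f1 by simp
    \<comment> \<open>The constant of the kernel bound is absorbed into the level.\<close>
    define \<beta> where "\<beta> = \<alpha> / K"
    have \<alpha>0: "\<alpha> > 0" using a0 \<alpha> by simp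
    have \<beta>: "\<beta> > 0" "\<beta> \<ge> exp 2" using \<alpha>0 a0(3) \<alpha> K(1) by (auto simp: \<beta>_def field_simps)
    have ln\<beta>: "ln \<beta> \<ge> 2" using \<beta> by (metis ln_exp ln_le_cancel_iff exp_gt_zero)
    \<comment> \<open>At this radius \<open>exp (\<psi> x / 2)\<close> equals
      \<open>\<beta>\<close>; as \<open>F \<le> 1\<close>, the level set lies outside it.\<close>
    define \<rho> where "\<rho> = sqrt (2 * ln \<beta>)"
    have \<rho>2: "\<rho>\<^sup>2 = 2 * ln \<beta>" using ln\<beta> by (simp add: \<rho>_def)
    have \<rho>: "\<rho> \<ge> 2" using real_le_rsqrt[of 2 "2 * ln \<beta>"] ln\<beta> by (simp add: \<rho>_def)
    have \<rho>exp: "exp (\<rho>\<^sup>2 / 2) = \<beta>" using \<rho>2 \<beta> by simp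
    define F' where "F' x = (\<integral>\<^sup>+u. tube_kernel x u * ennreal \<bar>f u\<bar> \<partial>\<gamma>)" for x
    interpret \<gamma>: sigma_finite_measure \<gamma> by (rule sigma_finite_\<gamma>)
    interpret pair_sigma_finite lborel \<gamma> by standard
    have [measurable]: "F' \<in> borel_measurable borel"
      unfolding F'_def by measurable
    have F'1: "F' x \<le> 1" for x
    proof -
      have "F' x \<le> (\<integral>\<^sup>+u. 1 * ennreal \<bar>f u\<bar> \<partial>\<gamma>)"
        unfolding F'_def by (intro nn_integral_mono mult_right_mono tube_kernel_le_1) auto
      then show ?thesis using nf by simp
    qed
    \<comment> \<open>\<open>flow_level_set_bound\<close> is stated for real functions; since
      \<open>F' x \<le> 1\<close>, the conversion loses nothing.\<close>
    define F where "F x = enn2real (F' x)" for x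
    have F: "ennreal (F x) = F' x" for x
      unfolding F_def using F'1[of x] by (intro ennreal_enn2real) (auto intro: le_less_trans)
    have F0: "0 \<le> F x" for x by (simp add: F_def)
    have F1: "F x \<le> 1" for x using F'1[of x] F0[of x] by (simp add: F[symmetric])
    have [measurable]: "F \<in> borel_measurable borel" unfolding F_def by measurable
    have Fmono: "F x \<le> F (P s *v x)" if "s \<ge> 0" for x s
    proof -
      have "F' x \<le> F' (P s *v x)"
        unfolding F'_def by (intro nn_integral_mono mult_right_mono tube_kernel_P_mono that) auto
      then show ?thesis using F0 by (simp add: F[symmetric])
    qed
    have shell: "(\<integral>\<^sup>+y. ennreal (F y) * indicator {y. \<bar>N y - \<rho>\<bar> \<le> 1} y \<partial>lborel) \<le> ennreal C2"
    proof -
      have "(\<integral>\<^sup>+y. ennreal (F y) * indicator {y. \<bar>N y - \<rho>\<bar> \<le> 1} y \<partial>lborel) =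
         (\<integral>\<^sup>+y. (\<integral>\<^sup>+u. tube_kernel y u * ennreal \<bar>f u\<bar> * indicator {y. \<bar>N y - \<rho>\<bar> \<le> 1} y \<partial>\<gamma>) \<partial>lborel)"
        unfolding F F'_def by (intro nn_integral_cong) (rule nn_integral_multc[symmetric], measurable)
      \<comment> \<open>After the exchange, each \<open>u\<close> contributes the shell integral of
        a single tube, and the unit mass of \<open>f\<close> adds these up.\<close>
      also have "\<dots> = (\<integral>\<^sup>+u. (\<integral>\<^sup>+y. tube_kernel y u * ennreal \<bar>f u\<bar> * indicator {y. \<bar>N y - \<rho>\<bar> \<le> 1} y \<partial>lborel) \<partial>\<gamma>)"
        by (rule Fubini'[symmetric]) measurable
      also have "\<dots> \<le> (\<integral>\<^sup>+u. ennreal C2 * ennreal \<bar>f u\<bar> \<partial>\<gamma>)"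
      proof (rule nn_integral_mono)
        fix u
        have "(\<integral>\<^sup>+y. tube_kernel y u * ennreal \<bar>f u\<bar> * indicator {y. \<bar>N y - \<rho>\<bar> \<le> 1} y \<partial>lborel) =
          (\<integral>\<^sup>+y. (tube_kernel y u * indicator {y. \<bar>N y - \<rho>\<bar> \<le> 1} y) * ennreal \<bar>f u\<bar> \<partial>lborel)"
          by (simp add: mult_ac)
        also have "\<dots> = (\<integral>\<^sup>+y. tube_kernel y u * indicator {y. \<bar>N y - \<rho>\<bar> \<le> 1} y \<partial>lborel) * ennreal \<bar>f u\<bar>"
          by (rule nn_integral_multc) measurable
        also have "\<dots> \<le> ennreal C2 * ennreal \<bar>f u\<bar>"
          using \<rho> by (intro mult_right_mono C2) auto
        finally show "(\<integral>\<^sup>+y. tube_kernel y u * ennreal \<bar>f u\<bar> * indicator {y. \<bar>N y - \<rho>\<bar> \<le> 1} y \<partial>lborel) \<le> ennreal C2 * ennreal \<bar>f u\<bar>" .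
      qed
      also have "\<dots> = ennreal C2 * (\<integral>\<^sup>+u. ennreal \<bar>f u\<bar> \<partial>\<gamma>)" by (rule nn_integral_cmult) measurable
      finally show ?thesis using nf by simp
    qed
    define A1 where "A1 = {x. \<rho>\<^sup>2 \<le> \<psi> x \<and> \<psi> x \<le> 2 * \<rho>\<^sup>2 \<and> exp (- \<psi> x / 2) < F x / \<beta>}"
    define A2 where "A2 = {x. 2 * \<rho>\<^sup>2 < \<psi> x}"
    have [measurable]: "A1 \<in> sets borel" "A2 \<in> sets borel" unfolding A1_def A2_def by measurable
    have sub: "{x. ou_maximal Q B f x > ereal \<alpha>} \<subseteq> A1 \<union> A2"
    proof
      fix x assume "x \<in> {x. ou_maximal Q B f x > ereal \<alpha>}"
      then obtain t where t: "t > 1" "\<bar>ou_semigroup Q B t f x\<bar> > \<alpha>" by (auto simp: ou_maximal_gt_iff)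
      have "ennreal \<bar>ou_semigroup Q B t f x\<bar> \<le> ennreal (K * exp (\<psi> x / 2)) * ennreal (F x)"
        using K(2)[OF _ f, of t x] t(1) by (simp add: F F'_def)
      also have "\<dots> = ennreal (K * exp (\<psi> x / 2) * F x)" using K(1) F0 by (intro ennreal_mult[symmetric]) auto
      finally have "\<bar>ou_semigroup Q B t f x\<bar> \<le> K * exp (\<psi> x / 2) * F x"
        using K(1) F0[of x] by (subst (asm) ennreal_le_iff) auto
      then have 1: "\<beta> < exp (\<psi> x / 2) * F x" using t(2) K(1) by (simp add: \<beta>_def field_simps)
      then have 2: "exp (- \<psi> x / 2) < F x / \<beta>" using \<beta>(1) by (simp add: exp_minus field_simps)
      have "exp (\<psi> x / 2) * F x \<le> exp (\<psi> x / 2) * 1" using F1 by (intro mult_left_mono) auto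
      with 1 have "exp (\<rho>\<^sup>2 / 2) < exp (\<psi> x / 2)" unfolding \<rho>exp by linarith
      then have "\<rho>\<^sup>2 \<le> \<psi> x" by simp
      with 2 show "x \<in> A1 \<union> A2" by (auto simp: A1_def A2_def)
    qed
    have "emeasure \<gamma> {x. ou_maximal Q B f x > ereal \<alpha>} \<le> emeasure \<gamma> (A1 \<union> A2)"
      by (rule emeasure_mono[OF sub]) simp
    also have "\<dots> = (\<integral>\<^sup>+x. ennreal c * ennreal (exp (- \<psi> x / 2)) * indicator (A1 \<union> A2) x \<partial>lborel)"
      unfolding c(2) by (rule emeasure_density) measurable
    also have "\<dots> \<le> (\<integral>\<^sup>+x. ennreal c * (ennreal (exp (- \<psi> x / 2)) * indicator A1 x + ennreal (exp (- \<psi> x / 2)) * indicator A2 x) \<partial>lborel)"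
      by (intro nn_integral_mono) (auto simp: indicator_def A1_def A2_def)
    also have "\<dots> = ennreal c * ((\<integral>\<^sup>+x. ennreal (exp (- \<psi> x / 2)) * indicator A1 x \<partial>lborel) +
        (\<integral>\<^sup>+x. ennreal (exp (- \<psi> x / 2)) * indicator A2 x \<partial>lborel))"
      using nn_integral_add[of "\<lambda>x. ennreal (exp (- \<psi> x / 2)) * indicator A1 x" lborel
          "\<lambda>x. ennreal (exp (- \<psi> x / 2)) * indicator A2 x"]
      by (simp add: nn_integral_cmult)
    also have "\<dots> \<le> ennreal c * (ennreal (C1 / (\<rho> * \<beta>)) * ennreal C2 + ennreal (C3 / (\<rho> * \<beta>)))"
    proof (intro mult_left_mono add_mono)
      have "(\<integral>\<^sup>+x. ennreal (exp (- \<psi> x / 2)) * indicator A1 x \<partial>lborel) \<le>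
        ennreal (C1 / (\<rho> * \<beta>)) * (\<integral>\<^sup>+y. ennreal (F y) * indicator {y. \<bar>N y - \<rho>\<bar> \<le> 1} y \<partial>lborel)"
        unfolding A1_def by (rule C1(2)) (use \<rho> \<beta> F0 Fmono in auto)
      also have "\<dots> \<le> ennreal (C1 / (\<rho> * \<beta>)) * ennreal C2" by (intro mult_left_mono shell) simp
      finally show "(\<integral>\<^sup>+x. ennreal (exp (- \<psi> x / 2)) * indicator A1 x \<partial>lborel) \<le> ennreal (C1 / (\<rho> * \<beta>)) * ennreal C2" .
      show "(\<integral>\<^sup>+x. ennreal (exp (- \<psi> x / 2)) * indicator A2 x \<partial>lborel) \<le> ennreal (C3 / (\<rho> * \<beta>))"
        using C3(2)[OF \<rho>] unfolding A2_def \<rho>exp .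
    qed simp
    also have "\<dots> = ennreal (c * (C1 / (\<rho> * \<beta>) * C2 + C3 / (\<rho> * \<beta>)))"
    proof -
      have "ennreal c * (ennreal p * ennreal C2 + ennreal q) = ennreal (c * (p * C2 + q))"
        if "0 \<le> p" "0 \<le> q" for p q
        using that c(1) C2(1) by (simp add: ennreal_mult)
      then show ?thesis using C1(1) C3(1) \<rho> \<beta> by simp
    qed
    also have "\<dots> \<le> ennreal (D / (\<alpha> * sqrt (ln \<alpha>)))"
    proof (rule ennreal_leI)
      have eq: "c * (C1 / (\<rho> * \<beta>) * C2 + C3 / (\<rho> * \<beta>)) = D / (\<alpha> * \<rho>)"
      proof -
        have "C1 / (\<rho> * \<beta>) * C2 + C3 / (\<rho> * \<beta>) = (C1 * C2 + C3) / (\<rho> * \<beta>)"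
          by (simp add: add_divide_distrib)
        moreover have "\<rho> * \<beta> = \<alpha> * \<rho> / K" by (simp add: \<beta>_def)
        ultimately show ?thesis by (simp add: D_def)
      qed
      have la: "ln \<alpha> > 0" using a0 \<alpha> by simp
      have "K\<^sup>2 \<le> \<alpha>" using a0 \<alpha> by simp
      then have "ln (K\<^sup>2) \<le> ln \<alpha>" using K(1) \<alpha>0 by (subst ln_le_cancel_iff) auto
      then have "2 * ln K \<le> ln \<alpha>" using K(1) by (simp add: ln_realpow)
      moreover have "ln \<beta> = ln \<alpha> - ln K" using K(1) \<alpha>0 by (simp add: \<beta>_def ln_div)
      ultimately have "ln \<alpha> \<le> 2 * ln \<beta>" by simp
      then have "sqrt (ln \<alpha>) \<le> \<rho>" unfolding \<rho>_def by (rule real_sqrt_le_mono)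
      then show "c * (C1 / (\<rho> * \<beta>) * C2 + C3 / (\<rho> * \<beta>)) \<le> D / (\<alpha> * sqrt (ln \<alpha>))"
        unfolding eq using D \<alpha>0 \<rho> la by (intro divide_left_mono mult_left_mono) auto
    qed
    finally show ?thesis .
  qed
  from that[OF D a0(1) main] show ?thesis .
qed

text \<open>Levels between 2 and the threshold are covered by the total mass of
  \<open>\<gamma>\<close>, because \<open>\<alpha> * sqrt (ln \<alpha>)\<close> is bounded
  there.\<close>

lemma ou_maximal_level_bound:
  "\<exists>C\<ge>0. \<forall>f \<alpha>. integrable \<gamma> f \<longrightarrow> (LINT x|\<gamma>. \<bar>f x\<bar>) = 1 \<longrightarrow> \<alpha> > 2 \<longrightarrow>
     emeasure \<gamma> {x. ou_maximal Q B f x > ereal \<alpha>} \<le> ennreal (C / (\<alpha> * sqrt (ln \<alpha>)))"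
proof -
  obtain C a where C: "C \<ge> 0" "a > 2"
    "\<And>f \<alpha>. integrable \<gamma> f \<Longrightarrow> (LINT x|\<gamma>. \<bar>f x\<bar>) = 1 \<Longrightarrow> \<alpha> \<ge> a \<Longrightarrow>
       emeasure \<gamma> {x. ou_maximal Q B f x > ereal \<alpha>} \<le> ennreal (C / (\<alpha> * sqrt (ln \<alpha>)))"
    by (rule ou_maximal_large_level_bound, rule that)
  obtain G where G: "G \<ge> 0" "emeasure \<gamma> UNIV = ennreal G"
    using emeasure_\<gamma>_finite by (metis enn2real_nonneg ennreal_enn2real infinity_ennreal_def)
  define D where "D = C + G * (a * sqrt (ln a))"
  have GD: "G * (a * sqrt (ln a)) \<ge> 0" using G C by simp
  have "emeasure \<gamma> {x. ou_maximal Q B f x > ereal \<alpha>} \<le> ennreal (D / (\<alpha> * sqrt (ln \<alpha>)))"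
    if f: "integrable \<gamma> f" "(LINT x|\<gamma>. \<bar>f x\<bar>) = 1" and \<alpha>: "\<alpha> > 2" for f \<alpha>
  proof -
    have pos: "\<alpha> * sqrt (ln \<alpha>) > 0" using \<alpha> by simp
    show ?thesis
    proof (cases "\<alpha> \<ge> a")
      case True
      have "C / (\<alpha> * sqrt (ln \<alpha>)) \<le> D / (\<alpha> * sqrt (ln \<alpha>))"
        using GD pos by (intro divide_right_mono) (auto simp: D_def)
      then show ?thesis by (rule order_trans[OF C(3)[OF f True] ennreal_leI])
    next
      case False
      have "emeasure \<gamma> {x. ou_maximal Q B f x > ereal \<alpha>} \<le> emeasure \<gamma> UNIV"
        by (rule emeasure_mono) simp_all
      also have "\<dots> = ennreal G" by (rule G)
      also have "\<dots> \<le> ennreal (D / (\<alpha> * sqrt (ln \<alpha>)))"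
      proof (rule ennreal_leI)
        have "\<alpha> * sqrt (ln \<alpha>) \<le> a * sqrt (ln a)"
          using False \<alpha> by (intro mult_mono real_sqrt_le_mono) auto
        then have "G * (\<alpha> * sqrt (ln \<alpha>)) \<le> G * (a * sqrt (ln a))"
          using G(1) by (rule mult_left_mono)
        also have "\<dots> \<le> D" using C(1) by (simp add: D_def)
        finally show "G \<le> D / (\<alpha> * sqrt (ln \<alpha>))" using pos by (simp only: pos_le_divide_eq)
      qed
      finally show ?thesis .
    qed
  qed
  moreover have "D \<ge> 0" using GD C by (simp add: D_def)
  ultimately show ?thesis by blast
qed

text \<open>Homogeneity reduces to norm 1 at the level \<open>\<alpha> / m\<close>. Above 2 the
  logarithm is at least \<open>ln 2\<close>, which gives the first term of \<open>D\<close>; up to 2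
  one has \<open>1 \<le> 2 * m / \<alpha>\<close>, and the total mass gives the second.\<close>

lemma ou_maximal_weak_type: "weak_type_1_1 \<gamma> (ou_maximal Q B)"
proof -
  obtain C where C: "C \<ge> 0"
    "\<And>f \<alpha>. integrable \<gamma> f \<Longrightarrow> (LINT x|\<gamma>. \<bar>f x\<bar>) = 1 \<Longrightarrow> \<alpha> > 2 \<Longrightarrow>
       emeasure \<gamma> {x. ou_maximal Q B f x > ereal \<alpha>} \<le> ennreal (C / (\<alpha> * sqrt (ln \<alpha>)))"
    using ou_maximal_level_bound by blast
  obtain G where G: "G \<ge> 0" "emeasure \<gamma> UNIV = ennreal G"
    using emeasure_\<gamma>_finite by (metis enn2real_nonneg ennreal_enn2real infinity_ennreal_def)
  define D where "D = C / sqrt (ln 2) + 2 * G"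
  have l2: "sqrt (ln 2) > (0::real)" by simp
  have D: "D \<ge> 0" using C G by (simp add: D_def)
  have "emeasure \<gamma> {x. ou_maximal Q B f x > ereal \<alpha>} \<le> ennreal (D / \<alpha> * (LINT x|\<gamma>. \<bar>f x\<bar>))"
    if f: "integrable \<gamma> f" and \<alpha>: "\<alpha> > 0" for f \<alpha>
  proof -
    define m where "m = (LINT x|\<gamma>. \<bar>f x\<bar>)"
    have m0: "m \<ge> 0" by (simp add: m_def)
    consider "m = 0" | "m > 0" "\<alpha> / m > 2" | "m > 0" "\<alpha> / m \<le> 2" using m0 by force
    then have "emeasure \<gamma> {x. ou_maximal Q B f x > ereal \<alpha>} \<le> ennreal (D / \<alpha> * m)"
    proof cases
      case 1
      have "AE x in \<gamma>. \<bar>f x\<bar> = 0"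
        using 1 f unfolding m_def by (subst (asm) integral_nonneg_eq_0_iff_AE) auto
      \<comment> \<open>The exceptional null set concerns \<open>u\<close> only, so the semigroup
        vanishes at every \<open>x\<close> and the level set is empty.\<close>
      then have "AE u in \<gamma>. mehler_kernel Q B t x u * f u = 0" for t x by eventually_elim simp
      then have "ou_semigroup Q B t f x = 0" for t x
        unfolding ou_semigroup_def by (rule integral_eq_zero_AE)
      then have "{x. ou_maximal Q B f x > ereal \<alpha>} = {}"
        using \<alpha> by (auto simp: ou_maximal_gt_iff)
      then show ?thesis by simp
    next
      case 2
      have g: "integrable \<gamma> (\<lambda>x. f x / m)" using f by simp
      have "(LINT x|\<gamma>. \<bar>f x / m\<bar>) = (LINT x|\<gamma>. \<bar>f x\<bar> / m)" using 2 by simp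
      then have g1: "(LINT x|\<gamma>. \<bar>f x / m\<bar>) = 1" using 2 by (simp add: m_def)
      have "ou_semigroup Q B t (\<lambda>x. f x / m) x = ou_semigroup Q B t f x / m" for t x
        by (simp add: ou_semigroup_def)
      then have "{x. ou_maximal Q B f x > ereal \<alpha>} = {x. ou_maximal Q B (\<lambda>x. f x / m) x > ereal (\<alpha> / m)}"
        using 2 by (auto simp: ou_maximal_gt_iff divide_less_cancel)
      then have "emeasure \<gamma> {x. ou_maximal Q B f x > ereal \<alpha>} \<le> ennreal (C / ((\<alpha> / m) * sqrt (ln (\<alpha> / m))))"
        using C(2)[OF g g1 2(2)] by simp
      also have "\<dots> \<le> ennreal (D / \<alpha> * m)"
      proof (rule ennreal_leI)
        have "m < \<alpha>" using 2 by (simp add: less_divide_eq)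
        have "sqrt (ln 2) \<le> sqrt (ln (\<alpha> / m))" using 2 by (intro real_sqrt_le_mono) auto
        then have "C / ((\<alpha> / m) * sqrt (ln (\<alpha> / m))) \<le> C / ((\<alpha> / m) * sqrt (ln 2))"
          using C(1) 2 \<alpha> l2 \<open>m < \<alpha>\<close> by (intro divide_left_mono mult_left_mono mult_pos_pos) auto
        also have "\<dots> = C / sqrt (ln 2) / \<alpha> * m" using 2 by simp
        also have "\<dots> \<le> D / \<alpha> * m"
          using G(1) \<alpha> 2 by (intro mult_right_mono divide_right_mono) (auto simp: D_def)
        finally show "C / ((\<alpha> / m) * sqrt (ln (\<alpha> / m))) \<le> D / \<alpha> * m" .
      qed
      finally show ?thesis .
    next
      case 3
      have "emeasure \<gamma> {x. ou_maximal Q B f x > ereal \<alpha>} \<le> emeasure \<gamma> UNIV"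
        by (rule emeasure_mono) simp_all
      also have "\<dots> = ennreal G" by (rule G)
      also have "\<dots> \<le> ennreal (D / \<alpha> * m)"
      proof (rule ennreal_leI)
        have "\<alpha> \<le> 2 * m" using 3 by (simp add: divide_le_eq)
        then have "G * \<alpha> \<le> G * (2 * m)" using G(1) by (rule mult_left_mono)
        also have "\<dots> \<le> D * m"
          using mult_right_mono[of "2 * G" D m] C(1) l2 m0 by (simp add: D_def mult_ac)
        finally show "G \<le> D / \<alpha> * m" using \<alpha> by (simp add: field_simps)
      qed
      finally show ?thesis .
    qed
    then show ?thesis by (simp add: m_def)
  qed
  then show ?thesis
    unfolding weak_type_1_1_def using D ou_maximal_level_sets by auto
qed

end

theorem proposition6p1:
  fixes Q B :: "real^'n^'n"
  assumes "transpose Q = Q"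
    and "positive_definite Q"
    and "\<And>z. complex_eigenvalue B z \<Longrightarrow> Re z < 0"
  shows "(\<exists>C\<ge>0. \<forall>(f :: real^'n \<Rightarrow> real) (\<alpha>::real).
            integrable (ou_gauss Q B \<infinity>) f \<longrightarrow>
            (LINT x|ou_gauss Q B \<infinity>. \<bar>f x\<bar>) = 1 \<longrightarrow>
            \<alpha> > 2 \<longrightarrow>
            {x. ou_maximal Q B f x > ereal \<alpha>} \<in> sets (ou_gauss Q B \<infinity>) \<and>
            emeasure (ou_gauss Q B \<infinity>) {x. ou_maximal Q B f x > ereal \<alpha>}
              \<le> ennreal (C / (\<alpha> * sqrt (ln \<alpha>))))
       \<and> weak_type_1_1 (ou_gauss Q B \<infinity>) (ou_maximal Q B)"
proof -
  interpret ornstein_uhlenbeck Q B by unfold_locales (fact assms)+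
  obtain C where C: "C \<ge> 0" "\<And>f \<alpha>. integrable (ou_gauss Q B \<infinity>) f \<Longrightarrow>
      (LINT x|ou_gauss Q B \<infinity>. \<bar>f x\<bar>) = 1 \<Longrightarrow> \<alpha> > 2 \<Longrightarrow>
      emeasure (ou_gauss Q B \<infinity>) {x. ou_maximal Q B f x > ereal \<alpha>} \<le> ennreal (C / (\<alpha> * sqrt (ln \<alpha>)))"
    using ou_maximal_level_bound by blast
  show ?thesis
    by (intro conjI exI[of _ C] allI impI C ou_maximal_level_sets ou_maximal_weak_type)
qed

end
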